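(* Suppose that $\mathcal M=\{m_\theta:\theta\in\Theta\}$ is $P_0$-Glivenko-Cantelli, and that for every $\epsilon>0$, $$P_0m_{\theta_0}>\sup_{\theta:\lVert\theta-\theta_0\rVert>\epsilon}P_0m_\theta .$$ Let $\hat\theta_N=\arg\max_{\theta\in\Theta}\mathbb P_N^{\mathrm H}m_\theta(X)$. Then, as $N\to\infty$, $$\lVert\hat\theta_N-\theta_0\rVert\to_{P^*}0 .$$
   Context: Setting. $X$ takes values in a measurable space $(\mathcal{X},\mathcal{A})$ and has law $P_0=P_{\theta_0}$, a member of a collection of probability measures $\{P_\theta:\theta\in\Theta\}$ on $(\mathcal X,\mathcal A)$, where $\Theta$ is a subset of a Banach space $(\mathcal B,\lVert\cdot\rVert)$ and $\theta_0\in\Theta$. The $m_\theta:\mathcal X\to\mathbb R$ are criterion functions. $U\in\mathcal U$ is a vector of auxiliary variables, $W=(X,U)$ has law $\tilde P_0$, and $V=(\check X,U)\in\mathcal V$, where $\check X$ is a coarsening (measurable function) of $X$. $\mathcal V=\bigcup_{j=1}^J\mathcal V^{(j)}$ is a union of $J$ measurable, possibly overlapping data sources. $Qf=\int f\,dQ$. Sampling. $W_1,\dots,W_N$ are i.i.d. copies of $W$ with corresponding $X_i,V_i$; $N^{(j)}=\#\{i\le N:V_i\in\mathcal V^{(j)}\}$. From each source $j$ a simple random sample of size $n^{(j)}\le N^{(j)}$ ($n^{(j)}$ random, through $N^{(j)}$) is drawn without replacement from the units with $V_i\in\mathcal V^{(j)}$, independently across sources given the data; $R_i^{(j)}$ is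 the selection indicator ($0$ if $V_i\notin\mathcal V^{(j)}$); $\pi^{(j)}(V_i)=(n^{(j)}/N^{(j)})I\{V_i\in\mathcal V^{(j)}\}$, convention $0/0=0$; $n^{(j)}/N^{(j)}\to p^{(j)}\ge c>0$ as $N\to\infty$. Weight function. $\rho=(\rho^{(1)},\dots,\rho^{(J)}):\mathcal V\to[0,1]^J$ is fixed, constant on each of the disjoint regions of $\mathcal V$ determined by which of the sources contain $v$, with $\rho^{(j)}(v)=0$ if $v\notin\mathcal V^{(j)}$, $\rho^{(j)}(v)=1$ if $v$ belongs to $\mathcal V^{(j)}$ only, and $\sum_{j}\rho^{(j)}(v)=1$. H-empirical measure. $\mathbb P_N^{\mathrm H}f=\frac1N\sum_{i=1}^N\sum_{j=1}^J\frac{R_i^{(j)}\rho^{(j)}(V_i)}{\pi^{(j)}(V_i)}f(X_i)$. $\to_{P^*}$ is convergence in outer probability (for the joint law of data and sampling indicators). "$P_0$-Glivenko-Cantelli" is the usual i.i.d. notion. *)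

theory Defs
  imports "HOL-Probability.Probability"
begin

section \<open>Convergence modes for possibly non-measurable quantities\<close>

definition converges_in_outer_prob_0 :: "'w measure \<Rightarrow> (nat \<Rightarrow> 'w \<Rightarrow> real) \<Rightarrow> bool" where
  "converges_in_outer_prob_0 M Y \<longleftrightarrow>
     (\<forall>\<epsilon>>0. (\<lambda>n. outer_measure_of M {\<omega> \<in> space M. \<epsilon> < \<bar>Y n \<omega>\<bar>}) \<longlonglongrightarrow> 0)"

text \<open>
  Outer almost sure convergence to zero: domination by measurable majorants that vanish
  almost surely.
\<close>
definition converges_outer_AE_0 :: "'w measure \<Rightarrow> (nat \<Rightarrow> 'w \<Rightarrow> ennreal) \<Rightarrow> bool" where
  "converges_outer_AE_0 M Z \<longleftrightarrow>
     (\<exists>\<Delta>. (\<forall>n. \<Delta> n \<in> borel_measurable M) \<and>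
          (\<forall>n. \<forall>\<omega>\<in>space M. Z n \<omega> \<le> \<Delta> n \<omega>) \<and>
          (AE \<omega> in M. (\<lambda>n. \<Delta> n \<omega>) \<longlonglongrightarrow> 0))"

section \<open>Glivenko-Cantelli classes\<close>

definition empirical :: "nat \<Rightarrow> (nat \<Rightarrow> 'x) \<Rightarrow> ('x \<Rightarrow> real) \<Rightarrow> real" where
  "empirical n x f = (\<Sum>i<n. f (x i)) / real n"

text \<open>
  The i.i.d. sample consists of the coordinate projections of the infinite product space.
  The supremum is taken in \<^typ>\<open>ennreal\<close>, so it is meaningful when infinite.
\<close>
definition glivenko_cantelli :: "'x measure \<Rightarrow> ('x \<Rightarrow> real) set \<Rightarrow> bool" where
  "glivenko_cantelli P F \<longleftrightarrow>
     (\<forall>f\<in>F. integrable P f) \<and>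
     converges_outer_AE_0 (\<Pi>\<^sub>M i\<in>(UNIV :: nat set). P)
       (\<lambda>n x. SUP f\<in>F. ennreal \<bar>empirical n x f - (\<integral>z. f z \<partial>P)\<bar>)"

section \<open>Merged data from multiple sources\<close>

text \<open>
  Sources are indexed by \<open>j < J\<close> and units by \<open>i < N\<close>. \<open>src j\<close> is the \<open>j\<close>-th data source,
  \<open>size N j k\<close> is the size of the sample taken from source \<open>j\<close> when \<open>k\<close> of the \<open>N\<close> units belong
  to it, and \<open>S N j\<close> is the random set of labels of the units selected from source \<open>j\<close>.
\<close>
locale merged_data =
  fixes coarsen :: "'x \<Rightarrow> 'c"
    and W :: "nat \<Rightarrow> 'w \<Rightarrow> 'x \<times> 'u"
    and src :: "nat \<Rightarrow> ('c \<times> 'u) set"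
    and size :: "nat \<Rightarrow> nat \<Rightarrow> nat \<Rightarrow> nat"
    and S :: "nat \<Rightarrow> nat \<Rightarrow> 'w \<Rightarrow> nat set"
begin

definition V_of :: "'x \<times> 'u \<Rightarrow> 'c \<times> 'u" where
  "V_of w = (coarsen (fst w), snd w)"

definition X :: "nat \<Rightarrow> 'w \<Rightarrow> 'x" where
  "X i \<omega> = fst (W i \<omega>)"

definition V :: "nat \<Rightarrow> 'w \<Rightarrow> 'c \<times> 'u" where
  "V i \<omega> = V_of (W i \<omega>)"

definition units :: "nat \<Rightarrow> nat \<Rightarrow> 'w \<Rightarrow> nat set" where
  "units N j \<omega> = {i \<in> {..<N}. V i \<omega> \<in> src j}"

definition N_src :: "nat \<Rightarrow> nat \<Rightarrow> 'w \<Rightarrow> nat" where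
  "N_src N j \<omega> = card (units N j \<omega>)"

definition n_src :: "nat \<Rightarrow> nat \<Rightarrow> 'w \<Rightarrow> nat" where
  "n_src N j \<omega> = size N j (N_src N j \<omega>)"

definition R :: "nat \<Rightarrow> nat \<Rightarrow> nat \<Rightarrow> 'w \<Rightarrow> real" where
  "R N j i \<omega> = indicator (S N j \<omega>) i"

definition sel_prob :: "nat \<Rightarrow> nat \<Rightarrow> 'w \<Rightarrow> 'c \<times> 'u \<Rightarrow> real" where
  "sel_prob N j \<omega> v = real (n_src N j \<omega>) / real (N_src N j \<omega>) * indicator (src j) v"

definition H_empirical ::
  "nat \<Rightarrow> (nat \<Rightarrow> 'c \<times> 'u \<Rightarrow> real) \<Rightarrow> nat \<Rightarrow> 'w \<Rightarrow> ('x \<Rightarrow> real) \<Rightarrow> real" where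
  "H_empirical J \<rho> N \<omega> f =
     (\<Sum>i<N. \<Sum>j<J. R N j i \<omega> * \<rho> j (V i \<omega>) / sel_prob N j \<omega> (V i \<omega>) * f (X i \<omega>)) / real N"

end

definition weight_function ::
  "nat \<Rightarrow> (nat \<Rightarrow> 'v set) \<Rightarrow> (nat \<Rightarrow> 'v \<Rightarrow> real) \<Rightarrow> bool" where
  "weight_function J src \<rho> \<longleftrightarrow>
     (\<forall>v \<in> (\<Union>j<J. src j).
        (\<forall>j<J. 0 \<le> \<rho> j v \<and> \<rho> j v \<le> 1) \<and>
        (\<forall>j<J. v \<notin> src j \<longrightarrow> \<rho> j v = 0) \<and>
        (\<forall>j<J. v \<in> src j \<and> (\<forall>k<J. k \<noteq> j \<longrightarrow> v \<notin> src k) \<longrightarrow> \<rho> j v = 1) \<and>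
        (\<Sum>j<J. \<rho> j v) = 1) \<and>
     (\<forall>v \<in> (\<Union>j<J. src j). \<forall>v' \<in> (\<Union>j<J. src j).
        (\<forall>j<J. v \<in> src j \<longleftrightarrow> v' \<in> src j) \<longrightarrow> (\<forall>j<J. \<rho> j v = \<rho> j v'))"

text \<open>
  \<open>MX\<close>, \<open>MU\<close>, \<open>MC\<close> are the measurable spaces of \<open>X\<close>, of the auxiliary variables and of the
  coarsening of \<open>X\<close>; \<open>Pt\<close> is the law of \<open>W = (X, U)\<close>.
\<close>
locale merged_sampling = prob_space M + merged_data coarsen W src size S
  for M :: "'w measure"
    and coarsen :: "'x \<Rightarrow> 'c"
    and W :: "nat \<Rightarrow> 'w \<Rightarrow> 'x \<times> 'u"
    and src :: "nat \<Rightarrow> ('c \<times> 'u) set"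
    and size :: "nat \<Rightarrow> nat \<Rightarrow> nat \<Rightarrow> nat"
    and S :: "nat \<Rightarrow> nat \<Rightarrow> 'w \<Rightarrow> nat set" +
  fixes MX :: "'x measure" and MU :: "'u measure" and MC :: "'c measure"
    and Pt :: "('x \<times> 'u) measure"
    and J :: nat
    and \<rho> :: "nat \<Rightarrow> 'c \<times> 'u \<Rightarrow> real"
    and p :: "nat \<Rightarrow> real" and c :: real
  assumes coarsen_measurable: "coarsen \<in> MX \<rightarrow>\<^sub>M MC"
    and iid_indep: "indep_vars (\<lambda>_. MX \<Otimes>\<^sub>M MU) W UNIV"
    and iid_law: "\<And>i. distr M (MX \<Otimes>\<^sub>M MU) (W i) = Pt"
    and src_measurable: "\<And>j. j < J \<Longrightarrow> src j \<in> sets (MC \<Otimes>\<^sub>M MU)"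
    and V_in_union: "AE w in Pt. V_of w \<in> (\<Union>j<J. src j)"
    and weights: "weight_function J src \<rho>"
    and size_le: "\<And>N j k. j < J \<Longrightarrow> size N j k \<le> k"
    and S_measurable: "\<And>N j. j < J \<Longrightarrow> S N j \<in> M \<rightarrow>\<^sub>M count_space (Pow {..<N})"
    \<comment> \<open>Conditionally on \<open>W\<^sub>0, \<dots>, W\<^sub>N\<^sub>-\<^sub>1\<close> the selected sets are independent
        across the sources, and the one from source \<open>j\<close> is uniformly distributed on the subsets of
        size \<open>n_src N j\<close> of \<open>units N j\<close>.\<close>
    and simple_random_sampling:
      "\<And>N A s. A \<in> sets (\<Pi>\<^sub>M i\<in>{..<N}. MX \<Otimes>\<^sub>M MU) \<Longrightarrow> (\<And>j. j < J \<Longrightarrow> s j \<subseteq> {..<N}) \<Longrightarrow>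
         prob {\<omega> \<in> space M. (\<lambda>i\<in>{..<N}. W i \<omega>) \<in> A \<and> (\<forall>j<J. S N j \<omega> = s j)} =
         (\<integral>\<omega>. indicator A (\<lambda>i\<in>{..<N}. W i \<omega>) *
            (\<Prod>j<J. pmf (pmf_of_set {T. T \<subseteq> units N j \<omega> \<and> card T = n_src N j \<omega>}) (s j)) \<partial>M)"
    and c_pos: "0 < c"
    and p_ge: "\<And>j. j < J \<Longrightarrow> c \<le> p j"
    \<comment> \<open>The sampling fractions are random, and converge in probability.\<close>
    and fraction_tendsto: "\<And>j. j < J \<Longrightarrow> converges_in_outer_prob_0 M
         (\<lambda>N \<omega>. real (n_src N j \<omega>) / real (N_src N j \<omega>) - p j)"

end

theory Submission
  imports Defs
begin

text \<open>
  Write \<open>H\<close> for the H-empirical measure and \<open>g \<theta> = m \<theta> - \<integral>m \<theta>\<close>. Almost sure uniform convergence forces an integrable envelope of the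
  \<open>g \<theta>\<close>, so that the Glivenko-Cantelli property also holds in the mean. Units in a set \<open>A\<close> are then
  redrawn independently from the law of \<open>W\<close> conditioned on \<open>A\<close>. This changes neither the law of the data
  nor the sampling probabilities of a source \<open>j\<close>, provided that \<open>A\<close> is contained in source \<open>j\<close>; averaging
  over the new values compares sums over the redrawn units with multiples of conditional means.
  With all units in a region of constant weights redrawn, this shows that multiplication by the weights
  \<open>\<rho> j\<close> preserves the Glivenko-Cantelli property; with the sampled units of source \<open>j\<close> redrawn, it
  gives the uniform convergence of the weighted average over the sample.

  The \<open>\<integral>m \<theta>\<close> may be unbounded below and the inverse sampling weights do not sum to \<open>1\<close>, so \<open>H f\<close> need
  not converge uniformly to \<open>\<integral>f\<close> over the \<open>m \<theta>\<close>. It does over the \<open>g \<theta>\<close>, and \<open>H 1\<close> tends to \<open>1\<close>, so the claim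
  follows from \<open>H (m \<theta>\<^sub>0) - H (m \<theta>) = H (g \<theta>\<^sub>0) - H (g \<theta>) + H 1 * (\<integral>m \<theta>\<^sub>0 - \<integral>m \<theta>)\<close>.
\<close>

section \<open>Redrawing coordinates of a product measure\<close>

text \<open>Suprema over the class need not be measurable, so they have no conditional expectations.
  Every bound is therefore carried by a measurable majorant that serves the whole class, and
  redrawing is applied to this majorant. Redrawing produces a new majorant of which only integrals
  are known. This is why the argument runs through convergence in the mean, where equality of
  integrals suffices, and returns to outer probability at the end by Markov's inequality.

  The envelope is used twice: for uniform integrability, and to bound the conditional means of the
  \<open>g \<theta>\<close> given a region or a source uniformly in \<open>\<theta>\<close>. The
  error of an observed frequency is multiplied by such a conditional mean, and the product has to be
  small uniformly over the class.\<close>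

lemma nn_integral_PiM_update:
  assumes Q: "prob_space Q" and i: "i \<in> I"
    and f[measurable]: "f \<in> borel_measurable (\<Pi>\<^sub>M i\<in>I. Q)"
  shows "(\<integral>\<^sup>+w. f w \<partial>(\<Pi>\<^sub>M i\<in>I. Q)) = (\<integral>\<^sup>+w. \<integral>\<^sup>+t. f (w(i := t)) \<partial>Q \<partial>(\<Pi>\<^sub>M i\<in>I. Q))"
    and "(\<integral>\<^sup>+w. f w \<partial>(\<Pi>\<^sub>M i\<in>I. Q)) = (\<integral>\<^sup>+t. \<integral>\<^sup>+w. f (w(i := t)) \<partial>(\<Pi>\<^sub>M i\<in>I. Q) \<partial>Q)"
proof -
  interpret Q: prob_space Q by fact
  interpret I: prob_space "\<Pi>\<^sub>M i\<in>I. Q" by (intro prob_space_PiM Q)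
  interpret PS: pair_sigma_finite Q "\<Pi>\<^sub>M i\<in>I. Q" ..
  have ins: "insert i I = I" using i by auto
  have upd[measurable]: "(\<lambda>(x, w). w(i := x)) \<in> Q \<Otimes>\<^sub>M (\<Pi>\<^sub>M i\<in>I. Q) \<rightarrow>\<^sub>M (\<Pi>\<^sub>M i\<in>I. Q)"
    unfolding split_beta by (rule measurable_fun_upd[where J=I]) (use i in auto)
  \<comment> \<open>Insertion of an independent coordinate, used with \<open>i\<close> already in
    \<open>I\<close>: the update overwrites the old value, and
    \<open>insert i I = I\<close>.\<close>
  have eq: "distr (Q \<Otimes>\<^sub>M (\<Pi>\<^sub>M i\<in>I. Q)) (\<Pi>\<^sub>M i\<in>I. Q) (\<lambda>(x, w). w(i := x)) = (\<Pi>\<^sub>M i\<in>I. Q)"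
    using distr_pair_PiM_eq_PiM[of I "\<lambda>_. Q" i] Q unfolding ins by simp
  have "(\<integral>\<^sup>+w. f w \<partial>(\<Pi>\<^sub>M i\<in>I. Q)) = (\<integral>\<^sup>+z. (case z of (x, w) \<Rightarrow> f (w(i := x))) \<partial>(Q \<Otimes>\<^sub>M (\<Pi>\<^sub>M i\<in>I. Q)))"
    by (subst eq[symmetric], subst nn_integral_distr) (auto simp: split_beta intro!: nn_integral_cong)
  moreover have m[measurable]: "(\<lambda>z. case z of (x, w) \<Rightarrow> f (w(i := x))) \<in> borel_measurable (Q \<Otimes>\<^sub>M (\<Pi>\<^sub>M i\<in>I. Q))"
    using measurable_compose[OF upd f] by (simp add: split_beta)
  ultimately show "(\<integral>\<^sup>+w. f w \<partial>(\<Pi>\<^sub>M i\<in>I. Q)) = (\<integral>\<^sup>+w. \<integral>\<^sup>+t. f (w(i := t)) \<partial>Q \<partial>(\<Pi>\<^sub>M i\<in>I. Q))"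
    and "(\<integral>\<^sup>+w. f w \<partial>(\<Pi>\<^sub>M i\<in>I. Q)) = (\<integral>\<^sup>+t. \<integral>\<^sup>+w. f (w(i := t)) \<partial>(\<Pi>\<^sub>M i\<in>I. Q) \<partial>Q)"
    using PS.nn_integral_snd[OF m] I.nn_integral_fst[OF m] by simp_all
qed

text \<open>Total expectation over \<open>A\<close> and its complement: on \<open>A\<close> the
  inner integral is the constant conditional mean, and multiplying it by the mass of
  \<open>A\<close> restores the integral over \<open>A\<close>.\<close>

lemma nn_integral_resample_on:
  assumes Q: "prob_space Q" and A[measurable]: "A \<in> sets Q" and pos: "emeasure Q A \<noteq> 0"
    and f[measurable]: "f \<in> borel_measurable Q"
  shows "(\<integral>\<^sup>+z. \<integral>\<^sup>+t. f (if z \<in> A then t else z) \<partial>uniform_measure Q A \<partial>Q) = (\<integral>\<^sup>+z. f z \<partial>Q)"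
proof -
  interpret Q: prob_space Q by fact
  interpret U: prob_space "uniform_measure Q A"
    using pos by (intro prob_space_uniform_measure) auto
  have one: "emeasure Q A / emeasure Q A = 1"
    using pos by (simp add: ennreal_divide_self less_top[symmetric])
  have "(\<integral>\<^sup>+z. \<integral>\<^sup>+t. f (if z \<in> A then t else z) \<partial>uniform_measure Q A \<partial>Q)
      = (\<integral>\<^sup>+z. (\<integral>\<^sup>+t. f t \<partial>uniform_measure Q A) * indicator A z + f z * indicator (space Q - A) z \<partial>Q)"
    by (intro nn_integral_cong) (use pos in \<open>auto simp: ennreal_divide_self less_top[symmetric] split: split_indicator\<close>)
  also have "\<dots> = (\<integral>\<^sup>+t. f t \<partial>uniform_measure Q A) * emeasure Q A + (\<integral>\<^sup>+z. f z * indicator (space Q - A) z \<partial>Q)"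
    by (subst nn_integral_add) (auto simp: nn_integral_cmult)
  also have "(\<integral>\<^sup>+t. f t \<partial>uniform_measure Q A) * emeasure Q A = (\<integral>\<^sup>+z. f z * indicator A z \<partial>Q)"
    using pos by (subst nn_integral_uniform_measure) (auto simp: ennreal_divide_times one)
  also have "\<dots> + (\<integral>\<^sup>+z. f z * indicator (space Q - A) z \<partial>Q) = (\<integral>\<^sup>+z. f z \<partial>Q)"
    by (subst nn_integral_add[symmetric]) (auto intro!: nn_integral_cong split: split_indicator)
  finally show ?thesis .
qed

lemma measurable_resample:
  assumes [measurable]: "A \<in> sets Q" and "i \<in> I"
  shows "(\<lambda>(w, t). w(i := if w i \<in> A then t else w i)) \<in> (\<Pi>\<^sub>M i\<in>I. Q) \<Otimes>\<^sub>M uniform_measure Q A \<rightarrow>\<^sub>M (\<Pi>\<^sub>M i\<in>I. Q)"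
proof -
  have s: "sets ((\<Pi>\<^sub>M i\<in>I. Q) \<Otimes>\<^sub>M uniform_measure Q A) = sets ((\<Pi>\<^sub>M i\<in>I. Q) \<Otimes>\<^sub>M Q)"
    by (intro sets_pair_measure_cong) auto
  have [measurable]: "(\<lambda>x. fst x i) \<in> (\<Pi>\<^sub>M i\<in>I. Q) \<Otimes>\<^sub>M Q \<rightarrow>\<^sub>M Q"
    using \<open>i \<in> I\<close> by simp
  show ?thesis
    unfolding split_beta
    by (subst measurable_cong_sets[OF s refl], rule measurable_fun_upd[where J=I]) (use assms in auto)
qed

lemma nn_integral_resample:
  assumes Q: "prob_space Q" and A[measurable]: "A \<in> sets Q" and pos: "emeasure Q A \<noteq> 0"
    and i: "i \<in> I" and f[measurable]: "f \<in> borel_measurable (\<Pi>\<^sub>M i\<in>I. Q)"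
  shows "(\<integral>\<^sup>+w. \<integral>\<^sup>+t. f (w(i := if w i \<in> A then t else w i)) \<partial>uniform_measure Q A \<partial>(\<Pi>\<^sub>M i\<in>I. Q))
    = (\<integral>\<^sup>+w. f w \<partial>(\<Pi>\<^sub>M i\<in>I. Q))"
proof -
  interpret Q: prob_space Q by fact
  interpret U: prob_space "uniform_measure Q A"
    using pos by (intro prob_space_uniform_measure) auto
  have m: "(\<lambda>(w, t). f (w(i := if w i \<in> A then t else w i))) \<in> borel_measurable ((\<Pi>\<^sub>M i\<in>I. Q) \<Otimes>\<^sub>M uniform_measure Q A)"
    using measurable_compose[OF measurable_resample[OF A i] f] by (simp add: split_beta)
  have m2: "(\<lambda>w. \<integral>\<^sup>+t. f (w(i := if w i \<in> A then t else w i)) \<partial>uniform_measure Q A) \<in> borel_measurable (\<Pi>\<^sub>M i\<in>I. Q)"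
    using U.borel_measurable_nn_integral[OF m] by simp
  \<comment> \<open>Exposing coordinate \<open>i\<close> as a variable \<open>z\<close> of law
    \<open>Q\<close> reduces the claim to the redrawing of a single variable, with the other
    coordinates fixed.\<close>
  have "(\<integral>\<^sup>+w. \<integral>\<^sup>+t. f (w(i := if w i \<in> A then t else w i)) \<partial>uniform_measure Q A \<partial>(\<Pi>\<^sub>M i\<in>I. Q))
     = (\<integral>\<^sup>+w. \<integral>\<^sup>+z. \<integral>\<^sup>+t. f (w(i := if z \<in> A then t else z)) \<partial>uniform_measure Q A \<partial>Q \<partial>(\<Pi>\<^sub>M i\<in>I. Q))"
    by (subst nn_integral_PiM_update(1)[OF Q i m2]) (simp cong: if_cong)
  also have "\<dots> = (\<integral>\<^sup>+w. \<integral>\<^sup>+z. f (w(i := z)) \<partial>Q \<partial>(\<Pi>\<^sub>M i\<in>I. Q))"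
  proof (rule nn_integral_cong)
    fix w assume w: "w \<in> space (\<Pi>\<^sub>M i\<in>I. Q)"
    have "(\<lambda>t. w(i := t)) \<in> Q \<rightarrow>\<^sub>M (\<Pi>\<^sub>M i\<in>I. Q)"
      by (rule measurable_fun_upd[where J=I]) (use i w in auto)
    then have "(\<lambda>t. f (w(i := t))) \<in> borel_measurable Q"
      by measurable
    from nn_integral_resample_on[OF Q A pos this]
    show "(\<integral>\<^sup>+z. \<integral>\<^sup>+t. f (w(i := if z \<in> A then t else z)) \<partial>uniform_measure Q A \<partial>Q) = (\<integral>\<^sup>+z. f (w(i := z)) \<partial>Q)" .
  qed
  also have "\<dots> = (\<integral>\<^sup>+w. f w \<partial>(\<Pi>\<^sub>M i\<in>I. Q))"
    by (rule nn_integral_PiM_update(1)[OF Q i f, symmetric])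
  finally show ?thesis .
qed

text \<open>The conditional expectation of \<open>u\<close> when the position inside
  \<open>A\<close> is forgotten and points outside \<open>A\<close> are known exactly.\<close>

definition average_on :: "'a measure \<Rightarrow> 'a set \<Rightarrow> ('a \<Rightarrow> real) \<Rightarrow> 'a \<Rightarrow> real" where
  "average_on Q A u x = (if x \<in> A then \<integral>t. u t \<partial>uniform_measure Q A else u x)"

text \<open>A real-valued density, so that Bochner integrals under the conditional law become
  integrals under \<open>Q\<close>.\<close>

lemma uniform_measure_eq_density:
  assumes Q: "prob_space Q" and pos: "emeasure Q A \<noteq> 0"
  shows "uniform_measure Q A = density Q (\<lambda>x. ennreal (indicator A x / measure Q A))"
proof -
  interpret Q: prob_space Q by fact
  have "measure Q A > 0" using pos by (simp add: Q.emeasure_eq_measure zero_less_measure_iff)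
  then show ?thesis
    unfolding uniform_measure_def
    by (intro arg_cong[where f = "density Q"] ext)
       (auto simp: Q.emeasure_eq_measure divide_ennreal ennreal_1[symmetric] simp del: ennreal_1 split: split_indicator)
qed

lemma integrable_uniform_measure:
  fixes u :: "'a \<Rightarrow> real"
  assumes Q: "prob_space Q" and A[measurable]: "A \<in> sets Q" and pos: "emeasure Q A \<noteq> 0" and u: "integrable Q u"
  shows "integrable (uniform_measure Q A) u"
proof -
  interpret Q: prob_space Q by fact
  have [measurable]: "u \<in> borel_measurable Q" using u by auto
  note uniform_measure_eq_density[OF Q pos]
  moreover have "integrable Q (\<lambda>x. indicator A x / measure Q A * u x)"
    using integrable_mult_indicator[OF A u] by (auto simp: mult.commute)
  ultimately show ?thesis
    by (simp add: integrable_density)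
qed

text \<open>
  One coordinate \<open>i \<in> s\<close> at a time is redrawn from the conditional law given \<open>A\<close>, which leaves the
  product measure invariant, and by Jensen's inequality averaging \<open>\<Psi>\<close> over the new value majorizes
  the sum in which \<open>u i (w i)\<close> is replaced by its conditional mean. The majorant \<open>\<Phi>\<close> does not depend
  on \<open>u\<close>, so the bound is uniform over classes. The functions \<open>b\<close> will be sampling probabilities,
  which see \<open>w i\<close> only through the sources it belongs to.
\<close>
lemma resample_majorant:
  fixes \<Psi> :: "('i \<Rightarrow> 'a) \<Rightarrow> ennreal"
  assumes Q: "prob_space Q" and A[measurable]: "A \<in> sets Q" and pos: "emeasure Q A \<noteq> 0"
    and I: "finite I" and s: "s \<subseteq> I" and \<Psi>: "\<Psi> \<in> borel_measurable (\<Pi>\<^sub>M i\<in>I. Q)"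
  obtains \<Phi> where "\<Phi> \<in> borel_measurable (\<Pi>\<^sub>M i\<in>I. Q)"
    and "\<And>u w. (\<And>i. i \<in> I \<Longrightarrow> integrable Q (u i)) \<Longrightarrow>
        (\<And>w. w \<in> space (\<Pi>\<^sub>M i\<in>I. Q) \<Longrightarrow> ennreal \<bar>\<Sum>i\<in>I. u i (w i)\<bar> \<le> \<Psi> w) \<Longrightarrow> w \<in> space (\<Pi>\<^sub>M i\<in>I. Q) \<Longrightarrow>
        ennreal \<bar>\<Sum>i\<in>I. (if i \<in> s then average_on Q A (u i) (w i) else u i (w i))\<bar> \<le> \<Phi> w"
    and "\<And>b. b \<in> borel_measurable (\<Pi>\<^sub>M i\<in>I. Q) \<Longrightarrow>
        (\<And>w i t. w \<in> space (\<Pi>\<^sub>M i\<in>I. Q) \<Longrightarrow> i \<in> s \<Longrightarrow> t \<in> A \<Longrightarrow> w i \<in> A \<Longrightarrow> b (w(i := t)) = b w) \<Longrightarrow>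
        (\<integral>\<^sup>+w. \<Phi> w * b w \<partial>(\<Pi>\<^sub>M i\<in>I. Q)) = (\<integral>\<^sup>+w. \<Psi> w * b w \<partial>(\<Pi>\<^sub>M i\<in>I. Q))"
proof -
  let ?P = "\<Pi>\<^sub>M i\<in>I. Q" and ?U = "uniform_measure Q A"
  interpret Q: prob_space Q by fact
  interpret U: prob_space ?U
    using pos by (intro prob_space_uniform_measure) auto
  have one: "emeasure Q A / emeasure Q A = 1"
    using pos by (simp add: ennreal_divide_self less_top[symmetric])
  have spU[simp]: "space ?U = space Q" by (rule sets_eq_imp_space_eq) simp
  have AU: "AE t in ?U. t \<in> A"
    using pos by (intro AE_uniform_measureI) auto
  have "finite s" using I s finite_subset by auto
  \<comment> \<open>Both properties quantify over all \<open>u\<close> and all \<open>b\<close>, so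
    that the induction on \<open>s\<close> produces one \<open>\<Phi>\<close> valid for all of
    them.\<close>
  define maj where "maj s \<Phi> \<longleftrightarrow> (\<forall>u. (\<forall>i\<in>I. integrable Q (u i)) \<longrightarrow>
      (\<forall>w\<in>space ?P. ennreal \<bar>\<Sum>i\<in>I. u i (w i)\<bar> \<le> \<Psi> w) \<longrightarrow>
      (\<forall>w\<in>space ?P. ennreal \<bar>\<Sum>i\<in>I. (if i \<in> s then average_on Q A (u i) (w i) else u i (w i))\<bar> \<le> \<Phi> w))" for s \<Phi>
  define int where "int s \<Phi> \<longleftrightarrow> (\<forall>b\<in>borel_measurable ?P.
      (\<forall>w\<in>space ?P. \<forall>i\<in>s. \<forall>t\<in>A. w i \<in> A \<longrightarrow> b (w(i := t)) = b w) \<longrightarrow>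
      (\<integral>\<^sup>+w. \<Phi> w * b w \<partial>?P) = (\<integral>\<^sup>+w. \<Psi> w * b w \<partial>?P))" for s \<Phi>
  from \<open>finite s\<close> have "\<exists>\<Phi>\<in>borel_measurable ?P. maj s \<Phi> \<and> int s \<Phi>"
    using s
  proof (induction s rule: finite_induct)
    case empty
    show ?case using \<Psi> by (intro bexI[of _ \<Psi>]) (auto simp: maj_def int_def)
  next
    case (insert i s)
    then have i: "i \<in> I" and "s \<subseteq> I" by auto
    from insert.IH[OF \<open>s \<subseteq> I\<close>] obtain \<Phi> where \<Phi>[measurable]: "\<Phi> \<in> borel_measurable ?P"
      and maj': "maj s \<Phi>" and int': "int s \<Phi>"
      by blast
    have maj: "ennreal \<bar>\<Sum>i\<in>I. (if i \<in> s then average_on Q A (u i) (w i) else u i (w i))\<bar> \<le> \<Phi> w"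
      if "\<And>i. i \<in> I \<Longrightarrow> integrable Q (u i)" "\<And>w. w \<in> space ?P \<Longrightarrow> ennreal \<bar>\<Sum>i\<in>I. u i (w i)\<bar> \<le> \<Psi> w"
        "w \<in> space ?P" for u w
      using maj' that unfolding maj_def by blast
    define \<Phi>' where "\<Phi>' w = (\<integral>\<^sup>+t. \<Phi> (w(i := if w i \<in> A then t else w i)) \<partial>?U)" for w
    have m: "(\<lambda>(w, t). \<Phi> (w(i := if w i \<in> A then t else w i))) \<in> borel_measurable (?P \<Otimes>\<^sub>M ?U)"
      using measurable_compose[OF measurable_resample[OF A i] \<Phi>] by (simp add: split_beta)
    have \<Phi>'m: "\<Phi>' \<in> borel_measurable ?P"
      unfolding \<Phi>'_def using U.borel_measurable_nn_integral[OF m] by simp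
    have upd: "w(i := t) \<in> space ?P" if "w \<in> space ?P" "t \<in> space Q" for w t
      using that i by (auto simp: space_PiM PiE_def extensional_def)
    have updm: "(\<lambda>t. w(i := t)) \<in> Q \<rightarrow>\<^sub>M ?P" if "w \<in> space ?P" for w
      by (rule measurable_fun_upd[where J=I]) (use i that in auto)
    have 1: "ennreal \<bar>\<Sum>j\<in>I. (if j \<in> insert i s then average_on Q A (u j) (w j) else u j (w j))\<bar> \<le> \<Phi>' w"
      if u: "\<And>i. i \<in> I \<Longrightarrow> integrable Q (u i)" and b: "\<And>w. w \<in> space ?P \<Longrightarrow> ennreal \<bar>\<Sum>i\<in>I. u i (w i)\<bar> \<le> \<Psi> w"
        and w: "w \<in> space ?P" for u w
    proof (cases "w i \<in> A")
      case False
      then have "\<Phi>' w = \<Phi> w" by (simp add: \<Phi>'_def one)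
      moreover have "(\<Sum>j\<in>I. (if j \<in> insert i s then average_on Q A (u j) (w j) else u j (w j))) =
          (\<Sum>j\<in>I. (if j \<in> s then average_on Q A (u j) (w j) else u j (w j)))"
        by (intro sum.cong) (auto simp: average_on_def False)
      ultimately show ?thesis using maj[OF u b w] by simp
    next
      case True
      \<comment> \<open>The part of the sum that does not involve coordinate
        \<open>i\<close>.\<close>
      define K where "K = (\<Sum>j\<in>I - {i}. (if j \<in> s then average_on Q A (u j) (w j) else u j (w j)))"
      have ui: "integrable ?U (u i)" using integrable_uniform_measure[OF Q A pos u[OF i]] .
      have "(\<Sum>j\<in>I. (if j \<in> insert i s then average_on Q A (u j) (w j) else u j (w j))) = K + (\<integral>t. u i t \<partial>?U)"
        by (subst sum.remove[OF I i]) (auto simp: K_def average_on_def True intro!: sum.cong)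
      also have "\<dots> = (\<integral>t. K + u i t \<partial>?U)"
        using ui U.prob_space by simp
      finally have "ennreal \<bar>\<Sum>j\<in>I. (if j \<in> insert i s then average_on Q A (u j) (w j) else u j (w j))\<bar>
           \<le> ennreal (\<integral>t. \<bar>K + u i t\<bar> \<partial>?U)"
        using integral_abs_bound[of ?U "\<lambda>t. K + u i t"] by (simp add: ennreal_leI)
      also have "\<dots> = (\<integral>\<^sup>+t. ennreal \<bar>K + u i t\<bar> \<partial>?U)"
        using ui by (intro nn_integral_eq_integral[symmetric]) auto
      also have "\<dots> \<le> (\<integral>\<^sup>+t. \<Phi> (w(i := t)) \<partial>?U)"
      proof (rule nn_integral_mono)
        fix t assume "t \<in> space ?U"
        then have "w(i := t) \<in> space ?P" using upd w by simp
        from maj[OF u b this] have "ennreal \<bar>\<Sum>j\<in>I. (if j \<in> s then average_on Q A (u j) ((w(i := t)) j) else u j ((w(i := t)) j))\<bar> \<le> \<Phi> (w(i := t))"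
          by simp
        also have "(\<Sum>j\<in>I. (if j \<in> s then average_on Q A (u j) ((w(i := t)) j) else u j ((w(i := t)) j))) = K + u i t"
        proof -
          have "(\<Sum>j\<in>I - {i}. (if j \<in> s then average_on Q A (u j) ((w(i := t)) j) else u j ((w(i := t)) j))) = K"
            unfolding K_def by (rule sum.cong) auto
          \<comment> \<open>Since \<open>i\<close> is not yet in \<open>s\<close>, its summand in
            the bound for \<open>s\<close> is still \<open>u i t\<close>.\<close>
          then show ?thesis using insert.hyps by (subst sum.remove[OF I i]) simp
        qed
        finally show "ennreal \<bar>K + u i t\<bar> \<le> \<Phi> (w(i := t))" .
      qed
      also have "\<dots> = \<Phi>' w" by (simp add: \<Phi>'_def True)
      finally show ?thesis .
    qed
    have 2: "(\<integral>\<^sup>+w. \<Phi>' w * b w \<partial>?P) = (\<integral>\<^sup>+w. \<Psi> w * b w \<partial>?P)"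
      if b[measurable]: "b \<in> borel_measurable ?P"
        and inv: "\<And>w j t. w \<in> space ?P \<Longrightarrow> j \<in> insert i s \<Longrightarrow> t \<in> A \<Longrightarrow> w j \<in> A \<Longrightarrow> b (w(j := t)) = b w" for b
    proof -
      \<comment> \<open>Almost surely the new value lies in \<open>A\<close>, where \<open>b\<close>
        does not notice the change. So \<open>b\<close> may be evaluated at the redrawn point as
        well, and invariance of the product measure applies to the product of \<open>\<Phi>\<close>
        and \<open>b\<close>.\<close>
      have "(\<integral>\<^sup>+w. \<Phi>' w * b w \<partial>?P) = (\<integral>\<^sup>+w. \<integral>\<^sup>+t. \<Phi> (w(i := if w i \<in> A then t else w i)) * b (w(i := if w i \<in> A then t else w i)) \<partial>?U \<partial>?P)"
      proof (rule nn_integral_cong)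
        fix w assume w: "w \<in> space ?P"
        then have [measurable]: "(\<lambda>t. \<Phi> (w(i := if w i \<in> A then t else w i))) \<in> borel_measurable ?U"
          using measurable_compose[OF updm[OF w] \<Phi>] by (cases "w i \<in> A") auto
        have "\<Phi>' w * b w = (\<integral>\<^sup>+t. \<Phi> (w(i := if w i \<in> A then t else w i)) * b w \<partial>?U)"
          by (simp add: \<Phi>'_def nn_integral_multc)
        also have "\<dots> = (\<integral>\<^sup>+t. \<Phi> (w(i := if w i \<in> A then t else w i)) * b (w(i := if w i \<in> A then t else w i)) \<partial>?U)"
          by (rule nn_integral_cong_AE) (use AU in eventually_elim, use inv[OF w] in auto)
        finally show "\<Phi>' w * b w = \<dots>" .
      qed
      also have "\<dots> = (\<integral>\<^sup>+w. \<Phi> w * b w \<partial>?P)"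
        by (rule nn_integral_resample[OF Q A pos i]) measurable
      also have "\<dots> = (\<integral>\<^sup>+w. \<Psi> w * b w \<partial>?P)"
        using int' b inv unfolding int_def by blast
      finally show ?thesis .
    qed
    have "maj (insert i s) \<Phi>'"
      unfolding maj_def by (intro allI impI ballI 1) simp_all
    moreover have "int (insert i s) \<Phi>'"
      unfolding int_def by (intro ballI impI 2) blast+
    ultimately show ?case using \<Phi>'m by blast
  qed
  then obtain \<Phi> where \<Phi>: "\<Phi> \<in> borel_measurable ?P" and \<Phi>_maj: "maj s \<Phi>" and \<Phi>_int: "int s \<Phi>"
    by blast
  show ?thesis
  proof (rule that[of \<Phi>])
    show "\<Phi> \<in> borel_measurable ?P" by fact
  next
    fix u w
    assume "\<And>i. i \<in> I \<Longrightarrow> integrable Q (u i)" "\<And>w. w \<in> space ?P \<Longrightarrow> ennreal \<bar>\<Sum>i\<in>I. u i (w i)\<bar> \<le> \<Psi> w" "w \<in> space ?P"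
    then show "ennreal \<bar>\<Sum>i\<in>I. (if i \<in> s then average_on Q A (u i) (w i) else u i (w i))\<bar> \<le> \<Phi> w"
      by (intro \<Phi>_maj[unfolded maj_def, rule_format])
  next
    fix b :: "('i \<Rightarrow> 'a) \<Rightarrow> ennreal"
    assume "b \<in> borel_measurable ?P" "\<And>w i t. w \<in> space ?P \<Longrightarrow> i \<in> s \<Longrightarrow> t \<in> A \<Longrightarrow> w i \<in> A \<Longrightarrow> b (w(i := t)) = b w"
    then show "(\<integral>\<^sup>+w. \<Phi> w * b w \<partial>?P) = (\<integral>\<^sup>+w. \<Psi> w * b w \<partial>?P)"
      by (intro \<Phi>_int[unfolded int_def, rule_format])
  qed
qed

lemma integral_uniform_measure:
  fixes u :: "'a \<Rightarrow> real"
  assumes Q: "prob_space Q" and A[measurable]: "A \<in> sets Q" and pos: "emeasure Q A \<noteq> 0" and u: "integrable Q u"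
  shows "(\<integral>x. u x \<partial>uniform_measure Q A) = (\<integral>x. indicator A x * u x \<partial>Q) / measure Q A"
proof -
  interpret Q: prob_space Q by fact
  have [measurable]: "u \<in> borel_measurable Q" using u by auto
  have "(\<integral>x. u x \<partial>uniform_measure Q A) = (\<integral>x. indicator A x / measure Q A * u x \<partial>Q)"
    by (simp add: uniform_measure_eq_density[OF Q pos] integral_density)
  also have "\<dots> = (\<integral>x. (indicator A x * u x) / measure Q A \<partial>Q)"
    by (intro Bochner_Integration.integral_cong) auto
  finally show ?thesis by simp
qed

text \<open>The sum with the coordinates in \<open>s\<close> averaged over \<open>A\<close> differs
  from the original one only at the \<open>i \<in> s\<close> with \<open>w i \<in> A\<close>, by
  \<open>h (w i)\<close> minus its conditional mean; the global mean cancels in this difference. One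
  sum is bounded by \<open>D\<close>, the other by the redrawn majorant.\<close>

lemma resample_centered:
  fixes D :: "('i \<Rightarrow> 'a) \<Rightarrow> ennreal"
  assumes Q: "prob_space Q" and A[measurable]: "A \<in> sets Q" and pos: "emeasure Q A \<noteq> 0"
    and I: "finite I" and s: "s \<subseteq> I" and D: "D \<in> borel_measurable (\<Pi>\<^sub>M i\<in>I. Q)"
  obtains \<Phi> where "\<Phi> \<in> borel_measurable (\<Pi>\<^sub>M i\<in>I. Q)"
    and "\<And>h w. integrable Q h \<Longrightarrow>
        (\<And>w. w \<in> space (\<Pi>\<^sub>M i\<in>I. Q) \<Longrightarrow> ennreal \<bar>(\<Sum>i\<in>I. h (w i)) - real (card I) * (\<integral>x. h x \<partial>Q)\<bar> \<le> D w) \<Longrightarrow>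
        w \<in> space (\<Pi>\<^sub>M i\<in>I. Q) \<Longrightarrow>
        ennreal \<bar>\<Sum>i\<in>s. indicator A (w i) * (h (w i) - (\<integral>x. indicator A x * h x \<partial>Q) / measure Q A)\<bar> \<le> D w + \<Phi> w"
    and "\<And>b. b \<in> borel_measurable (\<Pi>\<^sub>M i\<in>I. Q) \<Longrightarrow>
        (\<And>w i t. w \<in> space (\<Pi>\<^sub>M i\<in>I. Q) \<Longrightarrow> i \<in> s \<Longrightarrow> t \<in> A \<Longrightarrow> w i \<in> A \<Longrightarrow> b (w(i := t)) = b w) \<Longrightarrow>
        (\<integral>\<^sup>+w. \<Phi> w * b w \<partial>(\<Pi>\<^sub>M i\<in>I. Q)) = (\<integral>\<^sup>+w. D w * b w \<partial>(\<Pi>\<^sub>M i\<in>I. Q))"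
proof -
  let ?P = "\<Pi>\<^sub>M i\<in>I. Q"
  interpret Q: prob_space Q by fact
  interpret U: prob_space "uniform_measure Q A"
    using pos by (intro prob_space_uniform_measure) auto
  have [simp]: "U.prob (space Q) = 1" using U.prob_space by simp
  show ?thesis
  proof (rule resample_majorant[OF Q A pos I s D])
    fix \<Phi>
    assume \<Phi>: "\<Phi> \<in> borel_measurable ?P"
      and maj: "\<And>u w. (\<And>i. i \<in> I \<Longrightarrow> integrable Q (u i)) \<Longrightarrow>
        (\<And>w. w \<in> space ?P \<Longrightarrow> ennreal \<bar>\<Sum>i\<in>I. u i (w i)\<bar> \<le> D w) \<Longrightarrow> w \<in> space ?P \<Longrightarrow>
        ennreal \<bar>\<Sum>i\<in>I. (if i \<in> s then average_on Q A (u i) (w i) else u i (w i))\<bar> \<le> \<Phi> w"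
      and int: "\<And>b. b \<in> borel_measurable ?P \<Longrightarrow>
        (\<And>w i t. w \<in> space ?P \<Longrightarrow> i \<in> s \<Longrightarrow> t \<in> A \<Longrightarrow> w i \<in> A \<Longrightarrow> b (w(i := t)) = b w) \<Longrightarrow>
        (\<integral>\<^sup>+w. \<Phi> w * b w \<partial>?P) = (\<integral>\<^sup>+w. D w * b w \<partial>?P)"
    have 1: "ennreal \<bar>\<Sum>i\<in>s. indicator A (w i) * (h (w i) - (\<integral>x. indicator A x * h x \<partial>Q) / measure Q A)\<bar> \<le> D w + \<Phi> w"
      if h: "integrable Q h"
        and b: "\<And>w. w \<in> space ?P \<Longrightarrow> ennreal \<bar>(\<Sum>i\<in>I. h (w i)) - real (card I) * (\<integral>x. h x \<partial>Q)\<bar> \<le> D w"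
        and w: "w \<in> space ?P" for h w
    proof -
      define u where "u x = h x - (\<integral>x. h x \<partial>Q)" for x
      have u: "integrable Q u" using h unfolding u_def by auto
      have sum_u: "(\<Sum>i\<in>I. u (w i)) = (\<Sum>i\<in>I. h (w i)) - real (card I) * (\<integral>x. h x \<partial>Q)" for w :: "'i \<Rightarrow> 'a"
        by (simp add: u_def sum_subtractf)
      have c: "(\<integral>x. u x \<partial>uniform_measure Q A) = (\<integral>x. indicator A x * h x \<partial>Q) / measure Q A - (\<integral>x. h x \<partial>Q)"
        unfolding integral_uniform_measure[OF Q A pos h, symmetric] u_def
        using integrable_uniform_measure[OF Q A pos h] by simp
      let ?v = "\<lambda>i. if i \<in> s then average_on Q A u (w i) else u (w i)"
      have v: "ennreal \<bar>\<Sum>i\<in>I. ?v i\<bar> \<le> \<Phi> w"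
        by (rule maj) (use u b w in \<open>auto simp: sum_u\<close>)
      have "(\<Sum>i\<in>s. indicator A (w i) * (h (w i) - (\<integral>x. indicator A x * h x \<partial>Q) / measure Q A))
          = (\<Sum>i\<in>s. u (w i) - ?v i)"
        by (intro sum.cong) (auto simp: average_on_def u_def c[unfolded u_def] split: split_indicator)
      also have "\<dots> = (\<Sum>i\<in>I. u (w i) - ?v i)"
        by (intro sum.mono_neutral_left I s) auto
      also have "\<dots> = (\<Sum>i\<in>I. u (w i)) - (\<Sum>i\<in>I. ?v i)"
        by (rule sum_subtractf)
      finally have eq: "(\<Sum>i\<in>s. indicator A (w i) * (h (w i) - (\<integral>x. indicator A x * h x \<partial>Q) / measure Q A))
          = (\<Sum>i\<in>I. u (w i)) - (\<Sum>i\<in>I. ?v i)" .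
      have "ennreal \<bar>\<Sum>i\<in>s. indicator A (w i) * (h (w i) - (\<integral>x. indicator A x * h x \<partial>Q) / measure Q A)\<bar>
          \<le> ennreal (\<bar>\<Sum>i\<in>I. u (w i)\<bar> + \<bar>\<Sum>i\<in>I. ?v i\<bar>)"
        unfolding eq by (rule ennreal_leI[OF abs_triangle_ineq4])
      also have "\<dots> \<le> D w + \<Phi> w"
        using add_mono[OF b[OF w] v] by (simp add: sum_u)
      finally show ?thesis .
    qed
    show ?thesis
    proof (rule that[of \<Phi>])
      fix h w
      assume h: "integrable Q h"
        and b: "\<And>w. w \<in> space ?P \<Longrightarrow> ennreal \<bar>(\<Sum>i\<in>I. h (w i)) - real (card I) * (\<integral>x. h x \<partial>Q)\<bar> \<le> D w"
        and w: "w \<in> space ?P"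
      show "ennreal \<bar>\<Sum>i\<in>s. indicator A (w i) * (h (w i) - (\<integral>x. indicator A x * h x \<partial>Q) / measure Q A)\<bar> \<le> D w + \<Phi> w"
        by (rule 1[OF h b w])
    next
      fix b :: "('i \<Rightarrow> 'a) \<Rightarrow> ennreal"
      assume "b \<in> borel_measurable ?P"
        "\<And>w i t. w \<in> space ?P \<Longrightarrow> i \<in> s \<Longrightarrow> t \<in> A \<Longrightarrow> w i \<in> A \<Longrightarrow> b (w(i := t)) = b w"
      then show "(\<integral>\<^sup>+w. \<Phi> w * b w \<partial>?P) = (\<integral>\<^sup>+w. D w * b w \<partial>?P)"
        by (rule int)
    qed (rule \<Phi>)
  qed
qed

section \<open>Glivenko-Cantelli classes in the mean\<close>

text \<open>
  The Glivenko-Cantelli property in the mean. The majorant \<open>D N\<close> bounds the sum rather than the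
  average; \<open>N = 0\<close> is harmless as only the limit counts.
\<close>
definition mean_gc :: "'a measure \<Rightarrow> 'i set \<Rightarrow> ('i \<Rightarrow> 'a \<Rightarrow> real) \<Rightarrow> bool" where
  "mean_gc Q I h \<longleftrightarrow> (\<forall>i\<in>I. integrable Q (h i)) \<and>
     (\<exists>D. (\<forall>N. D N \<in> borel_measurable (\<Pi>\<^sub>M k\<in>{..<N}. Q)) \<and>
       (\<forall>N. \<forall>w\<in>space (\<Pi>\<^sub>M k\<in>{..<N}. Q). \<forall>i\<in>I.
          ennreal \<bar>(\<Sum>k<N. h i (w k)) - real N * (\<integral>x. h i x \<partial>Q)\<bar> \<le> D N w) \<and>
       (\<lambda>N. (\<integral>\<^sup>+w. D N w \<partial>(\<Pi>\<^sub>M k\<in>{..<N}. Q)) / of_nat N) \<longlonglongrightarrow> 0)"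

section \<open>Closure properties of the mean Glivenko-Cantelli property\<close>

lemma mean_gc_integrable: "mean_gc Q I h \<Longrightarrow> i \<in> I \<Longrightarrow> integrable Q (h i)"
  by (simp add: mean_gc_def)

lemma mean_gcE:
  assumes "mean_gc Q I h"
  obtains D :: "nat \<Rightarrow> (nat \<Rightarrow> 'a) \<Rightarrow> ennreal"
  where "\<And>N. D N \<in> borel_measurable (\<Pi>\<^sub>M k\<in>{..<N}. Q)"
    and "\<And>N w i. w \<in> space (\<Pi>\<^sub>M k\<in>{..<N}. Q) \<Longrightarrow> i \<in> I \<Longrightarrow>
          ennreal \<bar>(\<Sum>k<N. h i (w k)) - real N * (\<integral>x. h i x \<partial>Q)\<bar> \<le> D N w"
    and "(\<lambda>N. (\<integral>\<^sup>+w. D N w \<partial>(\<Pi>\<^sub>M k\<in>{..<N}. Q)) / of_nat N) \<longlonglongrightarrow> 0"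
  using assms unfolding mean_gc_def by blast

lemma mean_gcI:
  assumes "\<And>i. i \<in> I \<Longrightarrow> integrable Q (h i)"
    and "\<And>N. D N \<in> borel_measurable (\<Pi>\<^sub>M k\<in>{..<N}. Q)"
    and "\<And>N w i. w \<in> space (\<Pi>\<^sub>M k\<in>{..<N}. Q) \<Longrightarrow> i \<in> I \<Longrightarrow>
          ennreal \<bar>(\<Sum>k<N. h i (w k)) - real N * (\<integral>x. h i x \<partial>Q)\<bar> \<le> D N w"
    and "(\<lambda>N. (\<integral>\<^sup>+w. D N w \<partial>(\<Pi>\<^sub>M k\<in>{..<N}. Q)) / of_nat N) \<longlonglongrightarrow> 0"
  shows "mean_gc Q I h"
  unfolding mean_gc_def using assms by blast

lemma mean_gc_add:
  assumes "mean_gc Q I f" "mean_gc Q I g"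
  shows "mean_gc Q I (\<lambda>i x. f i x + g i x)"
proof -
  obtain D where D[measurable]: "\<And>N. D N \<in> borel_measurable (\<Pi>\<^sub>M k\<in>{..<N}. Q)"
    and fD: "\<And>N w i. w \<in> space (\<Pi>\<^sub>M k\<in>{..<N}. Q) \<Longrightarrow> i \<in> I \<Longrightarrow>
          ennreal \<bar>(\<Sum>k<N. f i (w k)) - real N * (\<integral>x. f i x \<partial>Q)\<bar> \<le> D N w"
    and limD: "(\<lambda>N. (\<integral>\<^sup>+w. D N w \<partial>(\<Pi>\<^sub>M k\<in>{..<N}. Q)) / of_nat N) \<longlonglongrightarrow> 0"
    using mean_gcE[OF assms(1)] by blast
  obtain E where E[measurable]: "\<And>N. E N \<in> borel_measurable (\<Pi>\<^sub>M k\<in>{..<N}. Q)"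
    and gE: "\<And>N w i. w \<in> space (\<Pi>\<^sub>M k\<in>{..<N}. Q) \<Longrightarrow> i \<in> I \<Longrightarrow>
          ennreal \<bar>(\<Sum>k<N. g i (w k)) - real N * (\<integral>x. g i x \<partial>Q)\<bar> \<le> E N w"
    and limE: "(\<lambda>N. (\<integral>\<^sup>+w. E N w \<partial>(\<Pi>\<^sub>M k\<in>{..<N}. Q)) / of_nat N) \<longlonglongrightarrow> 0"
    using mean_gcE[OF assms(2)] by blast
  note fi = mean_gc_integrable[OF assms(1)] and gi = mean_gc_integrable[OF assms(2)]
  show ?thesis
  proof (rule mean_gcI[where D="\<lambda>N w. D N w + E N w"])
    fix N :: nat and w i assume w: "w \<in> space (\<Pi>\<^sub>M k\<in>{..<N}. Q)" and i: "i \<in> I"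
    have eq: "(\<Sum>k<N. f i (w k) + g i (w k)) - real N * (\<integral>x. f i x + g i x \<partial>Q)
        = ((\<Sum>k<N. f i (w k)) - real N * (\<integral>x. f i x \<partial>Q)) + ((\<Sum>k<N. g i (w k)) - real N * (\<integral>x. g i x \<partial>Q))"
      using fi[OF i] gi[OF i] by (simp add: sum.distrib algebra_simps)
    have "ennreal \<bar>(\<Sum>k<N. f i (w k) + g i (w k)) - real N * (\<integral>x. f i x + g i x \<partial>Q)\<bar>
        \<le> ennreal (\<bar>(\<Sum>k<N. f i (w k)) - real N * (\<integral>x. f i x \<partial>Q)\<bar> + \<bar>(\<Sum>k<N. g i (w k)) - real N * (\<integral>x. g i x \<partial>Q)\<bar>)"
      unfolding eq by (rule ennreal_leI[OF abs_triangle_ineq])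
    also have "\<dots> \<le> D N w + E N w"
      using add_mono[OF fD[OF w i] gE[OF w i]] by simp
    finally show "ennreal \<bar>(\<Sum>k<N. f i (w k) + g i (w k)) - real N * (\<integral>x. f i x + g i x \<partial>Q)\<bar> \<le> D N w + E N w" .
  next
    show "(\<lambda>N. (\<integral>\<^sup>+w. D N w + E N w \<partial>(\<Pi>\<^sub>M k\<in>{..<N}. Q)) / of_nat N) \<longlonglongrightarrow> 0"
      using tendsto_add[OF limD limE] by (simp add: nn_integral_add add_divide_distrib_ennreal)
  qed (use fi gi in auto)
qed

lemma mean_gc_mult:
  assumes f: "mean_gc Q I f" and C: "\<And>i. i \<in> I \<Longrightarrow> \<bar>c i\<bar> \<le> C"
  shows "mean_gc Q I (\<lambda>i x. c i * f i x)"
proof -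
  obtain D where D[measurable]: "\<And>N. D N \<in> borel_measurable (\<Pi>\<^sub>M k\<in>{..<N}. Q)"
    and fD: "\<And>N w i. w \<in> space (\<Pi>\<^sub>M k\<in>{..<N}. Q) \<Longrightarrow> i \<in> I \<Longrightarrow>
          ennreal \<bar>(\<Sum>k<N. f i (w k)) - real N * (\<integral>x. f i x \<partial>Q)\<bar> \<le> D N w"
    and limD: "(\<lambda>N. (\<integral>\<^sup>+w. D N w \<partial>(\<Pi>\<^sub>M k\<in>{..<N}. Q)) / of_nat N) \<longlonglongrightarrow> 0"
    using mean_gcE[OF f] by blast
  show ?thesis
  proof (rule mean_gcI[where D="\<lambda>N w. ennreal C * D N w"])
    fix N :: nat and w i assume w: "w \<in> space (\<Pi>\<^sub>M k\<in>{..<N}. Q)" and i: "i \<in> I"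
    have "(\<Sum>k<N. c i * f i (w k)) - real N * (\<integral>x. c i * f i x \<partial>Q)
        = c i * ((\<Sum>k<N. f i (w k)) - real N * (\<integral>x. f i x \<partial>Q))"
      by (simp add: sum_distrib_left algebra_simps)
    then have "ennreal \<bar>(\<Sum>k<N. c i * f i (w k)) - real N * (\<integral>x. c i * f i x \<partial>Q)\<bar>
        = ennreal \<bar>c i\<bar> * ennreal \<bar>(\<Sum>k<N. f i (w k)) - real N * (\<integral>x. f i x \<partial>Q)\<bar>"
      by (simp add: abs_mult ennreal_mult)
    also have "\<dots> \<le> ennreal C * D N w"
      by (intro mult_mono ennreal_leI C fD w i) auto
    finally show "ennreal \<bar>(\<Sum>k<N. c i * f i (w k)) - real N * (\<integral>x. c i * f i x \<partial>Q)\<bar> \<le> ennreal C * D N w" .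
  next
    show "(\<lambda>N. (\<integral>\<^sup>+w. ennreal C * D N w \<partial>(\<Pi>\<^sub>M k\<in>{..<N}. Q)) / of_nat N) \<longlonglongrightarrow> 0"
      using ennreal_tendsto_cmult[OF _ limD, of "ennreal C"]
      by (simp add: nn_integral_cmult ennreal_times_divide)
  qed (use mean_gc_integrable[OF f] in auto)
qed

lemma mean_gc_zero: "mean_gc Q I (\<lambda>_ _. 0)"
  by (rule mean_gcI[where D="\<lambda>_ _. 0"]) auto

lemma mean_gc_sum:
  assumes "finite S" "\<And>r. r \<in> S \<Longrightarrow> mean_gc Q I (f r)"
  shows "mean_gc Q I (\<lambda>i x. \<Sum>r\<in>S. f r i x)"
  using assms
proof (induction S rule: finite_induct)
  case empty then show ?case by (simp add: mean_gc_zero)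
next
  case (insert r S)
  then have "mean_gc Q I (\<lambda>i x. f r i x + (\<Sum>r\<in>S. f r i x))"
    by (intro mean_gc_add) auto
  then show ?case using insert by simp
qed

text \<open>Additivity of the variance: integrating out the last coordinate kills the cross term
  because \<open>v\<close> has mean zero.\<close>

lemma nn_integral_sum_square:
  fixes v :: "'a \<Rightarrow> real"
  assumes Q: "prob_space Q" and v: "integrable Q v" and v2: "integrable Q (\<lambda>x. (v x)\<^sup>2)" and 0: "(\<integral>x. v x \<partial>Q) = 0"
  shows "(\<integral>\<^sup>+w. ennreal ((\<Sum>k<N. v (w k))\<^sup>2) \<partial>(\<Pi>\<^sub>M k\<in>{..<N}. Q)) = ennreal (real N * (\<integral>x. (v x)\<^sup>2 \<partial>Q))"
proof (induction N)
  case 0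
  then show ?case by simp
next
  case (Suc N)
  interpret Q: prob_space Q by fact
  interpret P: product_prob_space "\<lambda>_. Q" "{..<N}" ..
  have [measurable]: "v \<in> borel_measurable Q" using v by auto
  let ?\<sigma> = "\<integral>x. (v x)\<^sup>2 \<partial>Q"
  have inner: "(\<integral>\<^sup>+t. ennreal ((s + v t)\<^sup>2) \<partial>Q) = ennreal (s\<^sup>2) + ennreal ?\<sigma>" for s
  proof -
    have "(\<integral>\<^sup>+t. ennreal ((s + v t)\<^sup>2) \<partial>Q) = ennreal (\<integral>t. (s + v t)\<^sup>2 \<partial>Q)"
    proof (rule nn_integral_eq_integral)
      show "integrable Q (\<lambda>t. (s + v t)\<^sup>2)" using v v2 by (simp add: power2_sum)
    qed simp
    also have "(\<integral>t. (s + v t)\<^sup>2 \<partial>Q) = s\<^sup>2 + ?\<sigma>"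
      using v v2 0 by (simp add: power2_sum Q.prob_space)
    finally show ?thesis by simp
  qed
  have "(\<integral>\<^sup>+w. ennreal ((\<Sum>k<Suc N. v (w k))\<^sup>2) \<partial>(\<Pi>\<^sub>M k\<in>{..<Suc N}. Q))
      = (\<integral>\<^sup>+w. \<integral>\<^sup>+t. ennreal (((\<Sum>k<N. v (w k)) + v t)\<^sup>2) \<partial>Q \<partial>(\<Pi>\<^sub>M k\<in>{..<N}. Q))"
    unfolding lessThan_Suc by (subst P.product_nn_integral_insert) (auto intro!: nn_integral_cong simp: add.commute)
  also have "\<dots> = ennreal (real N * ?\<sigma>) + ennreal ?\<sigma>"
    unfolding inner by (subst nn_integral_add) (auto simp: Suc.IH P.emeasure_space_1)
  also have "\<dots> = ennreal (real (Suc N) * ?\<sigma>)"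
    by (subst ennreal_plus[symmetric]) (auto simp: algebra_simps)
  finally show ?case .
qed

text \<open>The weak law in the mean for one function; a constant family may have any index set. It
  serves the indicators of regions and sources, and the constant 1.\<close>

lemma mean_gc_bounded:
  fixes f :: "'a \<Rightarrow> real"
  assumes Q: "prob_space Q" and f[measurable]: "f \<in> borel_measurable Q" and C: "\<And>x. x \<in> space Q \<Longrightarrow> \<bar>f x\<bar> \<le> C"
  shows "mean_gc Q I (\<lambda>_. f)"
proof -
  interpret Q: prob_space Q by fact
  define v where "v x = f x - (\<integral>x. f x \<partial>Q)" for x
  have fi: "integrable Q f"
    by (rule Q.integrable_const_bound[of _ C]) (use C in auto)
  then have v: "integrable Q v" "(\<integral>x. v x \<partial>Q) = 0" unfolding v_def by (auto simp: Q.prob_space)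
  have vm[measurable]: "v \<in> borel_measurable Q" unfolding v_def by measurable
  have "\<bar>v x\<bar> \<le> C + \<bar>\<integral>x. f x \<partial>Q\<bar>" if "x \<in> space Q" for x
    using C[OF that] unfolding v_def by linarith
  then have "\<bar>(v x)\<^sup>2\<bar> \<le> (C + \<bar>\<integral>x. f x \<partial>Q\<bar>)\<^sup>2" if "x \<in> space Q" for x
    using that by (metis abs_ge_zero abs_power2 power2_abs power_mono)
  then have v2: "integrable Q (\<lambda>x. (v x)\<^sup>2)"
    by (intro Q.integrable_const_bound[of _ "(C + \<bar>\<integral>x. f x \<partial>Q\<bar>)\<^sup>2"]) auto
  let ?\<sigma> = "\<integral>x. (v x)\<^sup>2 \<partial>Q"
  let ?D = "\<lambda>N w. ennreal \<bar>(\<Sum>k<N. f (w k)) - real N * (\<integral>x. f x \<partial>Q)\<bar>"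
  have bound: "(\<integral>\<^sup>+w. ?D N w \<partial>(\<Pi>\<^sub>M k\<in>{..<N}. Q)) / of_nat N \<le> ennreal ((?\<sigma> + 1) / sqrt (real N))" if N: "N > 0" for N
  proof -
    interpret P: product_prob_space "\<lambda>_. Q" "{..<N}" ..
    \<comment> \<open>The inequality between arithmetic and geometric means trades the first moment
      for the second. The scale \<open>sqrt N\<close> balances the two terms, since the square of
      the centered sum has mean of order \<open>N\<close>.\<close>
    have "\<bar>x\<bar> \<le> x\<^sup>2 / sqrt (real N) + sqrt (real N)" for x :: real
    proof -
      have "0 \<le> (\<bar>x\<bar> - sqrt (real N))\<^sup>2" by simp
      then have "2 * \<bar>x\<bar> * sqrt (real N) \<le> x\<^sup>2 + (sqrt (real N))\<^sup>2" by (simp add: power2_diff)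
      moreover have "0 \<le> \<bar>x\<bar> * sqrt (real N)" by simp
      ultimately have "\<bar>x\<bar> * sqrt (real N) \<le> x\<^sup>2 + (sqrt (real N))\<^sup>2" by linarith
      then show ?thesis using N by (simp add: field_simps power2_eq_square)
    qed
    then have "ennreal \<bar>x\<bar> \<le> ennreal (x\<^sup>2 / sqrt (real N) + sqrt (real N))" for x
      by (intro ennreal_leI)
    moreover have "ennreal (x\<^sup>2 / sqrt (real N) + sqrt (real N)) = ennreal (1 / sqrt (real N)) * ennreal (x\<^sup>2) + ennreal (sqrt (real N))" for x
      by (simp add: ennreal_mult[symmetric])
    moreover have "(\<Sum>k<N. f (w k)) - real N * (\<integral>x. f x \<partial>Q) = (\<Sum>k<N. v (w k))" for w :: "nat \<Rightarrow> 'a"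
      by (simp add: v_def sum_subtractf)
    ultimately have "?D N w \<le> ennreal (1 / sqrt (real N)) * ennreal ((\<Sum>k<N. v (w k))\<^sup>2) + ennreal (sqrt (real N))" for w
      by simp
    then have "(\<integral>\<^sup>+w. ?D N w \<partial>(\<Pi>\<^sub>M k\<in>{..<N}. Q))
        \<le> (\<integral>\<^sup>+w. ennreal (1 / sqrt (real N)) * ennreal ((\<Sum>k<N. v (w k))\<^sup>2) + ennreal (sqrt (real N)) \<partial>(\<Pi>\<^sub>M k\<in>{..<N}. Q))"
      by (intro nn_integral_mono)
    also have "\<dots> = ennreal (1 / sqrt (real N)) * ennreal (real N * ?\<sigma>) + ennreal (sqrt (real N))"
      by (simp add: nn_integral_add nn_integral_cmult nn_integral_sum_square[OF Q v(1) v2 v(2)] P.emeasure_space_1)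
    also have "\<dots> = ennreal ((?\<sigma> + 1) * sqrt (real N))"
    proof -
      have "1 / sqrt (real N) * (real N * ?\<sigma>) + sqrt (real N) = (?\<sigma> + 1) * sqrt (real N)"
      proof -
        have "1 / sqrt (real N) * (real N * ?\<sigma>) + sqrt (real N) = (real N / sqrt (real N)) * ?\<sigma> + sqrt (real N)"
          by simp
        also have "real N / sqrt (real N) = sqrt (real N)"
          by (simp add: real_div_sqrt)
        finally show ?thesis by (simp add: algebra_simps)
      qed
      then show ?thesis
        by (subst ennreal_mult[symmetric], simp, simp, subst ennreal_plus[symmetric]) simp_all
    qed
    finally have "(\<integral>\<^sup>+w. ?D N w \<partial>(\<Pi>\<^sub>M k\<in>{..<N}. Q)) / of_nat N \<le> ennreal ((?\<sigma> + 1) * sqrt (real N)) / of_nat N"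
      by (rule divide_right_mono_ennreal)
    also have "\<dots> = ennreal ((?\<sigma> + 1) * sqrt (real N) / real N)"
      using N by (subst ennreal_of_nat_eq_real_of_nat, subst divide_ennreal) auto
    also have "(?\<sigma> + 1) * sqrt (real N) / real N = (?\<sigma> + 1) / sqrt (real N)"
      using N by (simp add: real_div_sqrt field_simps)
    finally show ?thesis .
  qed
  show ?thesis
  proof (rule mean_gcI[where D = ?D])
    have "(\<lambda>N. (?\<sigma> + 1) / sqrt (real N)) \<longlonglongrightarrow> 0"
      by (intro tendsto_divide_0[OF tendsto_const] filterlim_at_top_imp_at_infinity
          filterlim_compose[OF sqrt_at_top] filterlim_real_sequentially)
    then have lim: "(\<lambda>N. ennreal ((?\<sigma> + 1) / sqrt (real N))) \<longlonglongrightarrow> 0"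
      using tendsto_ennrealI by fastforce
    show "(\<lambda>N. (\<integral>\<^sup>+w. ?D N w \<partial>(\<Pi>\<^sub>M k\<in>{..<N}. Q)) / of_nat N) \<longlonglongrightarrow> 0"
      by (rule tendsto_sandwich[OF _ _ tendsto_const lim])
         (use bound in \<open>auto intro!: eventually_sequentiallyI[of 1]\<close>)
  qed (use fi in auto)
qed

text \<open>Redrawing every unit in \<open>A\<close> controls the sum of
  \<open>indicator A * (h i - c i)\<close>, with \<open>c i\<close> the conditional mean. What
  remains is \<open>c i\<close> times the indicator of \<open>A\<close>: a single bounded function
  with coefficients bounded uniformly in \<open>i\<close>, which is what \<open>C\<close> is
  for.\<close>

lemma mean_gc_indicator:
  assumes Q: "prob_space Q" and A[measurable]: "A \<in> sets Q" and h: "mean_gc Q I h"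
    and C: "\<And>i. i \<in> I \<Longrightarrow> \<bar>\<integral>x. indicator A x * h i x \<partial>Q\<bar> \<le> C"
  shows "mean_gc Q I (\<lambda>i x. indicator A x * h i x)"
proof -
  interpret Q: prob_space Q by fact
  have hi: "integrable Q (h i)" if "i \<in> I" for i
    using mean_gc_integrable[OF h that] .
  have Ah: "integrable Q (\<lambda>x. indicator A x * h i x)" if "i \<in> I" for i
    using integrable_mult_indicator[OF A hi[OF that]] by simp
  show ?thesis
  proof (cases "emeasure Q A = 0")
    case True
    then have AE: "AE x in Q. x \<notin> A"
      by (intro AE_not_in) auto
    \<comment> \<open>A null set gives no conditional law to redraw from. The samples that hit
      \<open>A\<close> form a null set, but the majorant must hold at each of them, hence the value
      infinity.\<close>
    let ?D = "\<lambda>N w. (if \<exists>k<N. w k \<in> A then \<infinity> else 0 :: ennreal)"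
    show ?thesis
    proof (rule mean_gcI[where D = ?D])
      fix N :: nat and w i assume w: "w \<in> space (\<Pi>\<^sub>M k\<in>{..<N}. Q)" and i: "i \<in> I"
      have "(\<integral>x. indicator A x * h i x \<partial>Q) = 0"
        by (rule integral_eq_zero_AE) (use AE in eventually_elim, auto)
      then show "ennreal \<bar>(\<Sum>k<N. indicator A (w k) * h i (w k)) - real N * (\<integral>x. indicator A x * h i x \<partial>Q)\<bar> \<le> ?D N w"
        by (cases "\<exists>k<N. w k \<in> A") auto
    next
      have "(\<integral>\<^sup>+w. ?D N w \<partial>(\<Pi>\<^sub>M k\<in>{..<N}. Q)) = 0" for N :: nat
      proof -
        have "AE w in (\<Pi>\<^sub>M k\<in>{..<N}. Q). \<forall>k\<in>{..<N}. w k \<notin> A"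
          by (intro AE_finite_allI AE_PiM_component[OF Q _ AE]) auto
        then have "AE w in (\<Pi>\<^sub>M k\<in>{..<N}. Q). ?D N w = 0"
          by eventually_elim auto
        then have "(\<integral>\<^sup>+w. ?D N w \<partial>(\<Pi>\<^sub>M k\<in>{..<N}. Q)) = (\<integral>\<^sup>+w. 0 \<partial>(\<Pi>\<^sub>M k\<in>{..<N}. Q))"
          by (rule nn_integral_cong_AE)
        then show ?thesis by simp
      qed
      then show "(\<lambda>N. (\<integral>\<^sup>+w. ?D N w \<partial>(\<Pi>\<^sub>M k\<in>{..<N}. Q)) / of_nat N) \<longlonglongrightarrow> 0"
        by simp
    next
      fix N :: nat
      have [measurable]: "(\<lambda>w. w k) \<in> (\<Pi>\<^sub>M k\<in>{..<N}. Q) \<rightarrow>\<^sub>M Q" if "k \<in> {..<N}" for k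
        using that by measurable
      have "{w \<in> space (\<Pi>\<^sub>M k\<in>{..<N}. Q). \<exists>k\<in>{..<N}. w k \<in> A} \<in> sets (\<Pi>\<^sub>M k\<in>{..<N}. Q)"
        by measurable
      then show "?D N \<in> borel_measurable (\<Pi>\<^sub>M k\<in>{..<N}. Q)"
        by (intro measurable_If) (auto simp: Bex_def)
    qed (rule Ah)
  next
    case pos: False
    then have p: "measure Q A > 0" by (simp add: Q.emeasure_eq_measure zero_less_measure_iff)
    define c where "c i = (\<integral>x. indicator A x * h i x \<partial>Q) / measure Q A" for i
    obtain D where D[measurable]: "\<And>N. D N \<in> borel_measurable (\<Pi>\<^sub>M k\<in>{..<N}. Q)"
      and hD: "\<And>N w i. w \<in> space (\<Pi>\<^sub>M k\<in>{..<N}. Q) \<Longrightarrow> i \<in> I \<Longrightarrow>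
            ennreal \<bar>(\<Sum>k<N. h i (w k)) - real N * (\<integral>x. h i x \<partial>Q)\<bar> \<le> D N w"
      and limD: "(\<lambda>N. (\<integral>\<^sup>+w. D N w \<partial>(\<Pi>\<^sub>M k\<in>{..<N}. Q)) / of_nat N) \<longlonglongrightarrow> 0"
      using mean_gcE[OF h] by blast
    define R where "R N \<Phi> \<longleftrightarrow> \<Phi> \<in> borel_measurable (\<Pi>\<^sub>M k\<in>{..<N}. Q) \<and>
      (\<forall>i\<in>I. \<forall>w\<in>space (\<Pi>\<^sub>M k\<in>{..<N}. Q). ennreal \<bar>\<Sum>k<N. indicator A (w k) * (h i (w k) - c i)\<bar> \<le> D N w + \<Phi> w) \<and>
      (\<integral>\<^sup>+w. \<Phi> w \<partial>(\<Pi>\<^sub>M k\<in>{..<N}. Q)) = (\<integral>\<^sup>+w. D N w \<partial>(\<Pi>\<^sub>M k\<in>{..<N}. Q))" for N \<Phi>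
    have "\<exists>\<Phi>. R N \<Phi>" for N
    proof (rule resample_centered[OF Q A pos finite_lessThan order_refl D])
      fix \<Phi> assume 1: "\<Phi> \<in> borel_measurable (\<Pi>\<^sub>M k\<in>{..<N}. Q)"
        and 2: "\<And>h w. integrable Q h \<Longrightarrow>
          (\<And>w. w \<in> space (\<Pi>\<^sub>M k\<in>{..<N}. Q) \<Longrightarrow> ennreal \<bar>(\<Sum>i<N. h (w i)) - real (card {..<N}) * (\<integral>x. h x \<partial>Q)\<bar> \<le> D N w) \<Longrightarrow>
          w \<in> space (\<Pi>\<^sub>M k\<in>{..<N}. Q) \<Longrightarrow>
          ennreal \<bar>\<Sum>i<N. indicator A (w i) * (h (w i) - (\<integral>x. indicator A x * h x \<partial>Q) / measure Q A)\<bar> \<le> D N w + \<Phi> w"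
        and 3: "\<And>b. b \<in> borel_measurable (\<Pi>\<^sub>M k\<in>{..<N}. Q) \<Longrightarrow>
          (\<And>w i t. w \<in> space (\<Pi>\<^sub>M k\<in>{..<N}. Q) \<Longrightarrow> i \<in> {..<N} \<Longrightarrow> t \<in> A \<Longrightarrow> w i \<in> A \<Longrightarrow> b (w(i := t)) = b w) \<Longrightarrow>
          (\<integral>\<^sup>+w. \<Phi> w * b w \<partial>(\<Pi>\<^sub>M k\<in>{..<N}. Q)) = (\<integral>\<^sup>+w. D N w * b w \<partial>(\<Pi>\<^sub>M k\<in>{..<N}. Q))"
      have "ennreal \<bar>\<Sum>k<N. indicator A (w k) * (h i (w k) - c i)\<bar> \<le> D N w + \<Phi> w"
        if "i \<in> I" "w \<in> space (\<Pi>\<^sub>M k\<in>{..<N}. Q)" for i w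
        unfolding c_def by (rule 2) (use that hi hD in auto)
      \<comment> \<open>Taking \<open>b\<close> constantly 1 in the redrawing identity gives
        \<open>\<Phi>\<close> and \<open>D N\<close> the same integral.\<close>
      then show ?thesis using 1 3[of "\<lambda>_. 1"] by (auto simp: R_def)
    qed
    then obtain \<Phi> where R: "\<And>N. R N (\<Phi> N)" by metis
    have \<Phi>[measurable]: "\<Phi> N \<in> borel_measurable (\<Pi>\<^sub>M k\<in>{..<N}. Q)"
      and int: "(\<integral>\<^sup>+w. \<Phi> N w \<partial>(\<Pi>\<^sub>M k\<in>{..<N}. Q)) = (\<integral>\<^sup>+w. D N w \<partial>(\<Pi>\<^sub>M k\<in>{..<N}. Q))" for N
      using R[of N] by (simp_all add: R_def)
    have maj: "ennreal \<bar>\<Sum>k<N. indicator A (w k) * (h i (w k) - c i)\<bar> \<le> D N w + \<Phi> N w"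
      if "i \<in> I" "w \<in> space (\<Pi>\<^sub>M k\<in>{..<N}. Q)" for N i w
      using R[of N] that by (simp add: R_def)
    have eq: "indicator A x * (h i x - c i) = indicator A x * h i x - c i * indicator A x" for i x
      by (simp add: algebra_simps)
    have "mean_gc Q I (\<lambda>i x. indicator A x * (h i x - c i))"
    proof (rule mean_gcI[where D = "\<lambda>N w. D N w + \<Phi> N w"])
      fix N :: nat and w i assume w: "w \<in> space (\<Pi>\<^sub>M k\<in>{..<N}. Q)" and i: "i \<in> I"
      have "(\<integral>x. indicator A x * (h i x - c i) \<partial>Q) = 0"
        unfolding eq using Ah[OF i] p by (simp add: c_def less_top[symmetric])
      then show "ennreal \<bar>(\<Sum>k<N. indicator A (w k) * (h i (w k) - c i)) - real N * (\<integral>x. indicator A x * (h i x - c i) \<partial>Q)\<bar> \<le> D N w + \<Phi> N w"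
        using maj[OF i w] by simp
    next
      show "(\<lambda>N. (\<integral>\<^sup>+w. D N w + \<Phi> N w \<partial>(\<Pi>\<^sub>M k\<in>{..<N}. Q)) / of_nat N) \<longlonglongrightarrow> 0"
        using tendsto_add[OF limD limD] by (simp add: nn_integral_add int add_divide_distrib_ennreal)
    next
      show "integrable Q (\<lambda>x. indicator A x * (h i x - c i))" if "i \<in> I" for i
        unfolding eq using Ah[OF that] by (auto simp: less_top[symmetric])
    qed auto
    moreover have "mean_gc Q I (\<lambda>i x. c i * indicator A x)"
      by (rule mean_gc_mult[where C = "C / measure Q A"])
         (use C p in \<open>auto simp: c_def divide_right_mono intro!: mean_gc_bounded[OF Q, where C=1] split: split_indicator\<close>)
    ultimately have "mean_gc Q I (\<lambda>i x. indicator A x * (h i x - c i) + c i * indicator A x)"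
      by (rule mean_gc_add)
    then show ?thesis by (simp add: eq)
  qed
qed

text \<open>Used with \<open>\<phi> = fst\<close>, to regard a class on the space of
  \<open>X\<close> as one on the space of \<open>W\<close>: applying \<open>\<phi>\<close>
  coordinatewise turns a sample from \<open>Q\<close> into a sample from the image law.\<close>

lemma mean_gc_distr:
  assumes Q: "prob_space Q" and \<phi>[measurable]: "\<phi> \<in> Q \<rightarrow>\<^sub>M MX" and h: "mean_gc (distr Q MX \<phi>) I h"
  shows "mean_gc Q I (\<lambda>i x. h i (\<phi> x))"
proof -
  let ?R = "distr Q MX \<phi>"
  interpret Q: prob_space Q by fact
  interpret R: prob_space ?R by (rule Q.prob_space_distr) simp
  obtain D where D[measurable]: "\<And>N. D N \<in> borel_measurable (\<Pi>\<^sub>M k\<in>{..<N}. ?R)"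
    and hD: "\<And>N w i. w \<in> space (\<Pi>\<^sub>M k\<in>{..<N}. ?R) \<Longrightarrow> i \<in> I \<Longrightarrow>
          ennreal \<bar>(\<Sum>k<N. h i (w k)) - real N * (\<integral>x. h i x \<partial>?R)\<bar> \<le> D N w"
    and limD: "(\<lambda>N. (\<integral>\<^sup>+w. D N w \<partial>(\<Pi>\<^sub>M k\<in>{..<N}. ?R)) / of_nat N) \<longlonglongrightarrow> 0"
    using mean_gcE[OF h] by blast
  define T where "T N w = (\<lambda>k\<in>{..<N}. \<phi> (w k))" for N :: nat and w
  have T[measurable]: "T N \<in> (\<Pi>\<^sub>M k\<in>{..<N}. Q) \<rightarrow>\<^sub>M (\<Pi>\<^sub>M k\<in>{..<N}. ?R)" for N
    unfolding T_def by measurable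
  have law: "distr (\<Pi>\<^sub>M k\<in>{..<N}. Q) (\<Pi>\<^sub>M k\<in>{..<N}. ?R) (T N) = (\<Pi>\<^sub>M k\<in>{..<N}. ?R)" for N
  proof -
    interpret PQ: product_prob_space "\<lambda>_. Q" "{..<N}" ..
    interpret PR: product_prob_space "\<lambda>_. ?R" "{..<N}" ..
    show ?thesis
    proof (rule PR.PiM_eqI)
      fix B assume B: "\<And>k. k \<in> {..<N} \<Longrightarrow> B k \<in> sets ?R"
      have "T N -` Pi\<^sub>E {..<N} B \<inter> space (\<Pi>\<^sub>M k\<in>{..<N}. Q) = Pi\<^sub>E {..<N} (\<lambda>k. \<phi> -` B k \<inter> space Q)"
        by (auto simp: T_def space_PiM PiE_iff extensional_def)
      then have "emeasure (distr (\<Pi>\<^sub>M k\<in>{..<N}. Q) (\<Pi>\<^sub>M k\<in>{..<N}. ?R) (T N)) (Pi\<^sub>E {..<N} B)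
          = emeasure (\<Pi>\<^sub>M k\<in>{..<N}. Q) (Pi\<^sub>E {..<N} (\<lambda>k. \<phi> -` B k \<inter> space Q))"
        using B by (subst emeasure_distr) (auto intro!: sets_PiM_I_finite)
      also have "\<dots> = (\<Prod>k<N. emeasure Q (\<phi> -` B k \<inter> space Q))"
        using B by (subst PQ.emeasure_PiM) (auto intro!: measurable_sets[OF \<phi>])
      also have "\<dots> = (\<Prod>k<N. emeasure ?R (B k))"
        using B by (intro prod.cong refl) (auto simp: emeasure_distr)
      finally show "emeasure (distr (\<Pi>\<^sub>M k\<in>{..<N}. Q) (\<Pi>\<^sub>M k\<in>{..<N}. ?R) (T N)) (Pi\<^sub>E {..<N} B) = (\<Prod>k<N. emeasure ?R (B k))" .
    qed auto
  qed
  have hm: "h i \<in> borel_measurable MX" if "i \<in> I" for i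
    using borel_measurable_integrable[OF mean_gc_integrable[OF h that]] by simp
  show ?thesis
  proof (rule mean_gcI[where D = "\<lambda>N w. D N (T N w)"])
    fix N :: nat and w i assume w: "w \<in> space (\<Pi>\<^sub>M k\<in>{..<N}. Q)" and i: "i \<in> I"
    have "T N w \<in> space (\<Pi>\<^sub>M k\<in>{..<N}. ?R)" by (rule measurable_space[OF T w])
    from hD[OF this i] show "ennreal \<bar>(\<Sum>k<N. h i (\<phi> (w k))) - real N * (\<integral>x. h i (\<phi> x) \<partial>Q)\<bar> \<le> D N (T N w)"
      using hm[OF i] by (simp add: integral_distr T_def)
  next
    have "(\<integral>\<^sup>+w. D N (T N w) \<partial>(\<Pi>\<^sub>M k\<in>{..<N}. Q)) = (\<integral>\<^sup>+w. D N w \<partial>(\<Pi>\<^sub>M k\<in>{..<N}. ?R))" for N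
    proof -
      have "(\<integral>\<^sup>+w. D N w \<partial>(\<Pi>\<^sub>M k\<in>{..<N}. ?R)) = (\<integral>\<^sup>+w. D N w \<partial>distr (\<Pi>\<^sub>M k\<in>{..<N}. Q) (\<Pi>\<^sub>M k\<in>{..<N}. ?R) (T N))"
        by (simp only: law)
      then show ?thesis by (simp add: nn_integral_distr)
    qed
    then show "(\<lambda>N. (\<integral>\<^sup>+w. D N (T N w) \<partial>(\<Pi>\<^sub>M k\<in>{..<N}. Q)) / of_nat N) \<longlonglongrightarrow> 0"
      using limD by simp
  next
    show "integrable Q (\<lambda>x. h i (\<phi> x))" if "i \<in> I" for i
      using mean_gc_integrable[OF h that] hm[OF that] by (simp add: integrable_distr_eq)
  next
    show "(\<lambda>w. D N (T N w)) \<in> borel_measurable (\<Pi>\<^sub>M k\<in>{..<N}. Q)" for N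
      by (rule measurable_compose[OF T D])
  qed
qed

lemma mean_gc_cong:
  assumes h: "mean_gc Q I h" and eq: "\<And>i x. i \<in> I \<Longrightarrow> x \<in> space Q \<Longrightarrow> h i x = g i x"
  shows "mean_gc Q I g"
proof -
  obtain D where D: "\<And>N. D N \<in> borel_measurable (\<Pi>\<^sub>M k\<in>{..<N}. Q)"
    and le: "\<And>N w i. w \<in> space (\<Pi>\<^sub>M k\<in>{..<N}. Q) \<Longrightarrow> i \<in> I \<Longrightarrow>
          ennreal \<bar>(\<Sum>k<N. h i (w k)) - real N * (\<integral>x. h i x \<partial>Q)\<bar> \<le> D N w"
    and lim: "(\<lambda>N. (\<integral>\<^sup>+w. D N w \<partial>(\<Pi>\<^sub>M k\<in>{..<N}. Q)) / of_nat N) \<longlonglongrightarrow> 0"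
    using mean_gcE[OF h] by blast
  show ?thesis
  proof (rule mean_gcI[where D = D])
    fix i assume "i \<in> I"
    then show "integrable Q (g i)"
      using mean_gc_integrable[OF h] Bochner_Integration.integrable_cong[of Q Q "h i" "g i"] eq by auto
  next
    fix N :: nat and w i assume w: "w \<in> space (\<Pi>\<^sub>M k\<in>{..<N}. Q)" and i: "i \<in> I"
    have "(\<Sum>k<N. g i (w k)) = (\<Sum>k<N. h i (w k))"
      by (intro sum.cong) (use w i eq in \<open>auto simp: space_PiM PiE_iff\<close>)
    moreover have "(\<integral>x. g i x \<partial>Q) = (\<integral>x. h i x \<partial>Q)"
      by (intro Bochner_Integration.integral_cong) (use i eq in auto)
    ultimately show "ennreal \<bar>(\<Sum>k<N. g i (w k)) - real N * (\<integral>x. g i x \<partial>Q)\<bar> \<le> D N w"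
      using le[OF w i] by simp
  qed (use D lim in auto)
qed

text \<open>A class indexed by its own members becomes one indexed by parameters; several parameters
  may name the same function.\<close>

lemma mean_gc_reindex: "mean_gc Q (g ` I) h \<Longrightarrow> mean_gc Q I (\<lambda>i. h (g i))"
  unfolding mean_gc_def by simp

text \<open>Centering leaves every deviation of a sum from its expectation unchanged, so the
  majorants can be kept.\<close>

lemma mean_gc_center:
  assumes Q: "prob_space Q" and h: "mean_gc Q I h"
  shows "mean_gc Q I (\<lambda>i x. h i x - (\<integral>x. h i x \<partial>Q))"
proof -
  interpret Q: prob_space Q by fact
  have "(\<Sum>k<N. h i (w k) - (\<integral>x. h i x \<partial>Q)) - real N * (\<integral>x. h i x - (\<integral>x. h i x \<partial>Q) \<partial>Q)
      = (\<Sum>k<N. h i (w k)) - real N * (\<integral>x. h i x \<partial>Q)" if "i \<in> I" for i N and w :: "nat \<Rightarrow> 'a"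
    using mean_gc_integrable[OF h that] by (simp add: sum_subtractf Q.prob_space)
  then show ?thesis
    using h unfolding mean_gc_def by simp
qed

section \<open>From almost sure convergence to an integrable envelope and convergence in the
  mean\<close>

lemma gc_majorant:
  assumes gc: "glivenko_cantelli P F"
  shows "\<exists>\<Delta>. (\<forall>n. \<Delta> n \<in> borel_measurable (\<Pi>\<^sub>M i\<in>(UNIV :: nat set). P)) \<and>
    (AE x in \<Pi>\<^sub>M i\<in>(UNIV :: nat set). P. (\<lambda>n. \<Delta> n x) \<longlonglongrightarrow> 0) \<and>
    (\<forall>n. \<forall>x\<in>space (\<Pi>\<^sub>M i\<in>(UNIV :: nat set). P). \<forall>f\<in>F.
      ennreal \<bar>(\<Sum>i<n. f (x i)) - real n * (\<integral>z. f z \<partial>P)\<bar> \<le> of_nat n * \<Delta> n x)"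
proof -
  let ?S = "\<Pi>\<^sub>M i\<in>(UNIV :: nat set). P"
  from gc obtain \<Delta> where \<Delta>: "\<And>n. \<Delta> n \<in> borel_measurable ?S"
    and le: "\<And>n x. x \<in> space ?S \<Longrightarrow> (SUP f\<in>F. ennreal \<bar>empirical n x f - (\<integral>z. f z \<partial>P)\<bar>) \<le> \<Delta> n x"
    and lim: "AE x in ?S. (\<lambda>n. \<Delta> n x) \<longlonglongrightarrow> 0"
    unfolding glivenko_cantelli_def converges_outer_AE_0_def by blast
  have "ennreal \<bar>(\<Sum>i<n. f (x i)) - real n * (\<integral>z. f z \<partial>P)\<bar> \<le> of_nat n * \<Delta> n x"
    if x: "x \<in> space ?S" and f: "f \<in> F" for n x f
  proof (cases "n = 0")
    case False
    then have "(\<Sum>i<n. f (x i)) - real n * (\<integral>z. f z \<partial>P) = real n * (empirical n x f - (\<integral>z. f z \<partial>P))"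
      by (simp add: empirical_def field_simps)
    then have "ennreal \<bar>(\<Sum>i<n. f (x i)) - real n * (\<integral>z. f z \<partial>P)\<bar> = of_nat n * ennreal \<bar>empirical n x f - (\<integral>z. f z \<partial>P)\<bar>"
      by (simp add: abs_mult ennreal_mult ennreal_of_nat_eq_real_of_nat)
    also have "ennreal \<bar>empirical n x f - (\<integral>z. f z \<partial>P)\<bar> \<le> \<Delta> n x"
      by (rule order_trans[OF SUP_upper le[OF x]]) (use f in auto)
    finally show ?thesis by (simp add: mult_left_mono)
  qed simp
  with \<Delta> lim show ?thesis by blast
qed

text \<open>
  This is where almost sure convergence is needed. Consecutive averages give \<open>\<bar>f (x n) - \<integral>f\<bar> \<le> 2 n + 1\<close>
  for all \<open>n \<ge> m\<close> on a set \<open>B\<close> of positive measure. As \<open>B\<close> is almost surely contained in the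
  product of the sets \<open>I n\<close> of those \<open>t\<close> whose section of \<open>B\<close> at coordinate \<open>n\<close> is not null, the
  complements of the \<open>I n\<close> have summable measure.
\<close>
lemma gc_envelope:
  assumes P: "prob_space P" and gc: "glivenko_cantelli P F"
  obtains H where "H \<in> borel_measurable P" "(\<integral>\<^sup>+x. H x \<partial>P) < \<infinity>"
    and "\<And>f x. f \<in> F \<Longrightarrow> x \<in> space P \<Longrightarrow> ennreal \<bar>f x - (\<integral>z. f z \<partial>P)\<bar> \<le> H x"
proof -
  let ?S = "\<Pi>\<^sub>M i\<in>(UNIV :: nat set). P"
  interpret P: prob_space P by fact
  interpret S: sequence_space P ..
  obtain \<Delta> where \<Delta>[measurable]: "\<And>n. \<Delta> n \<in> borel_measurable ?S"
    and lim: "AE x in ?S. (\<lambda>n. \<Delta> n x) \<longlonglongrightarrow> 0"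
    and le: "\<And>n x f. x \<in> space ?S \<Longrightarrow> f \<in> F \<Longrightarrow>
      ennreal \<bar>(\<Sum>i<n. f (x i)) - real n * (\<integral>z. f z \<partial>P)\<bar> \<le> of_nat n * \<Delta> n x"
    using gc_majorant[OF gc] by blast
  define B where "B m = {x \<in> space ?S. \<forall>n\<ge>m. \<Delta> n x \<le> 1}" for m
  have B_sets[measurable]: "B m \<in> sets ?S" for m
    unfolding B_def by measurable
  \<comment> \<open>If all \<open>B m\<close> were null, almost no sequence would satisfy
    \<open>\<Delta> n x \<le> 1\<close> for all large \<open>n\<close>, against the almost sure
    convergence.\<close>
  have "\<exists>m. emeasure ?S (B m) \<noteq> 0"
  proof (rule ccontr)
    assume "\<nexists>m. emeasure ?S (B m) \<noteq> 0"
    then have "AE x in ?S. \<forall>m. x \<notin> B m"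
      by (subst AE_all_countable) (auto intro!: AE_not_in)
    with AE_space lim have "AE x in ?S. False"
    proof eventually_elim
      case (elim x)
      from order_tendstoD(2)[OF elim(2), of 1] obtain m where "\<forall>n\<ge>m. \<Delta> n x < 1"
        by (auto simp: eventually_sequentially)
      then have "x \<in> B m" using elim(1) by (auto simp: B_def intro: less_imp_le)
      with elim(3) show False by auto
    qed
    then show False using S.P.AE_False by simp
  qed
  then obtain m where m: "emeasure ?S (B m) \<noteq> 0" by blast
  have osc: "ennreal \<bar>f (x n) - (\<integral>z. f z \<partial>P)\<bar> \<le> of_nat (2 * n + 1)" if x: "x \<in> B m" and "n \<ge> m" and f: "f \<in> F" for f x n
  proof -
    have xS: "x \<in> space ?S" and 1: "\<Delta> n x \<le> 1" "\<Delta> (Suc n) x \<le> 1" using x \<open>n \<ge> m\<close> by (auto simp: B_def)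
    let ?a = "\<lambda>n. (\<Sum>i<n. f (x i)) - real n * (\<integral>z. f z \<partial>P)"
    have eq: "f (x n) - (\<integral>z. f z \<partial>P) = ?a (Suc n) - ?a n" by (simp add: algebra_simps)
    have "ennreal \<bar>f (x n) - (\<integral>z. f z \<partial>P)\<bar> \<le> ennreal (\<bar>?a (Suc n)\<bar> + \<bar>?a n\<bar>)"
      unfolding eq by (rule ennreal_leI[OF abs_triangle_ineq4])
    also have "\<dots> = ennreal \<bar>?a (Suc n)\<bar> + ennreal \<bar>?a n\<bar>" by simp
    also have "\<dots> \<le> of_nat (Suc n) * \<Delta> (Suc n) x + of_nat n * \<Delta> n x"
      by (intro add_mono le xS f)
    also have "\<dots> \<le> of_nat (Suc n) * 1 + of_nat n * 1"
      by (intro add_mono mult_left_mono 1) auto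
    also have "\<dots> = of_nat (2 * n + 1)" by (simp add: mult_2)
    finally show ?thesis .
  qed
  have upd[measurable]: "(\<lambda>(t, x). x(n := t)) \<in> P \<Otimes>\<^sub>M ?S \<rightarrow>\<^sub>M ?S" for n
    unfolding split_beta by (rule measurable_fun_upd[where J=UNIV]) auto
  \<comment> \<open>The measure of the section of \<open>B m\<close> at which coordinate
    \<open>n\<close> equals \<open>t\<close>.\<close>
  define s where "s n t = (\<integral>\<^sup>+x. indicator (B m) (x(n := t)) \<partial>?S)" for n t
  have [measurable]: "s n \<in> borel_measurable P" for n
  proof -
    have "(\<lambda>z. (indicator (B m) (case z of (t, x) \<Rightarrow> x(n := t)) :: ennreal)) \<in> borel_measurable (P \<Otimes>\<^sub>M ?S)"
      by measurable
    from S.P.borel_measurable_nn_integral_fst[OF this] show ?thesis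
      by (simp add: s_def[abs_def])
  qed
  define I where "I n = {t \<in> space P. s n t \<noteq> 0}" for n
  have I_sets[measurable]: "I n \<in> sets P" for n
    unfolding I_def by measurable
  have I_osc: "ennreal \<bar>f t - (\<integral>z. f z \<partial>P)\<bar> \<le> of_nat (2 * n + 1)" if "t \<in> I n" "n \<ge> m" "f \<in> F" for f t n
  proof -
    \<comment> \<open>A section of positive measure is nonempty, and any sequence in it transfers
      the bound \<open>2 n + 1\<close> to the value \<open>t\<close>.\<close>
    have "\<exists>x. x(n := t) \<in> B m"
    proof (rule ccontr)
      assume "\<nexists>x. x(n := t) \<in> B m"
      then have "s n t = 0" by (simp add: s_def)
      with that show False by (simp add: I_def)
    qed
    then obtain x where "x(n := t) \<in> B m" by blast
    from osc[OF this \<open>n \<ge> m\<close> \<open>f \<in> F\<close>] show ?thesis by simp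
  qed
  have B_I: "AE x in ?S. x \<in> B m \<longrightarrow> x n \<in> I n" for n
  proof -
    let ?f = "\<lambda>x. indicator (B m) x * indicator (space P - I n) (x n) :: ennreal"
    \<comment> \<open>With coordinate \<open>n\<close> integrated last, the integrand vanishes for
      every \<open>t\<close>, either because \<open>t \<in> I n\<close> or because
      \<open>s n t = 0\<close>.\<close>
    have "(\<integral>\<^sup>+x. ?f x \<partial>?S) = (\<integral>\<^sup>+t. \<integral>\<^sup>+x. ?f (x(n := t)) \<partial>?S \<partial>P)"
      by (rule nn_integral_PiM_update(2)[OF P]) auto
    also have "\<dots> = (\<integral>\<^sup>+t. s n t * indicator (space P - I n) t \<partial>P)"
    proof (rule nn_integral_cong)
      fix t assume t: "t \<in> space P"
      have "(\<lambda>x. x(n := t)) \<in> ?S \<rightarrow>\<^sub>M ?S"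
        by (rule measurable_fun_upd[where J=UNIV]) (use t in auto)
      then have "(\<lambda>x. indicator (B m) (x(n := t)) :: ennreal) \<in> borel_measurable ?S"
        by measurable
      then show "(\<integral>\<^sup>+x. ?f (x(n := t)) \<partial>?S) = s n t * indicator (space P - I n) t"
        by (simp add: s_def nn_integral_multc)
    qed
    also have "\<dots> = 0"
      by (auto simp: I_def nn_integral_0_iff_AE split: split_indicator)
    finally have "AE x in ?S. ?f x = 0"
      by (subst (asm) nn_integral_0_iff_AE) auto
    with AE_space show ?thesis
    proof eventually_elim
      case (elim x)
      then show ?case by (auto simp: space_PiM indicator_def split: if_splits)
    qed
  qed
  define q where "q n = measure P (space P - I n)" for n
  have q: "0 \<le> q n" "q n \<le> 1" for n by (auto simp: q_def)
  have b: "measure ?S (B m) > 0"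
    using m by (simp add: S.P.emeasure_eq_measure zero_less_measure_iff)
  have partial: "(\<Sum>n\<in>{m..<M}. q n) \<le> - ln (measure ?S (B m))" for M
  proof -
    have "AE x in ?S. x \<in> B m \<longrightarrow> (\<forall>n\<in>{m..<M}. x n \<in> I n)"
      using AE_finite_allI[of "{m..<M}" "\<lambda>n x. x \<in> B m \<longrightarrow> x n \<in> I n" ?S] B_I by (auto simp: Ball_def)
    then have "emeasure ?S (B m) \<le> emeasure ?S {x\<in>space ?S. \<forall>n\<in>{m..<M}. x n \<in> I n}"
      by (intro emeasure_mono_AE) (auto simp: B_def)
    also have "\<dots> = (\<Prod>n\<in>{m..<M}. emeasure P (I n))"
      by (rule S.emeasure_PiM_Collect) auto
    also have "\<dots> = ennreal (\<Prod>n\<in>{m..<M}. 1 - q n)"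
      by (simp add: P.emeasure_eq_measure prod_ennreal q_def P.prob_compl)
    finally have "measure ?S (B m) \<le> (\<Prod>n\<in>{m..<M}. 1 - q n)"
      by (simp add: S.P.emeasure_eq_measure prod_nonneg q)
    \<comment> \<open>\<open>1 - q \<le> exp (- q)\<close> turns the lower bound on the product, the
      fixed positive measure of \<open>B m\<close>, into an upper bound on all partial sums.\<close>
    also have "\<dots> \<le> (\<Prod>n\<in>{m..<M}. exp (- q n))"
      using exp_ge_add_one_self[of "- q _"] q by (intro prod_mono) auto
    also have "\<dots> = exp (- (\<Sum>n\<in>{m..<M}. q n))"
      by (simp add: exp_sum sum_negf[symmetric])
    finally have "ln (measure ?S (B m)) \<le> ln (exp (- (\<Sum>n\<in>{m..<M}. q n)))"
      using b by (subst ln_le_cancel_iff) auto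
    then show ?thesis by simp
  qed
  define J where "J n = (if m \<le> n then space P - I n else {})" for n
  have [measurable]: "J n \<in> sets P" for n by (auto simp: J_def)
  \<comment> \<open>\<open>K\<close> counts the indices \<open>n \<ge> m\<close> with
    \<open>t \<notin> I n\<close>; its integral is the sum of the \<open>q n\<close> over these
    \<open>n\<close>.\<close>
  define K where "K t = (\<Sum>n. indicator (J n) t :: ennreal)" for t
  have [measurable]: "K \<in> borel_measurable P" unfolding K_def by measurable
  have K_ge: "of_nat (n - m) \<le> K t" if "t \<in> space P" "\<And>k. m \<le> k \<Longrightarrow> k < n \<Longrightarrow> t \<notin> I k" for n t
  proof -
    have "(\<Sum>k\<in>{m..<n}. 1 :: ennreal) = (\<Sum>k\<in>{m..<n}. indicator (J k) t)"
      by (intro sum.cong) (use that in \<open>auto simp: J_def\<close>)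
    also have "\<dots> \<le> K t"
      unfolding K_def by (intro sum_le_suminf summableI) auto
    finally show ?thesis by simp
  qed
  have K_int: "(\<integral>\<^sup>+t. K t \<partial>P) \<le> ennreal (- ln (measure ?S (B m)))"
  proof -
    have "(\<integral>\<^sup>+t. K t \<partial>P) = (\<Sum>n. emeasure P (J n))"
      unfolding K_def by (subst nn_integral_suminf) auto
    also have "\<dots> \<le> ennreal (- ln (measure ?S (B m)))"
    proof (rule suminf_le_const[OF summableI])
      fix n
      have "(\<Sum>k<n. emeasure P (J k)) = (\<Sum>k\<in>{m..<n}. ennreal (q k))"
        by (rule sum.mono_neutral_cong_right) (auto simp: J_def q_def P.emeasure_eq_measure)
      also have "\<dots> \<le> ennreal (- ln (measure ?S (B m)))"
        using partial[of n] q by (simp add: ennreal_leI)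
      finally show "(\<Sum>k<n. emeasure P (J k)) \<le> ennreal (- ln (measure ?S (B m)))" .
    qed
    finally show ?thesis .
  qed
  show ?thesis
  \<comment> \<open>If \<open>n\<close> is the least index from \<open>m\<close> on with
    \<open>t \<in> I n\<close>, then \<open>n - m \<le> K t\<close>, so \<open>2 n + 1\<close> is at
    most \<open>2 m + 1 + 2 K t\<close>. If there is no such index, \<open>K t\<close> is
    infinite.\<close>
  proof (rule that[of "\<lambda>t. of_nat (2 * m + 1) + 2 * K t"])
    have "(\<integral>\<^sup>+t. of_nat (2 * m + 1) + 2 * K t \<partial>P) = of_nat (2 * m + 1) + 2 * (\<integral>\<^sup>+t. K t \<partial>P)"
      by (simp add: nn_integral_add nn_integral_cmult P.emeasure_space_1)
    also have "\<dots> < \<infinity>"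
    proof -
      have "(of_nat (2 * m + 1) :: ennreal) < top" by (rule of_nat_less_top)
      moreover have "2 * (\<integral>\<^sup>+t. K t \<partial>P) < top"
        using le_less_trans[OF K_int ennreal_less_top] by (auto simp: ennreal_mult_less_top)
      ultimately show ?thesis by (simp only: ennreal_add_less_top infinity_ennreal_def)
    qed
    finally show "(\<integral>\<^sup>+t. of_nat (2 * m + 1) + 2 * K t \<partial>P) < \<infinity>" .
  next
    fix f t assume f: "f \<in> F" and t: "t \<in> space P"
    show "ennreal \<bar>f t - (\<integral>z. f z \<partial>P)\<bar> \<le> of_nat (2 * m + 1) + 2 * K t"
    proof (cases "\<exists>n\<ge>m. t \<in> I n")
      case True
      define n where "n = (LEAST n. m \<le> n \<and> t \<in> I n)"
      from True have n: "m \<le> n" "t \<in> I n"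
        unfolding n_def by (metis (mono_tags, lifting) LeastI)+
      have "t \<notin> I k" if "m \<le> k" "k < n" for k
        using that not_less_Least n_def by auto
      then have "2 * of_nat (n - m) \<le> 2 * K t" using K_ge[OF t] by (intro mult_left_mono) auto
      then have "of_nat (2 * m + 1) + 2 * of_nat (n - m) \<le> of_nat (2 * m + 1) + 2 * K t"
        by (intro add_left_mono)
      moreover have "of_nat (2 * n + 1) = (of_nat (2 * m + 1) + 2 * of_nat (n - m) :: ennreal)"
      proof -
        have "2 * n + 1 = (2 * m + 1) + 2 * (n - m)" using n by simp
        then show ?thesis by (metis of_nat_add of_nat_mult of_nat_numeral)
      qed
      ultimately show ?thesis using I_osc[OF n(2,1) f] by (metis order_trans)
    next
      case False
      then have "of_nat n \<le> K t" for n using K_ge[OF t, of "n + m"] by auto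
      then have "K t = \<infinity>"
        by (metis ennreal_Ex_less_of_nat infinity_ennreal_def less_top not_le)
      then show ?thesis by (simp add: ennreal_mult_top)
    qed
  qed measurable
qed

lemma nn_integral_min_tendsto_0:
  assumes "finite_measure M" and [measurable]: "\<And>n. \<Delta> n \<in> borel_measurable M"
    and lim: "AE x in M. (\<lambda>n. \<Delta> n x) \<longlonglongrightarrow> (0 :: ennreal)"
  shows "(\<lambda>n. \<integral>\<^sup>+x. min (\<Delta> n x) (of_nat K) \<partial>M) \<longlonglongrightarrow> 0"
proof -
  interpret finite_measure M by fact
  have "(\<lambda>n. \<integral>\<^sup>+x. min (\<Delta> n x) (of_nat K) \<partial>M) \<longlonglongrightarrow> (\<integral>\<^sup>+x. 0 \<partial>M)"
  proof (rule nn_integral_dominated_convergence[where w = "\<lambda>_. of_nat K"])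
    show "AE x in M. (\<lambda>n. min (\<Delta> n x) (of_nat K)) \<longlonglongrightarrow> 0"
      using lim
    proof eventually_elim
      case (elim x)
      show ?case
        by (rule tendsto_sandwich[OF _ _ tendsto_const elim]) auto
    qed
    show "(\<integral>\<^sup>+x. of_nat K \<partial>M) < \<infinity>"
      by (auto simp: ennreal_mult_eq_top_iff less_top[symmetric])
  qed auto
  then show ?thesis by simp
qed

text \<open>Subtraction in \<open>ennreal\<close> is cut off at 0, so the integrand is the excess of
  \<open>H\<close> over the level \<open>K\<close>. It is dominated by \<open>H\<close> and vanishes
  once \<open>K\<close> exceeds a finite value of \<open>H\<close>.\<close>

lemma nn_integral_excess_tendsto_0:
  assumes [measurable]: "H \<in> borel_measurable M" and fin: "(\<integral>\<^sup>+x. H x \<partial>M) < \<infinity>"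
  shows "(\<lambda>K. \<integral>\<^sup>+x. H x - of_nat K \<partial>M) \<longlonglongrightarrow> 0"
proof -
  have "(\<lambda>K. \<integral>\<^sup>+x. H x - of_nat K \<partial>M) \<longlonglongrightarrow> (\<integral>\<^sup>+x. 0 \<partial>M)"
  proof (rule nn_integral_dominated_convergence[where w = H])
    have "AE x in M. H x \<noteq> \<infinity>"
      using fin by (intro nn_integral_PInf_AE) auto
    then show "AE x in M. (\<lambda>K. H x - of_nat K) \<longlonglongrightarrow> 0"
    proof eventually_elim
      case (elim x)
      then obtain n where "H x < of_nat n"
        using ennreal_Ex_less_of_nat[of "H x"] by (auto simp: less_top)
      then have "H x - of_nat K = 0" if "K \<ge> n" for K
      proof -
        have "H x \<le> of_nat n" using \<open>H x < of_nat n\<close> by simp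
        also have "of_nat n \<le> (of_nat K :: ennreal)" using that by (simp add: of_nat_mono)
        finally show ?thesis using ennreal_minus_mono[of "H x" "of_nat K" "of_nat K" "of_nat K"] by simp
      qed
      then show ?case by (intro tendsto_eventually) (auto intro: eventually_sequentiallyI)
    qed
    show "AE x in M. H x - of_nat K \<le> H x" for K
      by (auto intro: diff_le_self_ennreal)
  qed (use fin in auto)
  then show ?thesis by simp
qed

text \<open>
  The majorant of the definition depends on the whole sequence; the coordinates from \<open>N\<close> on are
  integrated out after truncating at the sum of the envelope, which is uniformly integrable.
\<close>
lemma glivenko_cantelli_mean_gc:
  assumes P: "prob_space P" and gc: "glivenko_cantelli P F"
  shows "mean_gc P F (\<lambda>f. f)"
proof -
  let ?S = "\<Pi>\<^sub>M i\<in>(UNIV :: nat set). P"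
  interpret P: prob_space P by fact
  interpret S: sequence_space P ..
  obtain \<Delta> where \<Delta>[measurable]: "\<And>n. \<Delta> n \<in> borel_measurable ?S"
    and lim: "AE x in ?S. (\<lambda>n. \<Delta> n x) \<longlonglongrightarrow> 0"
    and le: "\<And>n x f. x \<in> space ?S \<Longrightarrow> f \<in> F \<Longrightarrow>
      ennreal \<bar>(\<Sum>i<n. f (x i)) - real n * (\<integral>z. f z \<partial>P)\<bar> \<le> of_nat n * \<Delta> n x"
    using gc_majorant[OF gc] by blast
  obtain H where H[measurable]: "H \<in> borel_measurable P" and Hfin: "(\<integral>\<^sup>+x. H x \<partial>P) < \<infinity>"
    and Hle: "\<And>f x. f \<in> F \<Longrightarrow> x \<in> space P \<Longrightarrow> ennreal \<bar>f x - (\<integral>z. f z \<partial>P)\<bar> \<le> H x"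
    using gc_envelope[OF P gc] by blast
  \<comment> \<open>Both terms bound the deviation, hence so does their minimum. It inherits
    smallness from \<open>\<Delta>\<close> and uniform integrability from the envelope.\<close>
  define G where "G N x = min (of_nat N * \<Delta> N x) (\<Sum>k<N. H (x k))" for N x
  have G[measurable]: "G N \<in> borel_measurable ?S" for N
    unfolding G_def by measurable
  have G_le: "ennreal \<bar>(\<Sum>k<N. f (x k)) - real N * (\<integral>z. f z \<partial>P)\<bar> \<le> G N x"
    if x: "x \<in> space ?S" and f: "f \<in> F" for N x f
  proof -
    have xk: "x k \<in> space P" for k using x by (auto simp: space_PiM)
    have eq: "(\<Sum>k<N. f (x k)) - real N * (\<integral>z. f z \<partial>P) = (\<Sum>k<N. f (x k) - (\<integral>z. f z \<partial>P))"
      by (simp add: sum_subtractf)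
    have "ennreal \<bar>(\<Sum>k<N. f (x k)) - real N * (\<integral>z. f z \<partial>P)\<bar> \<le> ennreal (\<Sum>k<N. \<bar>f (x k) - (\<integral>z. f z \<partial>P)\<bar>)"
      unfolding eq by (rule ennreal_leI[OF sum_abs])
    also have "\<dots> = (\<Sum>k<N. ennreal \<bar>f (x k) - (\<integral>z. f z \<partial>P)\<bar>)"
      by (rule sum_ennreal[symmetric]) simp
    also have "\<dots> \<le> (\<Sum>k<N. H (x k))"
      by (intro sum_mono Hle f xk)
    finally show ?thesis using le[OF x f] by (simp add: G_def)
  qed
  have comb: "(\<lambda>(w, \<xi>). comb_seq N w \<xi>) \<in> (\<Pi>\<^sub>M k\<in>{..<N}. P) \<Otimes>\<^sub>M ?S \<rightarrow>\<^sub>M ?S" for N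
  proof (rule measurable_PiM_single')
    show "(\<lambda>x. (case x of (w, \<xi>) \<Rightarrow> comb_seq N w \<xi>) i) \<in> (\<Pi>\<^sub>M k\<in>{..<N}. P) \<Otimes>\<^sub>M ?S \<rightarrow>\<^sub>M P" for i
    proof (cases "i < N")
      case True
      then have "(\<lambda>x. fst x i) \<in> (\<Pi>\<^sub>M k\<in>{..<N}. P) \<Otimes>\<^sub>M ?S \<rightarrow>\<^sub>M P"
        using measurable_compose[OF measurable_fst measurable_component_singleton[of i "{..<N}"]] by simp
      then show ?thesis using True by (simp add: comb_seq_def split_beta)
    qed (simp add: comb_seq_def split_beta)
  qed (auto simp: comb_seq_def space_pair_measure space_PiM PiE_iff)
  define D where "D N w = (\<integral>\<^sup>+\<xi>. G N (comb_seq N w \<xi>) \<partial>?S)" for N w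
  have D[measurable]: "D N \<in> borel_measurable (\<Pi>\<^sub>M k\<in>{..<N}. P)" for N
  proof -
    have "(\<lambda>(w, \<xi>). G N (comb_seq N w \<xi>)) \<in> borel_measurable ((\<Pi>\<^sub>M k\<in>{..<N}. P) \<Otimes>\<^sub>M ?S)"
      using measurable_compose[OF comb G] by (simp add: split_beta)
    from S.P.borel_measurable_nn_integral[OF this] show ?thesis by (simp add: D_def[abs_def])
  qed
  \<comment> \<open>Splicing the first \<open>N\<close> coordinates of one sequence with an
    independent sequence gives again a sequence of the same law, so averaging over the tail keeps
    the integral.\<close>
  have D_int: "(\<integral>\<^sup>+w. D N w \<partial>(\<Pi>\<^sub>M k\<in>{..<N}. P)) = (\<integral>\<^sup>+x. G N x \<partial>?S)" for N
  proof -
    have m: "(\<lambda>(x, \<xi>). G N (comb_seq N x \<xi>)) \<in> borel_measurable (?S \<Otimes>\<^sub>M ?S)"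
      using measurable_compose[OF measurable_comb_seq G] by (simp add: split_beta)
    have "(\<integral>\<^sup>+w. D N w \<partial>(\<Pi>\<^sub>M k\<in>{..<N}. P)) = (\<integral>\<^sup>+w. D N w \<partial>distr ?S (\<Pi>\<^sub>M k\<in>{..<N}. P) (\<lambda>x. restrict x {..<N}))"
      by (subst S.distr_PiM_restrict_finite) auto
    also have "\<dots> = (\<integral>\<^sup>+x. D N (restrict x {..<N}) \<partial>?S)"
      by (rule nn_integral_distr) measurable
    also have "\<dots> = (\<integral>\<^sup>+x. \<integral>\<^sup>+\<xi>. G N (comb_seq N x \<xi>) \<partial>?S \<partial>?S)"
    proof -
      have "comb_seq N (restrict x {..<N}) \<xi> = comb_seq N x \<xi>" for x \<xi> :: "nat \<Rightarrow> 'a"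
        by (auto simp: comb_seq_def fun_eq_iff)
      then show ?thesis by (simp add: D_def)
    qed
    also have "\<dots> = (\<integral>\<^sup>+z. (case z of (x, \<xi>) \<Rightarrow> G N (comb_seq N x \<xi>)) \<partial>(?S \<Otimes>\<^sub>M ?S))"
      using S.P.nn_integral_fst[OF m] by simp
    also have "\<dots> = (\<integral>\<^sup>+x. G N x \<partial>distr (?S \<Otimes>\<^sub>M ?S) ?S (\<lambda>(x, \<xi>). comb_seq N x \<xi>))"
      by (subst nn_integral_distr[OF measurable_comb_seq]) (auto intro!: nn_integral_cong)
    also have "\<dots> = (\<integral>\<^sup>+x. G N x \<partial>?S)"
      by (simp only: S.PiM_comb_seq)
    finally show ?thesis .
  qed
  \<comment> \<open>The envelope is split at level \<open>K\<close>: the part up to \<open>K\<close>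
    truncates \<open>\<Delta>\<close>, and the excess over \<open>K\<close> is added.\<close>
  have bound: "(\<integral>\<^sup>+x. G N x \<partial>?S) / of_nat N \<le> (\<integral>\<^sup>+x. min (\<Delta> N x) (of_nat K) \<partial>?S) + (\<integral>\<^sup>+x. H x - of_nat K \<partial>P)"
    if N: "N > 0" for N K
  proof -
    have G_min: "G N x \<le> of_nat N * min (\<Delta> N x) (of_nat K) + (\<Sum>k<N. H (x k) - of_nat K)" for x
    proof -
      have "(\<Sum>k<N. H (x k)) \<le> (\<Sum>k<N. of_nat K + (H (x k) - of_nat K))"
        by (intro sum_mono) (metis add.commute diff_add_cancel_ennreal linear add_increasing2 zero_le diff_eq_0_ennreal add_0 order_refl)
      also have "\<dots> = of_nat N * of_nat K + (\<Sum>k<N. H (x k) - of_nat K)"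
        by (simp add: sum.distrib)
      finally have "G N x \<le> min (of_nat N * \<Delta> N x) (of_nat N * of_nat K + (\<Sum>k<N. H (x k) - of_nat K))"
        unfolding G_def by (intro min.mono order_refl)
      also have "\<dots> \<le> min (of_nat N * \<Delta> N x) (of_nat N * of_nat K) + (\<Sum>k<N. H (x k) - of_nat K)"
        by (auto simp: min_def intro: add_increasing2)
      also have "min (of_nat N * \<Delta> N x) (of_nat N * of_nat K) = of_nat N * min (\<Delta> N x) (of_nat K)"
        by (metis min_of_mono mult_left_mono monoI zero_le)
      finally show ?thesis .
    qed
    have Hk: "(\<integral>\<^sup>+x. H (x k) - of_nat K \<partial>?S) = (\<integral>\<^sup>+x. H x - of_nat K \<partial>P)" for k
    proof -
      have "(\<integral>\<^sup>+x. H x - of_nat K \<partial>distr ?S P (\<lambda>x. x k)) = (\<integral>\<^sup>+x. H (x k) - of_nat K \<partial>?S)"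
        by (rule nn_integral_distr) measurable
      then show ?thesis by (simp add: S.PiM_component)
    qed
    have "(\<integral>\<^sup>+x. G N x \<partial>?S) \<le> (\<integral>\<^sup>+x. of_nat N * min (\<Delta> N x) (of_nat K) + (\<Sum>k<N. H (x k) - of_nat K) \<partial>?S)"
      using G_min by (intro nn_integral_mono)
    also have "\<dots> = of_nat N * (\<integral>\<^sup>+x. min (\<Delta> N x) (of_nat K) \<partial>?S) + (\<Sum>k<N. \<integral>\<^sup>+x. H (x k) - of_nat K \<partial>?S)"
      by (subst nn_integral_add) (auto simp: nn_integral_cmult nn_integral_sum)
    also have "\<dots> = ((\<integral>\<^sup>+x. min (\<Delta> N x) (of_nat K) \<partial>?S) + (\<integral>\<^sup>+x. H x - of_nat K \<partial>P)) * of_nat N"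
      by (simp add: Hk algebra_simps)
    finally have "(\<integral>\<^sup>+x. G N x \<partial>?S) / of_nat N \<le>
        ((\<integral>\<^sup>+x. min (\<Delta> N x) (of_nat K) \<partial>?S) + (\<integral>\<^sup>+x. H x - of_nat K \<partial>P)) * of_nat N / of_nat N"
      by (rule divide_right_mono_ennreal)
    also have "\<dots> = (\<integral>\<^sup>+x. min (\<Delta> N x) (of_nat K) \<partial>?S) + (\<integral>\<^sup>+x. H x - of_nat K \<partial>P)"
      using N by (intro ennreal_mult_divide_eq) auto
    finally show ?thesis .
  qed
  have D_lim: "(\<lambda>N. (\<integral>\<^sup>+w. D N w \<partial>(\<Pi>\<^sub>M k\<in>{..<N}. P)) / of_nat N) \<longlonglongrightarrow> 0"
  proof (rule order_tendstoI)
    fix e :: ennreal assume "0 < e"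
    then obtain r' where "0 < r'" "r' < e" using dense by blast
    then obtain r where r: "r' = ennreal r" "0 < r" "ennreal r < e"
      by (cases r') auto
    have r2: "0 < ennreal (r / 2)" using r by simp
    \<comment> \<open>\<open>K\<close> is chosen before \<open>N\<close>: the excess is small
      uniformly in \<open>N\<close>, and for fixed \<open>K\<close> the truncated part tends to
      0.\<close>
    obtain K where K: "(\<integral>\<^sup>+x. H x - of_nat K \<partial>P) < ennreal (r / 2)"
      using order_tendstoD(2)[OF nn_integral_excess_tendsto_0[OF H Hfin] r2]
      by (auto simp: eventually_sequentially)
    have "\<forall>\<^sub>F N in sequentially. (\<integral>\<^sup>+x. min (\<Delta> N x) (of_nat K) \<partial>?S) < ennreal (r / 2)"
      using order_tendstoD(2)[OF nn_integral_min_tendsto_0[OF S.P.finite_measure_axioms \<Delta> lim] r2] .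
    then show "\<forall>\<^sub>F N in sequentially. (\<integral>\<^sup>+w. D N w \<partial>(\<Pi>\<^sub>M k\<in>{..<N}. P)) / of_nat N < e"
      using eventually_gt_at_top[of 0]
    proof eventually_elim
      case (elim N)
      have "(\<integral>\<^sup>+w. D N w \<partial>(\<Pi>\<^sub>M k\<in>{..<N}. P)) / of_nat N \<le> ennreal (r / 2) + ennreal (r / 2)"
        unfolding D_int by (rule order_trans[OF bound[OF elim(2), of K]]) (use elim(1) K in \<open>auto intro!: add_mono\<close>)
      also have "\<dots> = ennreal r" using r by (subst ennreal_plus[symmetric]) auto
      finally show ?case using r by simp
    qed
  qed auto
  show ?thesis
  proof (rule mean_gcI[where D = D])
    show "integrable P f" if "f \<in> F" for f
      using gc that by (simp add: glivenko_cantelli_def)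
  next
    fix N :: nat and w f assume w: "w \<in> space (\<Pi>\<^sub>M k\<in>{..<N}. P)" and f: "f \<in> F"
    let ?c = "ennreal \<bar>(\<Sum>k<N. f (w k)) - real N * (\<integral>z. f z \<partial>P)\<bar>"
    \<comment> \<open>The deviation depends on the first \<open>N\<close> coordinates only, so
      averaging over the spliced tail \<open>\<xi>\<close> leaves it unchanged.\<close>
    have "?c = (\<integral>\<^sup>+\<xi>. ?c \<partial>?S)"
      by (simp add: S.P.emeasure_space_1)
    also have "\<dots> \<le> D N w"
      unfolding D_def
    proof (rule nn_integral_mono)
      fix \<xi> assume \<xi>: "\<xi> \<in> space ?S"
      have "comb_seq N w \<xi> \<in> space ?S"
        using w \<xi> by (auto simp: comb_seq_def space_PiM PiE_iff)
      from G_le[OF this f, of N] show "?c \<le> G N (comb_seq N w \<xi>)"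
        by (simp add: comb_seq_def)
    qed
    finally show "?c \<le> D N w" .
  qed (use D D_lim in auto)
qed

section \<open>Convergence in outer probability\<close>

lemma outer_measure_of_AE_eq_0:
  assumes "AE x in M. Q x"
  shows "outer_measure_of M {x \<in> space M. \<not> Q x} = 0"
proof -
  from AE_E[OF assms] obtain N where N: "{x \<in> space M. \<not> Q x} \<subseteq> N" "emeasure M N = 0" "N \<in> sets M" .
  then have "outer_measure_of M {x \<in> space M. \<not> Q x} \<le> outer_measure_of M N"
    by (intro outer_measure_of_mono)
  then show ?thesis using N by simp
qed

text \<open>Outer measure is subadditive: each set is replaced by a measurable hull of the same
  measure.\<close>

lemma outer_measure_of_tendsto_Un:
  assumes A: "\<And>n. A n \<subseteq> space M" "(\<lambda>n. outer_measure_of M (A n)) \<longlonglongrightarrow> 0"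
    and B: "\<And>n. B n \<subseteq> space M" "(\<lambda>n. outer_measure_of M (B n)) \<longlonglongrightarrow> 0"
  shows "(\<lambda>n. outer_measure_of M (A n \<union> B n)) \<longlonglongrightarrow> 0"
proof (rule tendsto_sandwich[OF _ _ tendsto_const])
  show "(\<lambda>n. outer_measure_of M (A n) + outer_measure_of M (B n)) \<longlonglongrightarrow> 0"
    using tendsto_add[OF A(2) B(2)] by simp
  show "\<forall>\<^sub>F n in sequentially. outer_measure_of M (A n \<union> B n) \<le> outer_measure_of M (A n) + outer_measure_of M (B n)"
  proof (intro always_eventually allI)
    fix n
    obtain E where E: "E \<in> sets M" "A n \<subseteq> E" "outer_measure_of M (A n) = emeasure M E"
      using outer_measure_of_attain[OF A(1)] by blast
    obtain F where F: "F \<in> sets M" "B n \<subseteq> F" "outer_measure_of M (B n) = emeasure M F"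
      using outer_measure_of_attain[OF B(1)] by blast
    have "outer_measure_of M (A n \<union> B n) \<le> outer_measure_of M (E \<union> F)"
      using E F by (intro outer_measure_of_mono) auto
    also have "\<dots> \<le> emeasure M E + emeasure M F"
      using E F by (simp add: emeasure_subadditive)
    finally show "outer_measure_of M (A n \<union> B n) \<le> outer_measure_of M (A n) + outer_measure_of M (B n)"
      using E F by simp
  qed
qed auto

lemma outer_measure_of_tendsto_UN:
  assumes "finite I" and "\<And>i n. i \<in> I \<Longrightarrow> A i n \<subseteq> space M"
    and "\<And>i. i \<in> I \<Longrightarrow> (\<lambda>n. outer_measure_of M (A i n)) \<longlonglongrightarrow> 0"
  shows "(\<lambda>n. outer_measure_of M (\<Union>i\<in>I. A i n)) \<longlonglongrightarrow> 0"
  using assms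
proof (induction I rule: finite_induct)
  case (insert i I)
  then have "(\<lambda>n. outer_measure_of M (A i n \<union> (\<Union>i\<in>I. A i n))) \<longlonglongrightarrow> 0"
    by (intro outer_measure_of_tendsto_Un) auto
  then show ?case by simp
qed simp

lemma outer_measure_of_tendsto_subset:
  assumes "(\<lambda>n. outer_measure_of M (B n)) \<longlonglongrightarrow> 0" and "\<And>n. 0 < n \<Longrightarrow> A n \<subseteq> B n"
  shows "(\<lambda>n. outer_measure_of M (A n)) \<longlonglongrightarrow> 0"
  by (rule tendsto_sandwich[OF _ _ tendsto_const assms(1)])
     (auto intro!: eventually_sequentiallyI[of 1] outer_measure_of_mono assms(2))

text \<open>The threshold grows with \<open>n\<close> because the majorants bound sums, not
  averages.\<close>

lemma outer_measure_of_tendsto_Markov: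
  assumes [measurable]: "\<And>n. Y n \<in> borel_measurable M"
    and lim: "(\<lambda>n. (\<integral>\<^sup>+\<omega>. Y n \<omega> \<partial>M) / of_nat n) \<longlonglongrightarrow> 0" and \<delta>: "0 < (\<delta> :: real)"
  shows "(\<lambda>n. outer_measure_of M {\<omega> \<in> space M. ennreal (\<delta> * real n) < Y n \<omega>}) \<longlonglongrightarrow> 0"
proof (rule tendsto_sandwich[OF _ _ tendsto_const])
  show "(\<lambda>n. ennreal (1 / \<delta>) * ((\<integral>\<^sup>+\<omega>. Y n \<omega> \<partial>M) / of_nat n)) \<longlonglongrightarrow> 0"
    using ennreal_tendsto_cmult[OF _ lim, of "ennreal (1 / \<delta>)"] by simp
  have "outer_measure_of M {\<omega> \<in> space M. ennreal (\<delta> * real n) < Y n \<omega>} \<le> ennreal (1 / \<delta>) * ((\<integral>\<^sup>+\<omega>. Y n \<omega> \<partial>M) / of_nat n)"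
    if n: "n > 0" for n
  proof -
    have "outer_measure_of M {\<omega> \<in> space M. ennreal (\<delta> * real n) < Y n \<omega>}
        \<le> emeasure M {\<omega> \<in> space M. 1 \<le> ennreal (1 / (\<delta> * real n)) * Y n \<omega>}"
    proof (subst outer_measure_of_eq, measurable, intro emeasure_mono subsetI)
      fix \<omega> assume "\<omega> \<in> {\<omega> \<in> space M. ennreal (\<delta> * real n) < Y n \<omega>}"
      then have "ennreal (1 / (\<delta> * real n)) * ennreal (\<delta> * real n) \<le> ennreal (1 / (\<delta> * real n)) * Y n \<omega>" "\<omega> \<in> space M"
        by (auto intro!: mult_left_mono)
      then show "\<omega> \<in> {\<omega> \<in> space M. 1 \<le> ennreal (1 / (\<delta> * real n)) * Y n \<omega>}"
        using \<delta> n by (simp add: ennreal_mult[symmetric])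
    qed measurable
    also have "\<dots> \<le> ennreal (1 / (\<delta> * real n)) * (\<integral>\<^sup>+\<omega>. Y n \<omega> * indicator (space M) \<omega> \<partial>M)"
      using nn_integral_Markov_inequality[where u = "Y n" and M = M and A = "space M" and c = "ennreal (1 / (\<delta> * real n))"] by simp
    also have "(\<integral>\<^sup>+\<omega>. Y n \<omega> * indicator (space M) \<omega> \<partial>M) = (\<integral>\<^sup>+\<omega>. Y n \<omega> \<partial>M)"
      by (rule nn_integral_cong) simp
    also have "ennreal (1 / (\<delta> * real n)) * (\<integral>\<^sup>+\<omega>. Y n \<omega> \<partial>M) = ennreal (1 / \<delta>) * ((\<integral>\<^sup>+\<omega>. Y n \<omega> \<partial>M) / of_nat n)"
    proof -
      have "inverse (of_nat n :: ennreal) = ennreal (1 / real n)"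
        using n by (simp add: ennreal_of_nat_eq_real_of_nat inverse_ennreal inverse_eq_divide)
      moreover have "ennreal (1 / (\<delta> * real n)) = ennreal (1 / \<delta>) * ennreal (1 / real n)"
        using \<delta> by (subst ennreal_mult[symmetric]) auto
      ultimately show ?thesis by (simp add: divide_ennreal_def mult_ac)
    qed
    finally show ?thesis .
  qed
  then show "\<forall>\<^sub>F n in sequentially. outer_measure_of M {\<omega> \<in> space M. ennreal (\<delta> * real n) < Y n \<omega>}
      \<le> ennreal (1 / \<delta>) * ((\<integral>\<^sup>+\<omega>. Y n \<omega> \<partial>M) / of_nat n)"
    by (intro eventually_sequentiallyI[of 1]) auto
qed auto

section \<open>Sampling from the sources\<close>

context merged_sampling
begin

lemma W_measurable[measurable]: "W i \<in> M \<rightarrow>\<^sub>M MX \<Otimes>\<^sub>M MU"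
  using iid_indep by (auto simp: indep_vars_def)

lemma sets_Pt[measurable_cong]: "sets Pt = sets (MX \<Otimes>\<^sub>M MU)"
  using iid_law[of 0] by (metis sets_distr)

lemma prob_space_Pt: "prob_space Pt"
  using prob_space_distr[OF W_measurable, of 0] by (simp add: iid_law)

lemma W_measurable_Pt[measurable]: "W i \<in> M \<rightarrow>\<^sub>M Pt"
  using W_measurable by (simp add: measurable_cong_sets[OF refl sets_Pt])

lemma distr_W: "distr M Pt (W i) = Pt"
  using iid_law[of i] by (metis distr_cong sets_Pt)

lemma V_of_measurable[measurable]: "V_of \<in> Pt \<rightarrow>\<^sub>M MC \<Otimes>\<^sub>M MU"
proof -
  note coarsen_measurable[measurable]
  show ?thesis
    unfolding V_of_def[abs_def] by measurable
qed

definition sample :: "nat \<Rightarrow> 'w \<Rightarrow> nat \<Rightarrow> 'x \<times> 'u" where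
  "sample N \<omega> = (\<lambda>i\<in>{..<N}. W i \<omega>)"

lemma sample_measurable[measurable]: "sample N \<in> M \<rightarrow>\<^sub>M (\<Pi>\<^sub>M i\<in>{..<N}. Pt)"
  unfolding sample_def[abs_def] by measurable

lemma distr_sample:
  assumes "0 < N"
  shows "distr M (\<Pi>\<^sub>M i\<in>{..<N}. Pt) (sample N) = (\<Pi>\<^sub>M i\<in>{..<N}. Pt)"
proof -
  have "indep_vars (\<lambda>_. Pt) W {..<N}"
    using indep_vars_subset[OF iid_indep, of "{..<N}"] sets_Pt W_measurable_Pt
    unfolding indep_vars_def2 by simp
  then have "distr M (\<Pi>\<^sub>M i\<in>{..<N}. Pt) (\<lambda>\<omega>. \<lambda>i\<in>{..<N}. W i \<omega>) = (\<Pi>\<^sub>M i\<in>{..<N}. distr M Pt (W i))"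
    using assms by (subst (asm) indep_vars_iff_distr_eq_PiM) auto
  then show ?thesis by (simp add: sample_def[abs_def] distr_W)
qed

lemma nn_integral_sample:
  assumes "0 < N" and "f \<in> borel_measurable (\<Pi>\<^sub>M i\<in>{..<N}. Pt)"
  shows "(\<integral>\<^sup>+\<omega>. f (sample N \<omega>) \<partial>M) = (\<integral>\<^sup>+w. f w \<partial>(\<Pi>\<^sub>M i\<in>{..<N}. Pt))"
  using assms by (metis distr_sample nn_integral_distr sample_measurable)

text \<open>\<open>units\<close> as a function of the data rather than of the outcome, so that it
  can be evaluated after a coordinate has been redrawn.\<close>

definition units_of :: "nat \<Rightarrow> nat \<Rightarrow> (nat \<Rightarrow> 'x \<times> 'u) \<Rightarrow> nat set" where
  "units_of N j w = {i \<in> {..<N}. V_of (w i) \<in> src j}"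

lemma units_of_subset: "units_of N j w \<subseteq> {..<N}"
  by (auto simp: units_of_def)

lemma units_eq: "units N j \<omega> = units_of N j (sample N \<omega>)"
  by (auto simp: units_def units_of_def sample_def V_def)

lemma units_of_measurable:
  assumes "j < J"
  shows "units_of N j \<in> (\<Pi>\<^sub>M i\<in>{..<N}. Pt) \<rightarrow>\<^sub>M count_space (Pow {..<N})"
proof (subst measurable_count_space_eq2)
  have V_sets: "{w \<in> space (\<Pi>\<^sub>M i\<in>{..<N}. Pt). V_of (w i) \<in> src j} \<in> sets (\<Pi>\<^sub>M i\<in>{..<N}. Pt)" if "i < N" for i
  proof -
    have "(\<lambda>w. V_of (w i)) \<in> (\<Pi>\<^sub>M i\<in>{..<N}. Pt) \<rightarrow>\<^sub>M MC \<Otimes>\<^sub>M MU"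
      by (rule measurable_compose[where g = V_of, OF _ V_of_measurable]) (use that in simp)
    from measurable_sets[OF this src_measurable[OF assms]] show ?thesis
      by (simp add: vimage_def Int_def conj_commute)
  qed
  have "units_of N j -` {U} \<inter> space (\<Pi>\<^sub>M i\<in>{..<N}. Pt) \<in> sets (\<Pi>\<^sub>M i\<in>{..<N}. Pt)" if "U \<subseteq> {..<N}" for U
  proof -
    have "units_of N j w = U \<longleftrightarrow> (\<forall>i\<in>{..<N}. (i \<in> U \<longleftrightarrow> V_of (w i) \<in> src j))" for w
      unfolding units_of_def using that by blast
    then have "units_of N j -` {U} \<inter> space (\<Pi>\<^sub>M i\<in>{..<N}. Pt)
       = {w \<in> space (\<Pi>\<^sub>M i\<in>{..<N}. Pt). \<forall>i\<in>{..<N}. (i \<in> U \<longleftrightarrow> V_of (w i) \<in> src j)}"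
      by (simp add: vimage_def Int_def conj_commute)
    also have "\<dots> \<in> sets (\<Pi>\<^sub>M i\<in>{..<N}. Pt)"
    proof (rule sets.sets_Collect_finite_All)
      fix i assume "i \<in> {..<N}"
      then show "{w \<in> space (\<Pi>\<^sub>M i\<in>{..<N}. Pt). i \<in> U \<longleftrightarrow> V_of (w i) \<in> src j} \<in> sets (\<Pi>\<^sub>M i\<in>{..<N}. Pt)"
        using V_sets[of i] sets.sets_Collect_neg[OF V_sets[of i]] by (cases "i \<in> U") auto
    qed simp
    finally show ?thesis .
  qed
  then show "units_of N j \<in> space (\<Pi>\<^sub>M i\<in>{..<N}. Pt) \<rightarrow> Pow {..<N} \<and>
      (\<forall>U\<in>Pow {..<N}. units_of N j -` {U} \<inter> space (\<Pi>\<^sub>M i\<in>{..<N}. Pt) \<in> sets (\<Pi>\<^sub>M i\<in>{..<N}. Pt))"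
    using units_of_subset by blast
qed auto

text \<open>The chance that simple random sampling draws exactly \<open>s\<close> when the units in
  source \<open>j\<close> are \<open>U\<close>. It depends on the data through \<open>U\<close>
  only, which makes it insensitive to redrawing inside the source.\<close>

definition srs :: "nat \<Rightarrow> nat \<Rightarrow> nat set \<Rightarrow> nat set \<Rightarrow> real" where
  "srs N j U s = pmf (pmf_of_set {T. T \<subseteq> U \<and> card T = size N j (card U)}) s"

text \<open>\<open>pmf_of_set\<close> has its meaning only on finite nonempty sets;
  \<open>size_le\<close> makes a sample of the required size possible.\<close>

lemma srs_support:
  assumes "j < J" "finite U"
  shows "finite {T. T \<subseteq> U \<and> card T = size N j (card U)}" "{T. T \<subseteq> U \<and> card T = size N j (card U)} \<noteq> {}"
proof -
  show "finite {T. T \<subseteq> U \<and> card T = size N j (card U)}"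
    using assms(2) by (auto intro: finite_subset[of _ "Pow U"])
  obtain T where "T \<subseteq> U" "card T = size N j (card U)"
    using obtain_subset_with_card_n[OF size_le[OF assms(1), of N "card U"]] by metis
  then show "{T. T \<subseteq> U \<and> card T = size N j (card U)} \<noteq> {}" by blast
qed

lemma sum_srs:
  assumes "j < J" "U \<subseteq> {..<N}"
  shows "(\<Sum>s\<in>Pow {..<N}. srs N j U s) = 1"
proof -
  have "finite U" using assms(2) finite_subset by blast
  from srs_support[OF assms(1) this, of N] assms(2) show ?thesis
    unfolding srs_def by (intro sum_pmf_eq_1) (auto simp: set_pmf_of_set)
qed

lemma srs_nonneg[simp]: "0 \<le> srs N j U s"
  by (simp add: srs_def)

lemma srs_le_1: "srs N j U s \<le> 1"
  by (simp add: srs_def pmf_le_1)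

lemma srs_eq_0:
  assumes "j < J" "finite U" "\<not> (s \<subseteq> U \<and> card s = size N j (card U))"
  shows "srs N j U s = 0"
  using srs_support[OF assms(1,2), of N] assms(3) by (simp add: srs_def pmf_of_set)

lemma srs_measurable:
  assumes "j < J"
  shows "(\<lambda>w. srs N j (units_of N j w) s) \<in> borel_measurable (\<Pi>\<^sub>M i\<in>{..<N}. Pt)"
  by (rule measurable_compose[OF units_of_measurable[OF assms]]) simp

lemma S_subset: "j < J \<Longrightarrow> \<omega> \<in> space M \<Longrightarrow> S N j \<omega> \<subseteq> {..<N}"
  using measurable_space[OF S_measurable[of j N]] by auto

lemma S_eq_sets: "j < J \<Longrightarrow> {\<omega> \<in> space M. S N j \<omega> = s} \<in> sets M"
proof -
  assume j: "j < J"
  show ?thesis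
  proof (cases "s \<subseteq> {..<N}")
    case True
    then have "S N j -` {s} \<inter> space M \<in> sets M"
      by (intro measurable_sets[OF S_measurable[OF j]]) auto
    moreover have "S N j -` {s} \<inter> space M = {\<omega> \<in> space M. S N j \<omega> = s}" by auto
    ultimately show ?thesis by simp
  next
    case False
    then have "{\<omega> \<in> space M. S N j \<omega> = s} = {}" using S_subset[OF j, of _ N] by auto
    then show ?thesis by (simp only: sets.empty_sets)
  qed
qed

section \<open>The joint law of the data and the set drawn from one source\<close>

text \<open>Only the law of one source at a time is needed, so the other ones are summed out.\<close>
lemma single_source_sampling:
  assumes B: "B \<in> sets (\<Pi>\<^sub>M i\<in>{..<N}. Pt)" and j: "j < J" and s: "s \<subseteq> {..<N}"
  shows "prob {\<omega> \<in> space M. sample N \<omega> \<in> B \<and> S N j \<omega> = s}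
    = (\<integral>\<omega>. indicator B (sample N \<omega>) * srs N j (units_of N j (sample N \<omega>)) s \<partial>M)"
proof -
  \<comment> \<open>All tuples of selected sets whose \<open>j\<close>-th entry is \<open>s\<close>;
    the event splits into the finitely many disjoint events that such a tuple is drawn.\<close>
  let ?A = "\<lambda>k. if k = j then {s} else Pow {..<N}"
  let ?T = "PiE {..<J} ?A"
  let ?E = "\<lambda>t. {\<omega> \<in> space M. sample N \<omega> \<in> B \<and> (\<forall>k<J. S N k \<omega> = t k)}"
  note B[measurable]
  have finT: "finite ?T" by (intro finite_PiE) auto
  have Bm: "B \<in> sets (\<Pi>\<^sub>M i\<in>{..<N}. MX \<Otimes>\<^sub>M MU)"
    using B sets_PiM_cong[OF refl, of "{..<N}" "\<lambda>_. Pt" "\<lambda>_. MX \<Otimes>\<^sub>M MU"] sets_Pt by simp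
  have E_sets: "?E t \<in> events" for t
  proof -
    have "{\<omega> \<in> space M. sample N \<omega> \<in> B} \<in> events" by measurable
    moreover have "{\<omega> \<in> space M. \<forall>k\<in>{..<J}. S N k \<omega> = t k} \<in> events"
      by (intro sets.sets_Collect_finite_All) (auto intro!: S_eq_sets)
    ultimately have "{\<omega> \<in> space M. sample N \<omega> \<in> B} \<inter> {\<omega> \<in> space M. \<forall>k\<in>{..<J}. S N k \<omega> = t k} \<in> events"
      by (rule sets.Int)
    also have "{\<omega> \<in> space M. sample N \<omega> \<in> B} \<inter> {\<omega> \<in> space M. \<forall>k\<in>{..<J}. S N k \<omega> = t k} = ?E t" by auto
    finally show ?thesis .
  qed
  have E_prob: "prob (?E t) = (\<integral>\<omega>. indicator B (sample N \<omega>) * (\<Prod>k<J. srs N k (units_of N k (sample N \<omega>)) (t k)) \<partial>M)"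
    if t: "t \<in> ?T" for t
  proof -
    have "t k \<subseteq> {..<N}" if "k < J" for k
      using PiE_mem[OF t, of k] that s by (auto split: if_splits)
    from simple_random_sampling[OF Bm, of t, OF this] show ?thesis
      by (simp add: sample_def[symmetric] units_eq[symmetric] n_src_def N_src_def srs_def)
  qed
  have "{\<omega> \<in> space M. sample N \<omega> \<in> B \<and> S N j \<omega> = s} = (\<Union>t\<in>?T. ?E t)"
  proof (intro equalityI subsetI)
    fix \<omega> assume \<omega>: "\<omega> \<in> {\<omega> \<in> space M. sample N \<omega> \<in> B \<and> S N j \<omega> = s}"
    then have "(\<lambda>k\<in>{..<J}. S N k \<omega>) \<in> ?T" "\<omega> \<in> ?E (\<lambda>k\<in>{..<J}. S N k \<omega>)"
      using S_subset by auto
    then show "\<omega> \<in> (\<Union>t\<in>?T. ?E t)" by blast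
  next
    fix \<omega> assume "\<omega> \<in> (\<Union>t\<in>?T. ?E t)"
    then obtain t where t: "t \<in> ?T" "\<omega> \<in> ?E t" by blast
    then have "t j = s" using PiE_mem[OF t(1), of j] j by simp
    then show "\<omega> \<in> {\<omega> \<in> space M. sample N \<omega> \<in> B \<and> S N j \<omega> = s}" using t(2) j by auto
  qed
  moreover have "disjoint_family_on ?E ?T"
    unfolding disjoint_family_on_def
  proof (intro ballI impI)
    fix t u assume tu: "t \<in> ?T" "u \<in> ?T" "t \<noteq> u"
    then obtain k where "k < J" "t k \<noteq> u k" by (metis PiE_ext lessThan_iff)
    then show "?E t \<inter> ?E u = {}" by auto
  qed
  ultimately have "prob {\<omega> \<in> space M. sample N \<omega> \<in> B \<and> S N j \<omega> = s} = (\<Sum>t\<in>?T. prob (?E t))"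
    using finite_measure_finite_Union[OF finT, of ?E] image_subsetI[of ?T ?E events, OF E_sets] by simp
  also have "\<dots> = (\<Sum>t\<in>?T. \<integral>\<omega>. indicator B (sample N \<omega>) * (\<Prod>k<J. srs N k (units_of N k (sample N \<omega>)) (t k)) \<partial>M)"
    by (intro sum.cong refl E_prob)
  also have "\<dots> = (\<integral>\<omega>. (\<Sum>t\<in>?T. indicator B (sample N \<omega>) * (\<Prod>k<J. srs N k (units_of N k (sample N \<omega>)) (t k))) \<partial>M)"
  proof (rule Bochner_Integration.integral_sum[symmetric])
    fix t
    have "(\<lambda>\<omega>. srs N k (units_of N k (sample N \<omega>)) (t k)) \<in> borel_measurable M" if "k \<in> {..<J}" for k
      by (rule measurable_compose[OF sample_measurable srs_measurable]) (use that in simp)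
    then have [measurable]: "(\<lambda>\<omega>. \<Prod>k<J. srs N k (units_of N k (sample N \<omega>)) (t k)) \<in> borel_measurable M"
      by (intro borel_measurable_prod)
    then show "integrable M (\<lambda>\<omega>. indicator B (sample N \<omega>) * (\<Prod>k<J. srs N k (units_of N k (sample N \<omega>)) (t k)))"
      by (intro integrable_const_bound[where B = 1])
         (auto simp: abs_mult abs_prod prod_le_1 srs_le_1 split: split_indicator)
  qed
  also have "\<dots> = (\<integral>\<omega>. indicator B (sample N \<omega>) * srs N j (units_of N j (sample N \<omega>)) s \<partial>M)"
  proof (rule Bochner_Integration.integral_cong[OF refl])
    fix \<omega>
    \<comment> \<open>Independence across the sources gives a product, and a sum of products over
      tuples is a product of sums; every factor with \<open>k \<noteq> j\<close> is 1 by
      \<open>sum_srs\<close>.\<close>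
    have "(\<Sum>t\<in>?T. \<Prod>k<J. srs N k (units_of N k (sample N \<omega>)) (t k)) = (\<Prod>k<J. \<Sum>x\<in>?A k. srs N k (units_of N k (sample N \<omega>)) x)"
      by (rule prod_sum_PiE[symmetric]) auto
    also have "\<dots> = (\<Prod>k<J. if k = j then srs N j (units_of N j (sample N \<omega>)) s else 1)"
      by (intro prod.cong refl) (auto intro!: sum_srs simp: units_of_def)
    also have "\<dots> = srs N j (units_of N j (sample N \<omega>)) s"
      using j by (simp add: prod.delta)
    finally show "(\<Sum>t\<in>?T. indicator B (sample N \<omega>) * (\<Prod>k<J. srs N k (units_of N k (sample N \<omega>)) (t k)))
        = indicator B (sample N \<omega>) * srs N j (units_of N j (sample N \<omega>)) s"
      by (simp add: sum_distrib_left[symmetric])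
  qed
  finally show ?thesis .
qed

text \<open>Restricted to the event that \<open>s\<close> is drawn, the law of the data has density
  \<open>srs\<close> with respect to the product measure. This moves the sampling design to the
  space on which coordinates can be redrawn.\<close>

lemma nn_integral_sampling:
  assumes N: "0 < N" and j: "j < J" and s: "s \<subseteq> {..<N}"
    and f[measurable]: "f \<in> borel_measurable (\<Pi>\<^sub>M i\<in>{..<N}. Pt)"
  shows "(\<integral>\<^sup>+\<omega>. f (sample N \<omega>) * indicator {s} (S N j \<omega>) \<partial>M)
    = (\<integral>\<^sup>+w. f w * ennreal (srs N j (units_of N j w) s) \<partial>(\<Pi>\<^sub>M i\<in>{..<N}. Pt))"
proof -
  let ?P = "\<Pi>\<^sub>M i\<in>{..<N}. Pt"
  have ind: "(\<lambda>\<omega>. indicator {s} (S N j \<omega>) :: ennreal) = indicator {\<omega>. S N j \<omega> = s}"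
    by (auto simp: indicator_def)
  have [measurable]: "(\<lambda>\<omega>. indicator {s} (S N j \<omega>) :: ennreal) \<in> borel_measurable M"
    unfolding ind using S_eq_sets[OF j, of N s] by (subst borel_measurable_indicator_iff) (simp add: Int_def conj_commute)
  note srs_measurable[OF j, measurable]
  let ?\<nu> = "distr (density M (\<lambda>\<omega>. indicator {s} (S N j \<omega>))) ?P (sample N)"
  have "?\<nu> = density ?P (\<lambda>w. ennreal (srs N j (units_of N j w) s))"
  proof (rule measure_eqI)
    fix B assume "B \<in> sets ?\<nu>"
    then have B[measurable]: "B \<in> sets ?P" by simp
    have "emeasure ?\<nu> B = (\<integral>\<^sup>+\<omega>. indicator {s} (S N j \<omega>) * indicator (sample N -` B \<inter> space M) \<omega> \<partial>M)"
      by (subst emeasure_distr) (auto simp: emeasure_density)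
    also have "\<dots> = (\<integral>\<^sup>+\<omega>. indicator {\<omega> \<in> space M. sample N \<omega> \<in> B \<and> S N j \<omega> = s} \<omega> \<partial>M)"
      by (intro nn_integral_cong) (auto split: split_indicator)
    also have "\<dots> = emeasure M {\<omega> \<in> space M. sample N \<omega> \<in> B \<and> S N j \<omega> = s}"
      using j by (intro nn_integral_indicator) (intro sets.sets_Collect_conj S_eq_sets, measurable)
    also have "\<dots> = ennreal (\<integral>\<omega>. indicator B (sample N \<omega>) * srs N j (units_of N j (sample N \<omega>)) s \<partial>M)"
      by (simp add: emeasure_eq_measure single_source_sampling[OF B j s])
    also have "\<dots> = (\<integral>\<^sup>+\<omega>. ennreal (indicator B (sample N \<omega>) * srs N j (units_of N j (sample N \<omega>)) s) \<partial>M)"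
      by (intro nn_integral_eq_integral[symmetric] integrable_const_bound[where B = 1])
         (auto simp: srs_le_1 split: split_indicator)
    also have "\<dots> = (\<integral>\<^sup>+w. ennreal (indicator B w * srs N j (units_of N j w) s) \<partial>?P)"
      by (rule nn_integral_sample[OF N]) measurable
    also have "\<dots> = emeasure (density ?P (\<lambda>w. ennreal (srs N j (units_of N j w) s))) B"
      by (subst emeasure_density) (auto intro!: nn_integral_cong split: split_indicator)
    finally show "emeasure ?\<nu> B = emeasure (density ?P (\<lambda>w. ennreal (srs N j (units_of N j w) s))) B" .
  qed simp
  then have "(\<integral>\<^sup>+w. f w \<partial>?\<nu>) = (\<integral>\<^sup>+w. f w \<partial>density ?P (\<lambda>w. ennreal (srs N j (units_of N j w) s)))"
    by simp
  then show ?thesis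
    by (simp add: nn_integral_distr nn_integral_density mult.commute)
qed

text \<open>A set outside the support of the design is drawn with probability 0, and there are only
  finitely many candidates.\<close>

lemma AE_sample_drawn:
  assumes N: "0 < N" and j: "j < J"
  shows "AE \<omega> in M. S N j \<omega> \<subseteq> units N j \<omega> \<and> card (S N j \<omega>) = n_src N j \<omega>"
proof -
  let ?bad = "\<lambda>s w. \<not> (s \<subseteq> units_of N j w \<and> card s = size N j (card (units_of N j w)))"
  have fin: "finite (units_of N j w)" for w by (simp add: units_of_def)
  have "AE \<omega> in M. \<forall>s\<in>Pow {..<N}. \<not> (?bad s (sample N \<omega>) \<and> S N j \<omega> = s)"
  proof (rule AE_finite_allI)
    fix s assume "s \<in> Pow {..<N}"
    then have s: "s \<subseteq> {..<N}" by simp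
    define f where "f w = (if ?bad s w then 1 else 0 :: ennreal)" for w
    have f[measurable]: "f \<in> borel_measurable (\<Pi>\<^sub>M i\<in>{..<N}. Pt)"
      unfolding f_def by (rule measurable_compose[OF units_of_measurable[OF j]]) simp
    have ind: "(\<lambda>\<omega>. indicator {s} (S N j \<omega>) :: ennreal) = indicator {\<omega>. S N j \<omega> = s}"
      by (auto simp: indicator_def)
    have [measurable]: "(\<lambda>\<omega>. indicator {s} (S N j \<omega>) :: ennreal) \<in> borel_measurable M"
      unfolding ind using S_eq_sets[OF j, of N s] by (subst borel_measurable_indicator_iff) (simp add: Int_def conj_commute)
    have "(\<integral>\<^sup>+\<omega>. f (sample N \<omega>) * indicator {s} (S N j \<omega>) \<partial>M)
        = (\<integral>\<^sup>+w. f w * ennreal (srs N j (units_of N j w) s) \<partial>(\<Pi>\<^sub>M i\<in>{..<N}. Pt))"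
      by (rule nn_integral_sampling[OF N j s f])
    also have "\<dots> = (\<integral>\<^sup>+w. 0 \<partial>(\<Pi>\<^sub>M i\<in>{..<N}. Pt))"
      by (intro nn_integral_cong) (use srs_eq_0[OF j fin] in \<open>auto simp: f_def\<close>)
    also have "\<dots> = 0" by simp
    finally have "AE \<omega> in M. f (sample N \<omega>) * indicator {s} (S N j \<omega>) = 0"
      by (subst (asm) nn_integral_0_iff_AE) auto
    then show "AE \<omega> in M. \<not> (?bad s (sample N \<omega>) \<and> S N j \<omega> = s)"
      by eventually_elim (auto simp: f_def split: if_splits)
  qed simp
  with AE_space show ?thesis
  proof eventually_elim
    case (elim \<omega>)
    then show ?case
      using S_subset[OF j elim(1), of N] by (auto simp: units_eq n_src_def N_src_def)
  qed
qed

section \<open>Sources as events for \<open>W\<close>, and deviations of sums over the drawn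
  units\<close>

definition src_event :: "nat \<Rightarrow> ('x \<times> 'u) set" where
  "src_event j = {w \<in> space Pt. V_of w \<in> src j}"

lemma src_event_sets[measurable]: "j < J \<Longrightarrow> src_event j \<in> sets Pt"
  using measurable_sets[OF V_of_measurable src_measurable[of j]]
  by (simp add: src_event_def vimage_def Int_def conj_commute)

lemma W_space: "\<omega> \<in> space M \<Longrightarrow> W i \<omega> \<in> space Pt"
  using measurable_space[OF W_measurable_Pt] .

lemma sample_space: "\<omega> \<in> space M \<Longrightarrow> sample N \<omega> \<in> space (\<Pi>\<^sub>M i\<in>{..<N}. Pt)"
  using measurable_space[OF sample_measurable] .

lemma AE_W: "(AE w in Pt. Q w) \<Longrightarrow> AE \<omega> in M. \<forall>i. Q (W i \<omega>)"
  unfolding AE_all_countable by (intro allI AE_distrD[OF W_measurable_Pt]) (subst distr_W)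

lemma borel_measurable_units:
  assumes "j < J"
  shows "(\<lambda>\<omega>. (g :: nat set \<Rightarrow> real) (units N j \<omega>)) \<in> borel_measurable M"
  unfolding units_eq by (rule measurable_compose[OF measurable_compose[OF sample_measurable units_of_measurable[OF assms]]]) simp

lemma fraction_outer_tendsto:
  assumes "j < J" "0 < \<epsilon>"
  shows "(\<lambda>N. outer_measure_of M {\<omega> \<in> space M. \<epsilon> < \<bar>real (n_src N j \<omega>) / real (N_src N j \<omega>) - p j\<bar>}) \<longlonglongrightarrow> 0"
  using fraction_tendsto[OF assms(1)] assms(2) by (simp add: converges_in_outer_prob_0_def)

text \<open>A null source would almost surely contain no unit for any \<open>N\<close>, and its
  sampling fraction \<open>0/0 = 0\<close> could not approach
  \<open>p j \<ge> c > 0\<close>.\<close>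

lemma src_event_pos:
  assumes j: "j < J"
  shows "emeasure Pt (src_event j) \<noteq> 0"
proof
  assume "emeasure Pt (src_event j) = 0"
  then have "AE w in Pt. w \<notin> src_event j"
    using src_event_sets[OF j] by (intro AE_not_in) auto
  then have "AE w in Pt. V_of w \<notin> src j"
    using AE_space by eventually_elim (auto simp: src_event_def)
  then have no: "AE \<omega> in M. \<forall>i. V i \<omega> \<notin> src j"
    unfolding V_def by (rule AE_W)
  have pj: "0 < p j / 2" using p_ge[OF j] c_pos by simp
  let ?E = "\<lambda>N. {\<omega> \<in> space M. p j / 2 < \<bar>real (n_src N j \<omega>) / real (N_src N j \<omega>) - p j\<bar>}"
  have "outer_measure_of M (?E N) = 1" for N
  proof -
    have E: "?E N \<in> sets M"
      using borel_measurable_units[OF j, of "\<lambda>U. \<bar>real (size N j (card U)) / real (card U) - p j\<bar>" N]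
      by (simp add: n_src_def N_src_def)
    have "AE \<omega> in M. \<omega> \<in> ?E N"
      using no AE_space
    proof eventually_elim
      case (elim \<omega>)
      then have "N_src N j \<omega> = 0" by (simp add: N_src_def units_def)
      then show ?case using elim pj by simp
    qed
    then have "prob (?E N) = 1" using E by (simp add: prob_eq_1)
    then show ?thesis using E by (simp add: emeasure_eq_measure)
  qed
  then have "(\<lambda>N. 1 :: ennreal) \<longlonglongrightarrow> 0"
    using fraction_outer_tendsto[OF j pj] by simp
  then show False using LIMSEQ_unique[OF tendsto_const] by fastforce
qed

text \<open>For each fixed \<open>s\<close> the units in \<open>s\<close> that lie in source
  \<open>j\<close> are redrawn, with the probability of drawing \<open>s\<close> as the factor
  \<open>b\<close>; \<open>Y\<close> then selects the bound belonging to the set actually drawn. The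
  factor 2 stems from the original and the redrawn majorant, whose integrals weighted by that
  probability agree.\<close>

lemma sampling_majorant:
  fixes D :: "(nat \<Rightarrow> 'x \<times> 'u) \<Rightarrow> ennreal"
  assumes N: "0 < N" and j: "j < J" and D[measurable]: "D \<in> borel_measurable (\<Pi>\<^sub>M i\<in>{..<N}. Pt)"
  shows "\<exists>Y\<in>borel_measurable M. (\<integral>\<^sup>+\<omega>. Y \<omega> \<partial>M) = 2 * (\<integral>\<^sup>+w. D w \<partial>(\<Pi>\<^sub>M i\<in>{..<N}. Pt)) \<and>
    (\<forall>h. integrable Pt h \<longrightarrow>
      (\<forall>w\<in>space (\<Pi>\<^sub>M i\<in>{..<N}. Pt). ennreal \<bar>(\<Sum>i<N. h (w i)) - real N * (\<integral>w. h w \<partial>Pt)\<bar> \<le> D w) \<longrightarrow>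
      (\<forall>\<omega>\<in>space M. ennreal \<bar>\<Sum>i\<in>S N j \<omega>. indicator (src_event j) (W i \<omega>) *
         (h (W i \<omega>) - (\<integral>w. indicator (src_event j) w * h w \<partial>Pt) / measure Pt (src_event j))\<bar> \<le> Y \<omega>))"
proof -
  let ?P = "\<Pi>\<^sub>M i\<in>{..<N}. Pt" and ?A = "src_event j"
  let ?c = "\<lambda>h. (\<integral>w. indicator ?A w * h w \<partial>Pt) / measure Pt ?A"
  define maj where "maj h \<longleftrightarrow> integrable Pt h \<and>
      (\<forall>w\<in>space ?P. ennreal \<bar>(\<Sum>i<N. h (w i)) - real N * (\<integral>w. h w \<partial>Pt)\<bar> \<le> D w)" for h
  define R where "R s \<Phi> \<longleftrightarrow> \<Phi> \<in> borel_measurable ?P \<and>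
      (\<forall>h. maj h \<longrightarrow> (\<forall>w\<in>space ?P. ennreal \<bar>\<Sum>i\<in>s. indicator ?A (w i) * (h (w i) - ?c h)\<bar> \<le> D w + \<Phi> w)) \<and>
      (\<integral>\<^sup>+w. \<Phi> w * ennreal (srs N j (units_of N j w) s) \<partial>?P) = (\<integral>\<^sup>+w. D w * ennreal (srs N j (units_of N j w) s) \<partial>?P)" for s \<Phi>
  have srs[measurable]: "(\<lambda>w. ennreal (srs N j (units_of N j w) s)) \<in> borel_measurable ?P" for s
    using srs_measurable[OF j] by measurable
  have "\<exists>\<Phi>. R s \<Phi>" if s: "s \<in> Pow {..<N}" for s
  proof -
    have s': "s \<subseteq> {..<N}" using s by simp
    show ?thesis
    proof (rule resample_centered[OF prob_space_Pt src_event_sets[OF j] src_event_pos[OF j] finite_lessThan s' D])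
      fix \<Phi> assume 1: "\<Phi> \<in> borel_measurable ?P"
        and 2: "\<And>h w. integrable Pt h \<Longrightarrow>
          (\<And>w. w \<in> space ?P \<Longrightarrow> ennreal \<bar>(\<Sum>i<N. h (w i)) - real (card {..<N}) * (\<integral>x. h x \<partial>Pt)\<bar> \<le> D w) \<Longrightarrow>
          w \<in> space ?P \<Longrightarrow>
          ennreal \<bar>\<Sum>i\<in>s. indicator ?A (w i) * (h (w i) - (\<integral>x. indicator ?A x * h x \<partial>Pt) / measure Pt ?A)\<bar> \<le> D w + \<Phi> w"
        and 3: "\<And>b. b \<in> borel_measurable ?P \<Longrightarrow>
          (\<And>w i t. w \<in> space ?P \<Longrightarrow> i \<in> s \<Longrightarrow> t \<in> ?A \<Longrightarrow> w i \<in> ?A \<Longrightarrow> b (w(i := t)) = b w) \<Longrightarrow>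
          (\<integral>\<^sup>+w. \<Phi> w * b w \<partial>?P) = (\<integral>\<^sup>+w. D w * b w \<partial>?P)"
      have "ennreal \<bar>\<Sum>i\<in>s. indicator ?A (w i) * (h (w i) - ?c h)\<bar> \<le> D w + \<Phi> w"
        if "maj h" "w \<in> space ?P" for h w
        by (rule 2) (use that in \<open>auto simp: maj_def\<close>)
      moreover have "(\<integral>\<^sup>+w. \<Phi> w * ennreal (srs N j (units_of N j w) s) \<partial>?P) = (\<integral>\<^sup>+w. D w * ennreal (srs N j (units_of N j w) s) \<partial>?P)"
      proof (rule 3)
        fix w :: "nat \<Rightarrow> 'x \<times> 'u" and i t assume "t \<in> ?A" "w i \<in> ?A"
        \<comment> \<open>Old and new value both lie in source \<open>j\<close>, hence its set of
          units, its sample size and the probability of \<open>s\<close> stay the same.\<close>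
        then have "units_of N j (w(i := t)) = units_of N j w"
          by (auto simp: units_of_def src_event_def)
        then show "ennreal (srs N j (units_of N j (w(i := t))) s) = ennreal (srs N j (units_of N j w) s)" by simp
      qed measurable
      ultimately have "R s \<Phi>" using 1 by (simp add: R_def)
      then show ?thesis by blast
    qed
  qed
  then obtain \<Phi> where R: "\<And>s. s \<in> Pow {..<N} \<Longrightarrow> R s (\<Phi> s)" by metis
  have \<Phi>[measurable]: "\<Phi> s \<in> borel_measurable ?P"
    and \<Phi>_int: "(\<integral>\<^sup>+w. \<Phi> s w * ennreal (srs N j (units_of N j w) s) \<partial>?P) = (\<integral>\<^sup>+w. D w * ennreal (srs N j (units_of N j w) s) \<partial>?P)"
    if "s \<in> Pow {..<N}" for s
    using R[OF that] by (simp_all add: R_def)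
  have \<Phi>_maj: "ennreal \<bar>\<Sum>i\<in>s. indicator ?A (w i) * (h (w i) - ?c h)\<bar> \<le> D w + \<Phi> s w"
    if "s \<in> Pow {..<N}" "maj h" "w \<in> space ?P" for s h w
    using R[OF that(1)] that by (simp add: R_def)
  define Y where "Y \<omega> = (\<Sum>s\<in>Pow {..<N}. (D (sample N \<omega>) + \<Phi> s (sample N \<omega>)) * indicator {s} (S N j \<omega>))" for \<omega>
  have ind[measurable]: "(\<lambda>\<omega>. indicator {s} (S N j \<omega>) :: ennreal) \<in> borel_measurable M" for s
  proof -
    have "(\<lambda>\<omega>. indicator {s} (S N j \<omega>) :: ennreal) = indicator {\<omega>. S N j \<omega> = s}"
      by (auto simp: indicator_def)
    then show ?thesis
      using S_eq_sets[OF j, of N s] by (simp add: borel_measurable_indicator_iff Int_def conj_commute)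
  qed
  have D\<Phi>[measurable]: "(\<lambda>w. D w + \<Phi> s w) \<in> borel_measurable ?P" if "s \<in> Pow {..<N}" for s
    using \<Phi>[OF that] by measurable
  have summand[measurable]: "(\<lambda>\<omega>. (D (sample N \<omega>) + \<Phi> s (sample N \<omega>)) * indicator {s} (S N j \<omega>)) \<in> borel_measurable M"
    if "s \<in> Pow {..<N}" for s
    using measurable_compose[OF sample_measurable D\<Phi>[OF that]] by measurable
  show ?thesis
  proof (intro bexI[of _ Y] conjI allI impI ballI)
    show "Y \<in> borel_measurable M"
      unfolding Y_def by (intro borel_measurable_sum summand)
  next
    have "(\<integral>\<^sup>+\<omega>. Y \<omega> \<partial>M) = (\<Sum>s\<in>Pow {..<N}. \<integral>\<^sup>+\<omega>. (D (sample N \<omega>) + \<Phi> s (sample N \<omega>)) * indicator {s} (S N j \<omega>) \<partial>M)"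
      unfolding Y_def by (intro nn_integral_sum summand)
    also have "\<dots> = (\<Sum>s\<in>Pow {..<N}. 2 * (\<integral>\<^sup>+w. D w * ennreal (srs N j (units_of N j w) s) \<partial>?P))"
    proof (rule sum.cong[OF refl])
      fix s assume s: "s \<in> Pow {..<N}"
      then have "s \<subseteq> {..<N}" by simp
      have "(\<integral>\<^sup>+\<omega>. (D (sample N \<omega>) + \<Phi> s (sample N \<omega>)) * indicator {s} (S N j \<omega>) \<partial>M)
          = (\<integral>\<^sup>+w. (D w + \<Phi> s w) * ennreal (srs N j (units_of N j w) s) \<partial>?P)"
        by (rule nn_integral_sampling[OF N j \<open>s \<subseteq> {..<N}\<close> D\<Phi>[OF s]])
      also have "\<dots> = (\<integral>\<^sup>+w. D w * ennreal (srs N j (units_of N j w) s) \<partial>?P) + (\<integral>\<^sup>+w. \<Phi> s w * ennreal (srs N j (units_of N j w) s) \<partial>?P)"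
        unfolding distrib_right by (intro nn_integral_add borel_measurable_times_ennreal D \<Phi>[OF s] srs)
      finally show "(\<integral>\<^sup>+\<omega>. (D (sample N \<omega>) + \<Phi> s (sample N \<omega>)) * indicator {s} (S N j \<omega>) \<partial>M)
          = 2 * (\<integral>\<^sup>+w. D w * ennreal (srs N j (units_of N j w) s) \<partial>?P)"
        by (simp add: \<Phi>_int[OF s] mult_2)
    qed
    also have "\<dots> = 2 * (\<integral>\<^sup>+w. (\<Sum>s\<in>Pow {..<N}. D w * ennreal (srs N j (units_of N j w) s)) \<partial>?P)"
      by (subst nn_integral_sum) (auto simp: sum_distrib_left)
    also have "(\<integral>\<^sup>+w. (\<Sum>s\<in>Pow {..<N}. D w * ennreal (srs N j (units_of N j w) s)) \<partial>?P) = (\<integral>\<^sup>+w. D w \<partial>?P)"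
    proof (rule nn_integral_cong)
      fix w
      have "units_of N j w \<subseteq> {..<N}" by (auto simp: units_of_def)
      from sum_srs[OF j this] show "(\<Sum>s\<in>Pow {..<N}. D w * ennreal (srs N j (units_of N j w) s)) = D w"
        by (simp add: sum_distrib_left[symmetric] sum_ennreal)
    qed
    finally show "(\<integral>\<^sup>+\<omega>. Y \<omega> \<partial>M) = 2 * (\<integral>\<^sup>+w. D w \<partial>?P)" .
  next
    fix h \<omega>
    assume "integrable Pt h" "\<forall>w\<in>space ?P. ennreal \<bar>(\<Sum>i<N. h (w i)) - real N * (\<integral>w. h w \<partial>Pt)\<bar> \<le> D w"
      and \<omega>: "\<omega> \<in> space M"
    then have h: "maj h" by (simp add: maj_def)
    have s: "S N j \<omega> \<in> Pow {..<N}" using S_subset[OF j \<omega>] by simp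
    have "(\<Sum>i\<in>S N j \<omega>. indicator ?A (W i \<omega>) * (h (W i \<omega>) - ?c h))
        = (\<Sum>i\<in>S N j \<omega>. indicator ?A (sample N \<omega> i) * (h (sample N \<omega> i) - ?c h))"
      by (intro sum.cong) (use s in \<open>auto simp: sample_def\<close>)
    then have "ennreal \<bar>\<Sum>i\<in>S N j \<omega>. indicator ?A (W i \<omega>) * (h (W i \<omega>) - ?c h)\<bar> \<le> D (sample N \<omega>) + \<Phi> (S N j \<omega>) (sample N \<omega>)"
      using \<Phi>_maj[OF s h sample_space[OF \<omega>]] by simp
    also have "\<dots> = (D (sample N \<omega>) + \<Phi> (S N j \<omega>) (sample N \<omega>)) * indicator {S N j \<omega>} (S N j \<omega>)"
      by simp
    also have "\<dots> \<le> Y \<omega>"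
      unfolding Y_def by (rule member_le_sum[OF s]) auto
    finally show "ennreal \<bar>\<Sum>i\<in>S N j \<omega>. indicator ?A (W i \<omega>) * (h (W i \<omega>) - ?c h)\<bar> \<le> Y \<omega>" .
  qed
qed

section \<open>Weights as combinations of region indicators\<close>

text \<open>The weight \<open>\<rho> j\<close> as a function of \<open>W\<close>, set to \<open>0\<close> on the null event that no source contains \<open>V\<close>.\<close>
definition weight :: "nat \<Rightarrow> 'x \<times> 'u \<Rightarrow> real" where
  "weight j w = (if V_of w \<in> (\<Union>k<J. src k) then \<rho> j (V_of w) else 0)"

lemma rho_props:
  assumes "v \<in> (\<Union>k<J. src k)"
  shows "\<forall>j<J. 0 \<le> \<rho> j v \<and> \<rho> j v \<le> 1" "\<forall>j<J. v \<notin> src j \<longrightarrow> \<rho> j v = 0" "(\<Sum>j<J. \<rho> j v) = 1"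
  using bspec[OF conjunct1[OF weights[unfolded weight_function_def]] assms] by blast+

lemma weight_bounds:
  assumes "j < J" shows "0 \<le> weight j w" "weight j w \<le> 1"
  unfolding weight_def using rho_props(1)[of "V_of w"] assms
  by (cases "V_of w \<in> (\<Union>k<J. src k)"; simp only: if_True if_False zero_le_one order_refl)+

lemma weight_eq_0: "j < J \<Longrightarrow> V_of w \<notin> src j \<Longrightarrow> weight j w = 0"
  unfolding weight_def using rho_props(2)[of "V_of w"] by (auto simp del: UN_iff)

lemma sum_weight: "V_of w \<in> (\<Union>k<J. src k) \<Longrightarrow> (\<Sum>j<J. weight j w) = 1"
  unfolding weight_def using rho_props(3)[of "V_of w"] by (simp only: if_True)

text \<open>An atom of the partition generated by the sources.\<close>

definition region :: "nat set \<Rightarrow> ('x \<times> 'u) set" where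
  "region r = {w \<in> space Pt. \<forall>j\<in>{..<J}. j \<in> r \<longleftrightarrow> w \<in> src_event j}"

lemma region_sets: "region r \<in> sets Pt"
  unfolding region_def
proof (rule sets.sets_Collect_finite_All)
  fix j assume "j \<in> {..<J}"
  then have "src_event j \<in> sets Pt" by (simp add: src_event_sets)
  moreover have "{w \<in> space Pt. w \<in> src_event j} = src_event j"
    by (auto simp: src_event_def)
  ultimately have "{w \<in> space Pt. w \<in> src_event j} \<in> sets Pt" by simp
  from this sets.sets_Collect_neg[OF this]
  show "{w \<in> space Pt. j \<in> r \<longleftrightarrow> w \<in> src_event j} \<in> sets Pt"
    by (cases "j \<in> r") auto
qed simp

lemma weight_region:
  "\<exists>a. \<forall>w\<in>space Pt. weight j w = (\<Sum>r\<in>Pow {..<J}. a r * indicator (region r) w)" if j: "j < J"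
proof -
  define label where "label w = {k\<in>{..<J}. V_of w \<in> src k}" for w
  have const: "weight j w = weight j w'" if "label w = label w'" for w w'
  proof -
    have eq: "\<forall>k<J. V_of w \<in> src k \<longleftrightarrow> V_of w' \<in> src k"
      using that by (auto simp: label_def set_eq_iff)
    show ?thesis
    proof (cases "V_of w \<in> (\<Union>k<J. src k)")
      case True
      then have "V_of w' \<in> (\<Union>k<J. src k)" using eq by auto
      moreover have "\<forall>v\<in>(\<Union>k<J. src k). \<forall>v'\<in>(\<Union>k<J. src k).
          (\<forall>k<J. v \<in> src k \<longleftrightarrow> v' \<in> src k) \<longrightarrow> (\<forall>k<J. \<rho> k v = \<rho> k v')"
        using weights unfolding weight_function_def by (rule conjunct2)
      ultimately have "\<rho> j (V_of w) = \<rho> j (V_of w')" using True eq j by blast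
      with True \<open>V_of w' \<in> (\<Union>k<J. src k)\<close> show ?thesis unfolding weight_def by simp
    next
      case False
      then have "V_of w' \<notin> (\<Union>k<J. src k)" using eq by auto
      with False show ?thesis unfolding weight_def by simp
    qed
  qed
  \<comment> \<open>By \<open>const\<close>, any representative of the region gives the same
    value.\<close>
  define a where "a r = weight j (SOME w. label w = r)" for r
  have "weight j w = (\<Sum>r\<in>Pow {..<J}. a r * indicator (region r) w)" if w: "w \<in> space Pt" for w
  proof -
    have "a (label w) = weight j w"
      unfolding a_def by (rule const, rule someI_ex) blast
    moreover have "(\<Sum>r\<in>Pow {..<J}. a r * indicator (region r) w) = (\<Sum>r\<in>Pow {..<J}. if r = label w then a r else 0)"
      by (intro sum.cong) (use w in \<open>auto simp: region_def label_def src_event_def indicator_def\<close>)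
    moreover have "label w \<in> Pow {..<J}" by (auto simp: label_def)
    ultimately show ?thesis by (simp only: sum.delta finite_Pow_iff finite_lessThan if_True)
  qed
  then show ?thesis by blast
qed

text \<open>By \<open>weight_region\<close>, multiplication by a weight is a finite combination of
  restrictions to regions, and the common bound on first absolute moments bounds the integrals over
  all regions.\<close>

lemma mean_gc_weight:
  assumes j: "j < J" and h: "mean_gc Pt I h" and C: "\<And>i. i \<in> I \<Longrightarrow> (\<integral>w. \<bar>h i w\<bar> \<partial>Pt) \<le> C"
  shows "mean_gc Pt I (\<lambda>i w. weight j w * h i w)"
proof -
  from weight_region[OF j] obtain a where a: "\<forall>w\<in>space Pt. weight j w = (\<Sum>r\<in>Pow {..<J}. a r * indicator (region r) w)" ..
  have "mean_gc Pt I (\<lambda>i w. \<Sum>r\<in>Pow {..<J}. a r * (indicator (region r) w * h i w))"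
  proof (intro mean_gc_sum mean_gc_mult[where C = "\<bar>a _\<bar>"])
    fix r
    have "\<bar>\<integral>w. indicator (region r) w * h i w \<partial>Pt\<bar> \<le> C" if i: "i \<in> I" for i
    proof -
      have hi: "integrable Pt (h i)" using mean_gc_integrable[OF h i] .
      have "\<bar>\<integral>w. indicator (region r) w * h i w \<partial>Pt\<bar> \<le> (\<integral>w. \<bar>indicator (region r) w * h i w\<bar> \<partial>Pt)"
        by (rule integral_abs_bound)
      also have "\<dots> \<le> (\<integral>w. \<bar>h i w\<bar> \<partial>Pt)"
        using integrable_mult_indicator[OF region_sets hi] hi
        by (intro integral_mono) (auto split: split_indicator)
      finally show ?thesis using C[OF i] by simp
    qed
    then show "mean_gc Pt I (\<lambda>i w. indicator (region r) w * h i w)"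
      by (rule mean_gc_indicator[OF prob_space_Pt region_sets h])
  qed auto
  then show ?thesis
    by (rule mean_gc_cong) (simp only: bspec[OF a] sum_distrib_right mult.assoc)
qed

section \<open>Uniform convergence of the H-empirical measure\<close>

lemma mean_gc_sample:
  assumes h: "mean_gc Pt I h"
  shows "\<exists>Z. (\<forall>N. Z N \<in> borel_measurable M) \<and> (\<lambda>N. (\<integral>\<^sup>+\<omega>. Z N \<omega> \<partial>M) / of_nat N) \<longlonglongrightarrow> 0 \<and>
    (\<forall>N. \<forall>\<omega>\<in>space M. \<forall>i\<in>I. ennreal \<bar>(\<Sum>k<N. h i (W k \<omega>)) - real N * (\<integral>w. h i w \<partial>Pt)\<bar> \<le> Z N \<omega>)"
proof -
  obtain D where D[measurable]: "\<And>N. D N \<in> borel_measurable (\<Pi>\<^sub>M k\<in>{..<N}. Pt)"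
    and le: "\<And>N w i. w \<in> space (\<Pi>\<^sub>M k\<in>{..<N}. Pt) \<Longrightarrow> i \<in> I \<Longrightarrow>
          ennreal \<bar>(\<Sum>k<N. h i (w k)) - real N * (\<integral>x. h i x \<partial>Pt)\<bar> \<le> D N w"
    and lim: "(\<lambda>N. (\<integral>\<^sup>+w. D N w \<partial>(\<Pi>\<^sub>M k\<in>{..<N}. Pt)) / of_nat N) \<longlonglongrightarrow> 0"
    using mean_gcE[OF h] by blast
  have "(\<lambda>N. (\<integral>\<^sup>+\<omega>. D N (sample N \<omega>) \<partial>M) / of_nat N) \<longlonglongrightarrow> 0"
    by (rule Lim_transform_eventually[OF lim])
       (auto intro!: eventually_sequentiallyI[of 1] simp: nn_integral_sample[OF _ D])
  moreover have "ennreal \<bar>(\<Sum>k<N. h i (W k \<omega>)) - real N * (\<integral>w. h i w \<partial>Pt)\<bar> \<le> D N (sample N \<omega>)"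
    if "\<omega> \<in> space M" "i \<in> I" for N \<omega> i
    using le[OF sample_space[OF that(1)] that(2), of N] by (simp add: sample_def)
  moreover have "(\<lambda>\<omega>. D N (sample N \<omega>)) \<in> borel_measurable M" for N
    by (rule measurable_compose[OF sample_measurable D])
  ultimately show ?thesis by (intro exI[of _ "\<lambda>N \<omega>. D N (sample N \<omega>)"]) blast
qed

lemma mean_gc_source_sample:
  assumes j: "j < J" and h: "mean_gc Pt I h"
  shows "\<exists>Y. (\<forall>N. Y N \<in> borel_measurable M) \<and> (\<lambda>N. (\<integral>\<^sup>+\<omega>. Y N \<omega> \<partial>M) / of_nat N) \<longlonglongrightarrow> 0 \<and>
    (\<forall>N>0. \<forall>\<omega>\<in>space M. \<forall>i\<in>I. ennreal \<bar>\<Sum>k\<in>S N j \<omega>. indicator (src_event j) (W k \<omega>) *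
         (h i (W k \<omega>) - (\<integral>w. indicator (src_event j) w * h i w \<partial>Pt) / measure Pt (src_event j))\<bar> \<le> Y N \<omega>)"
proof -
  obtain D where D[measurable]: "\<And>N. D N \<in> borel_measurable (\<Pi>\<^sub>M k\<in>{..<N}. Pt)"
    and le: "\<And>N w i. w \<in> space (\<Pi>\<^sub>M k\<in>{..<N}. Pt) \<Longrightarrow> i \<in> I \<Longrightarrow>
          ennreal \<bar>(\<Sum>k<N. h i (w k)) - real N * (\<integral>x. h i x \<partial>Pt)\<bar> \<le> D N w"
    and lim: "(\<lambda>N. (\<integral>\<^sup>+w. D N w \<partial>(\<Pi>\<^sub>M k\<in>{..<N}. Pt)) / of_nat N) \<longlonglongrightarrow> 0"
    using mean_gcE[OF h] by blast
  define R where "R N Y \<longleftrightarrow> Y \<in> borel_measurable M \<and>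
      (0 < N \<longrightarrow> (\<integral>\<^sup>+\<omega>. Y \<omega> \<partial>M) = 2 * (\<integral>\<^sup>+w. D N w \<partial>(\<Pi>\<^sub>M k\<in>{..<N}. Pt)) \<and>
        (\<forall>\<omega>\<in>space M. \<forall>i\<in>I. ennreal \<bar>\<Sum>k\<in>S N j \<omega>. indicator (src_event j) (W k \<omega>) *
         (h i (W k \<omega>) - (\<integral>w. indicator (src_event j) w * h i w \<partial>Pt) / measure Pt (src_event j))\<bar> \<le> Y \<omega>))" for N Y
  have "\<exists>Y. R N Y" for N
  proof (cases "0 < N")
    case True
    from sampling_majorant[OF True j D[of N]] obtain Y where Y: "Y \<in> borel_measurable M"
      and Y_int: "(\<integral>\<^sup>+\<omega>. Y \<omega> \<partial>M) = 2 * (\<integral>\<^sup>+w. D N w \<partial>(\<Pi>\<^sub>M k\<in>{..<N}. Pt))"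
      and Y_le: "\<forall>h. integrable Pt h \<longrightarrow>
        (\<forall>w\<in>space (\<Pi>\<^sub>M i\<in>{..<N}. Pt). ennreal \<bar>(\<Sum>i<N. h (w i)) - real N * (\<integral>w. h w \<partial>Pt)\<bar> \<le> D N w) \<longrightarrow>
        (\<forall>\<omega>\<in>space M. ennreal \<bar>\<Sum>i\<in>S N j \<omega>. indicator (src_event j) (W i \<omega>) *
         (h (W i \<omega>) - (\<integral>w. indicator (src_event j) w * h w \<partial>Pt) / measure Pt (src_event j))\<bar> \<le> Y \<omega>)"
      by blast
    have "ennreal \<bar>\<Sum>k\<in>S N j \<omega>. indicator (src_event j) (W k \<omega>) *
         (h i (W k \<omega>) - (\<integral>w. indicator (src_event j) w * h i w \<partial>Pt) / measure Pt (src_event j))\<bar> \<le> Y \<omega>"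
      if "\<omega> \<in> space M" "i \<in> I" for \<omega> i
      using Y_le[rule_format, of "h i", OF mean_gc_integrable[OF h that(2)] le that(1)] that(2) by blast
    then have "R N Y" using Y Y_int by (simp add: R_def)
    then show ?thesis by blast
  next
    case False
    then have "R N (\<lambda>_. 0)" by (simp add: R_def)
    then show ?thesis by blast
  qed
  then obtain Y where R: "\<And>N. R N (Y N)" by metis
  have "(\<lambda>N. (\<integral>\<^sup>+\<omega>. Y N \<omega> \<partial>M) / of_nat N) \<longlonglongrightarrow> 0"
  proof (rule Lim_transform_eventually)
    show "(\<lambda>N. 2 * ((\<integral>\<^sup>+w. D N w \<partial>(\<Pi>\<^sub>M k\<in>{..<N}. Pt)) / of_nat N)) \<longlonglongrightarrow> 0"
      using ennreal_tendsto_cmult[OF _ lim, of 2] by simp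
    have "2 * ((\<integral>\<^sup>+w. D N w \<partial>(\<Pi>\<^sub>M k\<in>{..<N}. Pt)) / of_nat N) = (\<integral>\<^sup>+\<omega>. Y N \<omega> \<partial>M) / of_nat N" if "0 < N" for N
      using R[of N] that by (simp add: R_def ennreal_times_divide)
    then show "\<forall>\<^sub>F N in sequentially. 2 * ((\<integral>\<^sup>+w. D N w \<partial>(\<Pi>\<^sub>M k\<in>{..<N}. Pt)) / of_nat N) = (\<integral>\<^sup>+\<omega>. Y N \<omega> \<partial>M) / of_nat N"
      by (intro eventually_sequentiallyI[of 1]) simp
  qed
  then show ?thesis using R by (intro exI[of _ Y]) (simp add: R_def)
qed

text \<open>Let \<open>r\<close> be the sampling fraction, \<open>n'\<close> the number of units in
  the source and \<open>q\<close> its probability. Before division by \<open>N\<close>, the source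
  term is the centered sampled sum \<open>T\<close> divided by \<open>r\<close>, plus
  \<open>n'\<close> times the conditional mean \<open>\<mu> / q\<close>. The first part costs a
  factor \<open>2 / c\<close>, the second only the error of \<open>n' / N\<close> as an estimate of
  \<open>q\<close>, times \<open>C / q\<close>.\<close>

lemma source_term_error:
  fixes f :: "'x \<Rightarrow> real" and \<delta> C :: real
  assumes N: "0 < N" and j: "j < J" and \<omega>: "\<omega> \<in> space M"
    and S: "S N j \<omega> \<subseteq> units N j \<omega>" "card (S N j \<omega>) = n_src N j \<omega>"
    and V: "\<And>i. V i \<omega> \<in> (\<Union>k<J. src k)"
    and frac: "\<bar>real (n_src N j \<omega>) / real (N_src N j \<omega>) - p j\<bar> \<le> c / 2"
    and mean: "\<mu> = (\<integral>w. weight j w * f (fst w) \<partial>Pt)" "\<bar>\<mu>\<bar> \<le> C"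
    and dev_S: "\<bar>\<Sum>k\<in>S N j \<omega>. indicator (src_event j) (W k \<omega>) * (weight j (W k \<omega>) * f (fst (W k \<omega>)) - \<mu> / measure Pt (src_event j))\<bar> \<le> \<delta> * real N"
    and dev_N: "\<bar>(\<Sum>k<N. indicator (src_event j) (W k \<omega>)) - real N * measure Pt (src_event j)\<bar> \<le> \<delta> * real N"
  shows "\<bar>(\<Sum>k<N. R N j k \<omega> * \<rho> j (V k \<omega>) / sel_prob N j \<omega> (V k \<omega>) * f (X k \<omega>)) / real N - \<mu>\<bar>
    \<le> (2 / c + C / measure Pt (src_event j)) * \<delta>"
proof -
  interpret Q: prob_space Pt by (rule prob_space_Pt)
  define q where "q = measure Pt (src_event j)"
  define r where "r = real (n_src N j \<omega>) / real (N_src N j \<omega>)"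
  define n' where "n' = real (N_src N j \<omega>)"
  have q: "0 < q" using src_event_pos[OF j] by (simp add: q_def Q.emeasure_eq_measure zero_less_measure_iff)
  \<comment> \<open>The allowed deviation is half of the lower bound \<open>c\<close> of
    \<open>p j\<close>, so \<open>1 / r\<close> stays below \<open>2 / c\<close>.\<close>
  have "c / 2 \<le> r" using frac p_ge[OF j] unfolding r_def by linarith
  with c_pos have r: "0 < r" "1 / r \<le> 2 / c" by (auto simp: field_simps)
  \<comment> \<open>A positive fraction excludes an empty source, so the division in
    \<open>r\<close> can be undone.\<close>
  have nr: "real (n_src N j \<omega>) = r * n'" using r by (auto simp: r_def n'_def)
  have \<delta>: "0 \<le> \<delta>"
    using order_trans[OF abs_ge_zero dev_N] N by (simp add: zero_le_mult_iff)
  have SN: "S N j \<omega> \<subseteq> {..<N}" using S_subset[OF j \<omega>] .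
  have in_src: "V k \<omega> \<in> src j" "W k \<omega> \<in> src_event j" if "k \<in> units N j \<omega>" for k
    using that W_space[OF \<omega>] by (auto simp: units_def src_event_def V_def)
  have units_N: "(\<Sum>k<N. indicator (src_event j) (W k \<omega>)) = n'"
  proof -
    have "(\<Sum>k<N. indicator (src_event j) (W k \<omega>) :: real) = (\<Sum>k\<in>units N j \<omega>. 1)"
      by (rule sum.mono_neutral_cong_right)
         (use W_space[OF \<omega>] in \<open>auto simp: units_def src_event_def V_def\<close>)
    then show ?thesis by (simp add: n'_def N_src_def)
  qed
  define T where "T = (\<Sum>k\<in>S N j \<omega>. indicator (src_event j) (W k \<omega>) * (weight j (W k \<omega>) * f (fst (W k \<omega>)) - \<mu> / q))"
  have T: "T = (\<Sum>k\<in>S N j \<omega>. weight j (W k \<omega>) * f (fst (W k \<omega>))) - real (n_src N j \<omega>) * (\<mu> / q)"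
  proof -
    have "T = (\<Sum>k\<in>S N j \<omega>. weight j (W k \<omega>) * f (fst (W k \<omega>)) - \<mu> / q)"
      unfolding T_def by (intro sum.cong refl) (use in_src S(1) in auto)
    then show ?thesis by (simp add: sum_subtractf S(2))
  qed
  have "(\<Sum>k<N. R N j k \<omega> * \<rho> j (V k \<omega>) / sel_prob N j \<omega> (V k \<omega>) * f (X k \<omega>))
      = (\<Sum>k\<in>S N j \<omega>. weight j (W k \<omega>) * f (fst (W k \<omega>)) / r)"
  proof (rule sum.mono_neutral_cong_right)
    fix k assume "k \<in> S N j \<omega>"
    then have "V k \<omega> \<in> src j" using in_src(1) S(1) by blast
    then show "R N j k \<omega> * \<rho> j (V k \<omega>) / sel_prob N j \<omega> (V k \<omega>) * f (X k \<omega>) = weight j (W k \<omega>) * f (fst (W k \<omega>)) / r"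
      using \<open>k \<in> S N j \<omega>\<close> V[of k] by (simp add: R_def sel_prob_def r_def weight_def X_def V_def del: UN_iff)
  qed (use SN in \<open>auto simp: R_def\<close>)
  also have "\<dots> = (T + real (n_src N j \<omega>) * (\<mu> / q)) / r"
    by (simp add: T sum_divide_distrib)
  also have "\<dots> = T / r + n' * (\<mu> / q)"
    unfolding nr using r by (simp add: add_divide_distrib)
  finally have "(\<Sum>k<N. R N j k \<omega> * \<rho> j (V k \<omega>) / sel_prob N j \<omega> (V k \<omega>) * f (X k \<omega>)) / real N - \<mu>
      = (T / real N) * (1 / r) + (\<mu> / q) * ((n' - real N * q) / real N)"
    using N q r by (simp add: field_simps)
  also have "\<bar>\<dots>\<bar> \<le> \<bar>(T / real N) * (1 / r)\<bar> + \<bar>(\<mu> / q) * ((n' - real N * q) / real N)\<bar>"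
    by (rule abs_triangle_ineq)
  also have "\<dots> \<le> \<delta> * (2 / c) + (C / q) * \<delta>"
  proof (intro add_mono)
    have "\<bar>T\<bar> \<le> \<delta> * real N" using dev_S by (simp add: T_def q_def)
    then have "\<bar>T / real N\<bar> \<le> \<delta>" using N by (simp add: abs_divide field_simps)
    then show "\<bar>(T / real N) * (1 / r)\<bar> \<le> \<delta> * (2 / c)"
      unfolding abs_mult using r \<delta> by (intro mult_mono) auto
    have "\<bar>n' - real N * q\<bar> \<le> \<delta> * real N" using dev_N by (simp add: units_N q_def)
    then have "\<bar>(n' - real N * q) / real N\<bar> \<le> \<delta>" using N by (simp add: abs_divide field_simps)
    moreover have "\<bar>\<mu> / q\<bar> \<le> C / q" using mean(2) q by (simp add: abs_divide divide_right_mono)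
    ultimately show "\<bar>(\<mu> / q) * ((n' - real N * q) / real N)\<bar> \<le> (C / q) * \<delta>"
      unfolding abs_mult by (intro mult_mono) (use q mean(2) in auto)
  qed
  finally show ?thesis by (simp add: q_def algebra_simps)
qed

text \<open>Source by source, the terms converge to the integrals \<open>\<mu> j i\<close> of the
  weighted functions, which add up to the integral of \<open>f i\<close> because the weights sum to
  1 almost surely. The exceptional sets come from majorants, sampling fractions and null events, so
  they do not depend on \<open>i\<close> and the convergence is uniform.\<close>

lemma H_empirical_glivenko_cantelli:
  assumes f: "mean_gc Pt I (\<lambda>i w. f i (fst w))"
    and C: "\<And>i. i \<in> I \<Longrightarrow> (\<integral>w. \<bar>f i (fst w)\<bar> \<partial>Pt) \<le> C" and \<epsilon>: "0 < \<epsilon>"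
  shows "(\<lambda>N. outer_measure_of M {\<omega> \<in> space M. \<exists>i\<in>I.
      \<epsilon> < \<bar>H_empirical J \<rho> N \<omega> (f i) - (\<integral>w. f i (fst w) \<partial>Pt)\<bar>}) \<longlonglongrightarrow> 0"
proof -
  interpret Q: prob_space Pt by (rule prob_space_Pt)
  define h where "h j i w = weight j w * f i (fst w)" for j i w
  define \<mu> where "\<mu> j i = (\<integral>w. h j i w \<partial>Pt)" for j i
  define q where "q j = measure Pt (src_event j)" for j
  have q: "0 < q j" if "j < J" for j
    using src_event_pos[OF that] by (simp add: q_def Q.emeasure_eq_measure zero_less_measure_iff)
  have fi: "integrable Pt (\<lambda>w. f i (fst w))" if "i \<in> I" for i
    using mean_gc_integrable[OF f that] .
  have h: "mean_gc Pt I (h j)" if "j < J" for j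
    unfolding h_def[abs_def] by (rule mean_gc_weight[OF that f C])
  have hi: "integrable Pt (h j i)" if "j < J" "i \<in> I" for j i
    using mean_gc_integrable[OF h[OF that(1)] that(2)] .
  \<comment> \<open>The weight vanishes outside source \<open>j\<close>, so restricting to the
    source loses nothing.\<close>
  have ind_h: "(\<integral>w. indicator (src_event j) w * h j i w \<partial>Pt) = \<mu> j i" if "j < J" for j i
    unfolding \<mu>_def
    by (rule Bochner_Integration.integral_cong[OF refl])
       (auto simp: h_def src_event_def weight_eq_0[OF that] split: split_indicator)
  have \<mu>_le: "\<bar>\<mu> j i\<bar> \<le> \<bar>C\<bar>" if "j < J" "i \<in> I" for j i
  proof -
    have "\<bar>\<mu> j i\<bar> \<le> (\<integral>w. \<bar>h j i w\<bar> \<partial>Pt)" unfolding \<mu>_def by (rule integral_abs_bound)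
    also have "\<dots> \<le> (\<integral>w. \<bar>f i (fst w)\<bar> \<partial>Pt)"
    proof (rule integral_mono)
      show "integrable Pt (\<lambda>w. \<bar>h j i w\<bar>)" "integrable Pt (\<lambda>w. \<bar>f i (fst w)\<bar>)"
        using hi[OF that] fi[OF that(2)] by auto
      show "\<bar>h j i w\<bar> \<le> \<bar>f i (fst w)\<bar>" for w
        using weight_bounds[OF that(1), of w] by (simp add: h_def abs_mult mult_left_le_one_le)
    qed
    finally show ?thesis using C[OF that(2)] by linarith
  qed
  have sum_\<mu>: "(\<Sum>j<J. \<mu> j i) = (\<integral>w. f i (fst w) \<partial>Pt)" if "i \<in> I" for i
  proof -
    have "(\<Sum>j<J. \<mu> j i) = (\<integral>w. (\<Sum>j<J. h j i w) \<partial>Pt)"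
      unfolding \<mu>_def by (rule Bochner_Integration.integral_sum[symmetric]) (use hi that in auto)
    also have "\<dots> = (\<integral>w. f i (fst w) \<partial>Pt)"
    proof (rule integral_cong_AE)
      show "(\<lambda>w. \<Sum>j<J. h j i w) \<in> borel_measurable Pt"
        using hi that by (intro borel_measurable_sum borel_measurable_integrable) auto
      show "(\<lambda>w. f i (fst w)) \<in> borel_measurable Pt"
        using fi[OF that] by auto
      show "AE w in Pt. (\<Sum>j<J. h j i w) = f i (fst w)"
        using V_in_union
      proof eventually_elim
        case (elim w)
        have "(\<Sum>j<J. h j i w) = (\<Sum>j<J. weight j w) * f i (fst w)"
          unfolding h_def by (rule sum_distrib_right[symmetric])
        then show ?case using sum_weight[OF elim] by simp
      qed
    qed
    finally show ?thesis .
  qed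
  have "\<forall>j\<in>{..<J}. \<exists>Y. (\<forall>N. Y N \<in> borel_measurable M) \<and> (\<lambda>N. (\<integral>\<^sup>+\<omega>. Y N \<omega> \<partial>M) / of_nat N) \<longlonglongrightarrow> 0 \<and>
    (\<forall>N>0. \<forall>\<omega>\<in>space M. \<forall>i\<in>I. ennreal \<bar>\<Sum>k\<in>S N j \<omega>. indicator (src_event j) (W k \<omega>) *
         (h j i (W k \<omega>) - \<mu> j i / q j)\<bar> \<le> Y N \<omega>)"
  proof
    fix j assume "j \<in> {..<J}"
    then have j: "j < J" by simp
    from mean_gc_source_sample[OF j h[OF j]]
    show "\<exists>Y. (\<forall>N. Y N \<in> borel_measurable M) \<and> (\<lambda>N. (\<integral>\<^sup>+\<omega>. Y N \<omega> \<partial>M) / of_nat N) \<longlonglongrightarrow> 0 \<and>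
      (\<forall>N>0. \<forall>\<omega>\<in>space M. \<forall>i\<in>I. ennreal \<bar>\<Sum>k\<in>S N j \<omega>. indicator (src_event j) (W k \<omega>) *
         (h j i (W k \<omega>) - \<mu> j i / q j)\<bar> \<le> Y N \<omega>)"
      by (simp only: ind_h[OF j] q_def)
  qed
  from bchoice[OF this] obtain Y where Y_all: "\<forall>j\<in>{..<J}. (\<forall>N. Y j N \<in> borel_measurable M) \<and>
    (\<lambda>N. (\<integral>\<^sup>+\<omega>. Y j N \<omega> \<partial>M) / of_nat N) \<longlonglongrightarrow> 0 \<and>
    (\<forall>N>0. \<forall>\<omega>\<in>space M. \<forall>i\<in>I. ennreal \<bar>\<Sum>k\<in>S N j \<omega>. indicator (src_event j) (W k \<omega>) *
         (h j i (W k \<omega>) - \<mu> j i / q j)\<bar> \<le> Y j N \<omega>)" ..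
  have Y: "Y j N \<in> borel_measurable M" and Y_lim: "(\<lambda>N. (\<integral>\<^sup>+\<omega>. Y j N \<omega> \<partial>M) / of_nat N) \<longlonglongrightarrow> 0"
    if "j < J" for j N
    using bspec[OF Y_all, of j] that by simp_all
  have Y_le: "ennreal \<bar>\<Sum>k\<in>S N j \<omega>. indicator (src_event j) (W k \<omega>) * (h j i (W k \<omega>) - \<mu> j i / q j)\<bar> \<le> Y j N \<omega>"
    if "j < J" "0 < N" "\<omega> \<in> space M" "i \<in> I" for j N \<omega> i
    using bspec[OF Y_all, of j] that by simp
  have "\<forall>j\<in>{..<J}. \<exists>Z. (\<forall>N. Z N \<in> borel_measurable M) \<and> (\<lambda>N. (\<integral>\<^sup>+\<omega>. Z N \<omega> \<partial>M) / of_nat N) \<longlonglongrightarrow> 0 \<and>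
    (\<forall>N. \<forall>\<omega>\<in>space M. ennreal \<bar>(\<Sum>k<N. indicator (src_event j) (W k \<omega>)) - real N * q j\<bar> \<le> Z N \<omega>)"
  proof
    fix j assume "j \<in> {..<J}"
    then have j: "j < J" by simp
    \<comment> \<open>A single function, as a class with a one-point index set: the observed
      frequency of source \<open>j\<close> obeys the law of large numbers.\<close>
    have "mean_gc Pt {()} (\<lambda>_. indicator (src_event j))"
      by (rule mean_gc_bounded[OF prob_space_Pt, where C = 1]) (use src_event_sets[OF j] in \<open>auto split: split_indicator\<close>)
    from mean_gc_sample[OF this]
    show "\<exists>Z. (\<forall>N. Z N \<in> borel_measurable M) \<and> (\<lambda>N. (\<integral>\<^sup>+\<omega>. Z N \<omega> \<partial>M) / of_nat N) \<longlonglongrightarrow> 0 \<and>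
      (\<forall>N. \<forall>\<omega>\<in>space M. ennreal \<bar>(\<Sum>k<N. indicator (src_event j) (W k \<omega>)) - real N * q j\<bar> \<le> Z N \<omega>)"
      using src_event_sets[OF j] by (simp add: q_def)
  qed
  from bchoice[OF this] obtain Z where Z_all: "\<forall>j\<in>{..<J}. (\<forall>N. Z j N \<in> borel_measurable M) \<and>
    (\<lambda>N. (\<integral>\<^sup>+\<omega>. Z j N \<omega> \<partial>M) / of_nat N) \<longlonglongrightarrow> 0 \<and>
    (\<forall>N. \<forall>\<omega>\<in>space M. ennreal \<bar>(\<Sum>k<N. indicator (src_event j) (W k \<omega>)) - real N * q j\<bar> \<le> Z j N \<omega>)" ..
  have Z: "Z j N \<in> borel_measurable M" and Z_lim: "(\<lambda>N. (\<integral>\<^sup>+\<omega>. Z j N \<omega> \<partial>M) / of_nat N) \<longlonglongrightarrow> 0"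
    if "j < J" for j N
    using bspec[OF Z_all, of j] that by simp_all
  have Z_le: "ennreal \<bar>(\<Sum>k<N. indicator (src_event j) (W k \<omega>)) - real N * q j\<bar> \<le> Z j N \<omega>"
    if "j < J" "\<omega> \<in> space M" for j N \<omega>
    using bspec[OF Z_all, of j] that by simp
  \<comment> \<open>The sum of the error constants of the sources. The denominator
    \<open>K + 1\<close> in \<open>\<delta>\<close> makes the total error strictly smaller than
    \<open>\<epsilon>\<close>, also when \<open>K = 0\<close>.\<close>
  define K where "K = (\<Sum>j<J. 2 / c + \<bar>C\<bar> / q j)"
  have K: "0 \<le> K"
    unfolding K_def using c_pos q by (intro sum_nonneg add_nonneg_nonneg divide_nonneg_nonneg) (auto intro: less_imp_le)
  define \<delta> where "\<delta> = \<epsilon> / (K + 1)"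
  have \<delta>: "0 < \<delta>" "K * \<delta> < \<epsilon>" using K \<epsilon> by (auto simp: \<delta>_def field_simps)
  let ?good = "\<lambda>N \<omega>. (\<forall>i. V i \<omega> \<in> (\<Union>k<J. src k)) \<and> (\<forall>j\<in>{..<J}. S N j \<omega> \<subseteq> units N j \<omega> \<and> card (S N j \<omega>) = n_src N j \<omega>)"
  define E0 where "E0 N = {\<omega> \<in> space M. \<not> ?good N \<omega>}" for N
  define E where "E j N = {\<omega> \<in> space M. ennreal (\<delta> * real N) < Y j N \<omega>} \<union>
      ({\<omega> \<in> space M. ennreal (\<delta> * real N) < Z j N \<omega>} \<union>
       {\<omega> \<in> space M. c / 2 < \<bar>real (n_src N j \<omega>) / real (N_src N j \<omega>) - p j\<bar>})" for j N
  have E0_lim: "(\<lambda>N. outer_measure_of M (E0 N)) \<longlonglongrightarrow> 0"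
  proof (rule tendsto_eventually, rule eventually_sequentiallyI[of 1])
    fix N :: nat assume "1 \<le> N"
    then have N: "0 < N" by simp
    have "AE \<omega> in M. \<forall>i. V i \<omega> \<in> (\<Union>k<J. src k)"
      unfolding V_def by (rule AE_W[OF V_in_union])
    moreover have "AE \<omega> in M. \<forall>j\<in>{..<J}. S N j \<omega> \<subseteq> units N j \<omega> \<and> card (S N j \<omega>) = n_src N j \<omega>"
      by (rule AE_finite_allI) (use AE_sample_drawn[OF N] in auto)
    ultimately have "AE \<omega> in M. ?good N \<omega>" by (rule AE_conjI)
    from outer_measure_of_AE_eq_0[OF this] show "outer_measure_of M (E0 N) = 0"
      by (simp only: E0_def)
  qed
  have E_lim: "(\<lambda>N. outer_measure_of M (\<Union>j\<in>{..<J}. E j N)) \<longlonglongrightarrow> 0"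
  proof (rule outer_measure_of_tendsto_UN)
    fix j assume "j \<in> {..<J}"
    then have j: "j < J" by simp
    show "(\<lambda>N. outer_measure_of M (E j N)) \<longlonglongrightarrow> 0"
      unfolding E_def
      by (intro outer_measure_of_tendsto_Un outer_measure_of_tendsto_Markov Y[OF j] Z[OF j] Y_lim[OF j] Z_lim[OF j]
          \<delta> fraction_outer_tendsto[OF j]) (use c_pos in auto)
  qed (auto simp: E_def)
  show ?thesis
  proof (rule outer_measure_of_tendsto_subset)
    show "(\<lambda>N. outer_measure_of M (E0 N \<union> (\<Union>j\<in>{..<J}. E j N))) \<longlonglongrightarrow> 0"
      by (intro outer_measure_of_tendsto_Un E0_lim E_lim) (auto simp: E0_def E_def)
  next
    fix N :: nat assume N: "0 < N"
    show "{\<omega> \<in> space M. \<exists>i\<in>I. \<epsilon> < \<bar>H_empirical J \<rho> N \<omega> (f i) - (\<integral>w. f i (fst w) \<partial>Pt)\<bar>} \<subseteq> E0 N \<union> (\<Union>j\<in>{..<J}. E j N)"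
    proof (intro subsetI, rule ccontr)
      fix \<omega> assume "\<omega> \<in> {\<omega> \<in> space M. \<exists>i\<in>I. \<epsilon> < \<bar>H_empirical J \<rho> N \<omega> (f i) - (\<integral>w. f i (fst w) \<partial>Pt)\<bar>}"
      then obtain i where \<omega>: "\<omega> \<in> space M" and i: "i \<in> I"
        and large: "\<epsilon> < \<bar>H_empirical J \<rho> N \<omega> (f i) - (\<integral>w. f i (fst w) \<partial>Pt)\<bar>" by blast
      assume "\<omega> \<notin> E0 N \<union> (\<Union>j\<in>{..<J}. E j N)"
      then have good: "?good N \<omega>" and notE: "\<And>j. j < J \<Longrightarrow> \<omega> \<notin> E j N"
        using \<omega> unfolding E0_def by blast+
      define t where "t j = (\<Sum>k<N. R N j k \<omega> * \<rho> j (V k \<omega>) / sel_prob N j \<omega> (V k \<omega>) * f i (X k \<omega>)) / real N" for j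
      have t: "\<bar>t j - \<mu> j i\<bar> \<le> (2 / c + \<bar>C\<bar> / q j) * \<delta>" if j: "j < J" for j
        unfolding t_def q_def
      proof (rule source_term_error[OF N j \<omega>])
        show "S N j \<omega> \<subseteq> units N j \<omega>" "card (S N j \<omega>) = n_src N j \<omega>" "V k \<omega> \<in> (\<Union>k<J. src k)" for k
          using good j by auto
        show "\<bar>real (n_src N j \<omega>) / real (N_src N j \<omega>) - p j\<bar> \<le> c / 2"
          using notE[OF j] \<omega> unfolding E_def by auto
        show "\<mu> j i = (\<integral>w. weight j w * f i (fst w) \<partial>Pt)"
          by (simp add: \<mu>_def h_def)
        show "\<bar>\<mu> j i\<bar> \<le> \<bar>C\<bar>" by (rule \<mu>_le[OF j i])
        have "Y j N \<omega> \<le> ennreal (\<delta> * real N)" using notE[OF j] \<omega> unfolding E_def by (auto simp: not_less)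
        from order_trans[OF Y_le[OF j N \<omega> i] this]
        show "\<bar>\<Sum>k\<in>S N j \<omega>. indicator (src_event j) (W k \<omega>) *
           (weight j (W k \<omega>) * f i (fst (W k \<omega>)) - \<mu> j i / measure Pt (src_event j))\<bar> \<le> \<delta> * real N"
          using \<delta> by (simp add: h_def q_def)
        have "Z j N \<omega> \<le> ennreal (\<delta> * real N)" using notE[OF j] \<omega> unfolding E_def by (auto simp: not_less)
        from order_trans[OF Z_le[OF j \<omega>] this]
        show "\<bar>(\<Sum>k<N. indicator (src_event j) (W k \<omega>)) - real N * measure Pt (src_event j)\<bar> \<le> \<delta> * real N"
          using \<delta> by (simp add: q_def)
      qed
      have "H_empirical J \<rho> N \<omega> (f i) = (\<Sum>j<J. t j)"
        unfolding H_empirical_def t_def by (subst sum.swap) (simp add: sum_divide_distrib)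
      then have "\<bar>H_empirical J \<rho> N \<omega> (f i) - (\<integral>w. f i (fst w) \<partial>Pt)\<bar> = \<bar>\<Sum>j<J. t j - \<mu> j i\<bar>"
        by (simp add: sum_\<mu>[OF i, symmetric] sum_subtractf)
      also have "\<dots> \<le> (\<Sum>j<J. \<bar>t j - \<mu> j i\<bar>)" by (rule sum_abs)
      also have "\<dots> \<le> (\<Sum>j<J. (2 / c + \<bar>C\<bar> / q j) * \<delta>)" using t by (intro sum_mono) simp
      also have "\<dots> = K * \<delta>" by (simp add: K_def sum_distrib_right)
      finally show False using large \<delta>(2) by linarith
    qed
  qed
qed

lemma H_empirical_affine:
  "H_empirical J \<rho> N \<omega> (\<lambda>x. f x + a) = H_empirical J \<rho> N \<omega> f + a * H_empirical J \<rho> N \<omega> (\<lambda>_. 1)"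
proof -
  have "(\<Sum>i<N. \<Sum>j<J. R N j i \<omega> * \<rho> j (V i \<omega>) / sel_prob N j \<omega> (V i \<omega>) * (f (X i \<omega>) + a))
      = (\<Sum>i<N. \<Sum>j<J. R N j i \<omega> * \<rho> j (V i \<omega>) / sel_prob N j \<omega> (V i \<omega>) * f (X i \<omega>))
        + a * (\<Sum>i<N. \<Sum>j<J. R N j i \<omega> * \<rho> j (V i \<omega>) / sel_prob N j \<omega> (V i \<omega>) * 1)"
    by (simp add: sum_distrib_left sum.distrib[symmetric] algebra_simps add_divide_distrib)
  then show ?thesis
    unfolding H_empirical_def by (simp only: add_divide_distrib times_divide_eq_right)
qed

end

section \<open>Consistency of the M-estimator\<close>

theorem theorem5p1:
  fixes M :: "'w measure" and MX :: "'x measure" and MU :: "'u measure" and MC :: "'c measure"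
    and coarsen :: "'x \<Rightarrow> 'c" and W :: "nat \<Rightarrow> 'w \<Rightarrow> 'x \<times> 'u"
    and src :: "nat \<Rightarrow> ('c \<times> 'u) set" and size :: "nat \<Rightarrow> nat \<Rightarrow> nat \<Rightarrow> nat"
    and S :: "nat \<Rightarrow> nat \<Rightarrow> 'w \<Rightarrow> nat set"
    and Pt :: "('x \<times> 'u) measure" and J :: nat and \<rho> :: "nat \<Rightarrow> 'c \<times> 'u \<Rightarrow> real"
    and p :: "nat \<Rightarrow> real" and c :: real
    and \<Theta> :: "'b::banach set" and \<theta>\<^sub>0 :: 'b and P :: "'b \<Rightarrow> 'x measure"
    and m :: "'b \<Rightarrow> 'x \<Rightarrow> real" and \<theta>hat :: "nat \<Rightarrow> 'w \<Rightarrow> 'b"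
  assumes "merged_sampling M coarsen W src size S MX MU MC Pt J \<rho> p c"
    and "\<And>\<theta>. \<theta> \<in> \<Theta> \<Longrightarrow> prob_space (P \<theta>) \<and> sets (P \<theta>) = sets MX"
    and "\<theta>\<^sub>0 \<in> \<Theta>"
    and "distr Pt MX fst = P \<theta>\<^sub>0"
    and "glivenko_cantelli (P \<theta>\<^sub>0) (m ` \<Theta>)"
    and "\<And>\<epsilon>. \<epsilon> > 0 \<Longrightarrow>
           ereal (\<integral>x. m \<theta>\<^sub>0 x \<partial>P \<theta>\<^sub>0) >
           (SUP \<theta>\<in>{\<theta>\<in>\<Theta>. norm (\<theta> - \<theta>\<^sub>0) > \<epsilon>}. ereal (\<integral>x. m \<theta> x \<partial>P \<theta>\<^sub>0))"
    and "\<And>N \<omega>. \<omega> \<in> space M \<Longrightarrow>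
           is_arg_max (\<lambda>\<theta>. merged_data.H_empirical coarsen W src size S J \<rho> N \<omega> (m \<theta>))
             (\<lambda>\<theta>. \<theta> \<in> \<Theta>) (\<theta>hat N \<omega>)"
  shows "converges_in_outer_prob_0 M (\<lambda>N \<omega>. norm (\<theta>hat N \<omega> - \<theta>\<^sub>0))"
proof -
  interpret merged_sampling M coarsen W src size S MX MU MC Pt J \<rho> p c by fact
  interpret Q: prob_space Pt by (rule prob_space_Pt)
  let ?P = "P \<theta>\<^sub>0"
  have fst[measurable]: "fst \<in> Pt \<rightarrow>\<^sub>M MX"
    by (simp add: measurable_cong_sets[OF sets_Pt refl])
  have P: "prob_space ?P" using assms(2,3) by blast
  define \<mu> where "\<mu> \<theta> = (\<integral>x. m \<theta> x \<partial>?P)" for \<theta>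
  define g where "g \<theta> x = m \<theta> x - \<mu> \<theta>" for \<theta> x
  have m_gc: "mean_gc ?P \<Theta> m"
    using mean_gc_reindex[OF glivenko_cantelli_mean_gc[OF P assms(5)]] .
  have g_gc: "mean_gc ?P \<Theta> g"
    unfolding g_def[abs_def] \<mu>_def by (rule mean_gc_center[OF P m_gc])
  have g_Pt: "mean_gc Pt \<Theta> (\<lambda>\<theta> w. g \<theta> (fst w))"
    by (rule mean_gc_distr[OF prob_space_Pt fst]) (simp add: assms(4) g_gc)
  obtain H where H: "H \<in> borel_measurable ?P" and H_fin: "(\<integral>\<^sup>+x. H x \<partial>?P) < \<infinity>"
    and H_le: "\<And>f x. f \<in> m ` \<Theta> \<Longrightarrow> x \<in> space ?P \<Longrightarrow> ennreal \<bar>f x - (\<integral>z. f z \<partial>?P)\<bar> \<le> H x"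
    using gc_envelope[OF P assms(5)] by blast
  have gi: "integrable ?P (g \<theta>)" if "\<theta> \<in> \<Theta>" for \<theta>
    using mean_gc_integrable[OF g_gc that] .
  have to_P: "(\<integral>w. u (fst w) \<partial>Pt) = (\<integral>x. u x \<partial>?P)" if "u \<in> borel_measurable ?P" for u :: "'x \<Rightarrow> real"
    using integral_distr[OF fst, of u] that unfolding assms(4)[symmetric] by simp
  \<comment> \<open>The envelope does not depend on \<open>\<theta>\<close>, so its integral is a
    common bound on the first absolute moments.\<close>
  have g_bound: "(\<integral>w. \<bar>g \<theta> (fst w)\<bar> \<partial>Pt) \<le> enn2real (\<integral>\<^sup>+x. H x \<partial>?P)" if \<theta>: "\<theta> \<in> \<Theta>" for \<theta>
  proof -
    have [measurable]: "g \<theta> \<in> borel_measurable ?P" using gi[OF \<theta>] by auto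
    have "(\<integral>w. \<bar>g \<theta> (fst w)\<bar> \<partial>Pt) = (\<integral>x. \<bar>g \<theta> x\<bar> \<partial>?P)"
      by (rule to_P) measurable
    also have "\<dots> = enn2real (\<integral>\<^sup>+x. ennreal \<bar>g \<theta> x\<bar> \<partial>?P)"
      by (rule integral_eq_nn_integral) auto
    also have "\<dots> \<le> enn2real (\<integral>\<^sup>+x. H x \<partial>?P)"
    proof (rule enn2real_mono)
      show "(\<integral>\<^sup>+x. ennreal \<bar>g \<theta> x\<bar> \<partial>?P) \<le> (\<integral>\<^sup>+x. H x \<partial>?P)"
        using H_le[of "m \<theta>"] \<theta> by (intro nn_integral_mono) (auto simp: g_def \<mu>_def)
    qed (use H_fin in simp)
    finally show ?thesis .
  qed
  have g_0: "(\<integral>w. g \<theta> (fst w) \<partial>Pt) = 0" if "\<theta> \<in> \<Theta>" for \<theta>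
  proof -
    interpret P0: prob_space ?P by (rule P)
    have "(\<integral>w. g \<theta> (fst w) \<partial>Pt) = (\<integral>x. g \<theta> x \<partial>?P)"
      by (rule to_P) (use gi[OF that] in auto)
    also have "\<dots> = 0"
      unfolding g_def using mean_gc_integrable[OF m_gc that] by (simp add: \<mu>_def P0.prob_space)
    finally show ?thesis .
  qed
  have H_m: "H_empirical J \<rho> N \<omega> (m \<theta>) = H_empirical J \<rho> N \<omega> (g \<theta>) + \<mu> \<theta> * H_empirical J \<rho> N \<omega> (\<lambda>_. 1)" for N \<omega> \<theta>
    using H_empirical_affine[of N \<omega> "g \<theta>" "\<mu> \<theta>"] by (simp add: g_def)
  show ?thesis
    unfolding converges_in_outer_prob_0_def
  proof (intro allI impI)
    fix \<epsilon> :: real assume \<epsilon>: "0 < \<epsilon>"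
    \<comment> \<open>The supremum is \<open>-\<infinity>\<close> if no parameter is that far away;
      in any case a real number lies strictly in between and turns the strict inequality into a gap
      \<open>\<delta>\<close>.\<close>
    obtain b where b: "(SUP \<theta>\<in>{\<theta>\<in>\<Theta>. norm (\<theta> - \<theta>\<^sub>0) > \<epsilon>}. ereal (\<mu> \<theta>)) < ereal b" "ereal b < ereal (\<mu> \<theta>\<^sub>0)"
      using ereal_dense2[OF assms(6)[OF \<epsilon>, folded \<mu>_def]] by blast
    define \<delta> where "\<delta> = \<mu> \<theta>\<^sub>0 - b"
    have \<delta>: "0 < \<delta>" using b(2) by (simp add: \<delta>_def)
    have gap: "\<mu> \<theta> \<le> \<mu> \<theta>\<^sub>0 - \<delta>" if "\<theta> \<in> \<Theta>" "\<epsilon> < norm (\<theta> - \<theta>\<^sub>0)" for \<theta>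
    proof -
      have "ereal (\<mu> \<theta>) \<le> (SUP \<theta>\<in>{\<theta>\<in>\<Theta>. norm (\<theta> - \<theta>\<^sub>0) > \<epsilon>}. ereal (\<mu> \<theta>))"
        by (rule SUP_upper) (use that in auto)
      also have "\<dots> < ereal b" by (rule b(1))
      finally show ?thesis by (simp add: \<delta>_def)
    qed
    \<comment> \<open>Outside \<open>A N\<close> and \<open>B N\<close> the total weight is at least
      \<open>1 / 2\<close>. A distant maximizer would then have \<open>\<delta> / 2\<close> as a
      lower and \<open>\<delta> / 8 + \<delta> / 8\<close> as an upper bound for the same product of
      mean gap and total weight.\<close>
    define A where "A N = {\<omega> \<in> space M. \<exists>\<theta>\<in>\<Theta>. \<delta> / 8 < \<bar>H_empirical J \<rho> N \<omega> (g \<theta>) - (\<integral>w. g \<theta> (fst w) \<partial>Pt)\<bar>}" for N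
    define B where "B N = {\<omega> \<in> space M. \<exists>u\<in>{()}. 1 / 2 < \<bar>H_empirical J \<rho> N \<omega> (\<lambda>_. 1) - (\<integral>w. 1 \<partial>Pt)\<bar>}" for N
    have A_lim: "(\<lambda>N. outer_measure_of M (A N)) \<longlonglongrightarrow> 0"
      unfolding A_def by (rule H_empirical_glivenko_cantelli[OF g_Pt g_bound]) (use \<delta> in auto)
    have B_lim: "(\<lambda>N. outer_measure_of M (B N)) \<longlonglongrightarrow> 0"
      unfolding B_def
      by (rule H_empirical_glivenko_cantelli[where C = 1, OF mean_gc_bounded[OF prob_space_Pt, where C = 1]])
         (auto simp: Q.prob_space)
    show "(\<lambda>N. outer_measure_of M {\<omega> \<in> space M. \<epsilon> < \<bar>norm (\<theta>hat N \<omega> - \<theta>\<^sub>0)\<bar>}) \<longlonglongrightarrow> 0"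
    proof (rule outer_measure_of_tendsto_subset)
      show "(\<lambda>N. outer_measure_of M (A N \<union> B N)) \<longlonglongrightarrow> 0"
        by (rule outer_measure_of_tendsto_Un[OF _ A_lim _ B_lim]) (auto simp: A_def B_def)
    next
      fix N
      show "{\<omega> \<in> space M. \<epsilon> < \<bar>norm (\<theta>hat N \<omega> - \<theta>\<^sub>0)\<bar>} \<subseteq> A N \<union> B N"
      proof (intro subsetI, rule ccontr)
        fix \<omega> assume "\<omega> \<in> {\<omega> \<in> space M. \<epsilon> < \<bar>norm (\<theta>hat N \<omega> - \<theta>\<^sub>0)\<bar>}"
        then have \<omega>: "\<omega> \<in> space M" and far: "\<epsilon> < norm (\<theta>hat N \<omega> - \<theta>\<^sub>0)" by auto
        assume out: "\<omega> \<notin> A N \<union> B N"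
        let ?\<theta> = "\<theta>hat N \<omega>" and ?H = "H_empirical J \<rho> N \<omega>"
        have \<theta>: "?\<theta> \<in> \<Theta>" and max: "?H (m \<theta>\<^sub>0) \<le> ?H (m ?\<theta>)"
          using assms(7)[OF \<omega>, of N] assms(3) by (auto simp: is_arg_max_def not_less)
        have small: "\<bar>?H (g \<theta>)\<bar> \<le> \<delta> / 8" if "\<theta> \<in> \<Theta>" for \<theta>
          using out \<omega> that g_0[OF that] unfolding A_def by (force simp: not_less)
        have one: "1 / 2 \<le> ?H (\<lambda>_. 1)"
        proof -
          have "\<bar>?H (\<lambda>_. 1) - 1\<bar> \<le> 1 / 2"
            using out \<omega> unfolding B_def by (auto simp: Q.prob_space not_less)
          then show ?thesis by linarith
        qed
        have "\<delta> * (1 / 2) \<le> (\<mu> \<theta>\<^sub>0 - \<mu> ?\<theta>) * ?H (\<lambda>_. 1)"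
          using gap[OF \<theta> far] one \<delta> by (intro mult_mono) auto
        also have "\<dots> \<le> ?H (g ?\<theta>) - ?H (g \<theta>\<^sub>0)"
          using max by (simp add: H_m algebra_simps)
        also have "\<dots> \<le> \<delta> / 8 + \<delta> / 8"
          using small[OF \<theta>] small[OF assms(3)] by linarith
        finally show False using \<delta> by simp
      qed
    qed
  qed
qed

end
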